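(* Let $\mathbb{D}\in\mathbb{R}^{M\times M}$ satisfy $\mathbb{D}+\mathbb{D}^T\le 0$, let $r\ge 1$ be an integer and let $s\ge 1$. Let $\mathbf{Y}$ be the solution of $\mathbf{Y}'=\mathbb{D}\mathbf{Y}+\mathbf{R}$ in $(0,T)$, $\mathbf{Y}(0)=\mathbf{Y}_0$, and assume that $\mathbb{D}^r\mathbf{Y}\in[H^s(0,T)]^M$. Let $\mathbf{Y}_r\in\mathbf{V}_\tau^r$ be the solution of the continuous time Galerkin method: $\mathbf{Y}_r(0)=\mathbf{Y}_0$ and $\mathbf{Y}_r'=\mathbb{D}\mathcal{P}_{r-1}\mathbf{Y}_r+\mathcal{P}_{r-1}\mathbf{R}$ in $I_n$, $0\le n\le N-1$. Then $$\max_{1\le n\le N}\|(\mathbf{Y}-\mathbf{Y}_r)(t_n)\|_{\mathbb{R}^M}\le CT^{1/2}\frac{\tau^{\min(2r,s+r-1)}}{r^s}\|\mathbb{D}^r\mathbf{Y}\|_{H^s(0,T)},$$ where the constant $C$ is independent of $\tau,r$ but may depend on $s$.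
   Context: $T>0$; $M\ge 1$; $\mathbf{R}\in[L^2(0,T)]^M$; $\mathbb{D}+\mathbb{D}^T\le 0$ means negative semidefinite. $0=t_0<t_1<\cdots<t_N=T$ is a partition, $I_n=(t_n,t_{n+1})$, $\tau_n=t_{n+1}-t_n$, $\tau=\max_{0\le n\le N-1}\tau_n$. $P^m$ is the set of polynomials of degree at most $m$. $\mathbf{V}_\tau^m$ ($m\ge 1$) is the space of continuous functions $\mathbf{v}:[0,T]\to\mathbb{R}^M$ with $\mathbf{v}|_{I_n}\in[P^m]^M$ for all $0\le n\le N-1$. For $m\ge 0$, $\mathcal{P}_m$ is the local $L^2$ projection: on each $I_n$, $\mathcal{P}_m\mathbf{v}\in[P^m]^M$ and $\int_{I_n}(\mathcal{P}_m\mathbf{v},\mathbf{w})\,dt=\int_{I_n}(\mathbf{v},\mathbf{w})\,dt$ for all $\mathbf{w}\in[P^m]^M$. The discrete problem has a unique solution. $H^s$ is the usual Sobolev space; the norm of a vector-valued function in $[X]^M$ is written $\|\cdot\|_X$. As usual, the generic constant $C$ does not depend on the data $\mathbf{Y}_0,\mathbf{R}$ or on the solution. *)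

theory Defs
  imports "HOL-Analysis.Analysis"
begin

section \<open>Sobolev spaces on a bounded interval\<close>

text \<open>Functions on the open interval from a to b are total functions whose values outside the
  interval play no role. Membership in the spaces below concerns representatives,
  not equivalence classes.\<close>

definition L2_space :: "real \<Rightarrow> real \<Rightarrow> (real \<Rightarrow> real) set" where
  "L2_space a b = {u. u \<in> borel_measurable (lebesgue_on {a<..<b}) \<and>
                      integrable (lebesgue_on {a<..<b}) (\<lambda>x. (u x)\<^sup>2)}"

text \<open>Continuously differentiable functions with compact support in the open interval, given
  together with their derivative.\<close>

definition test_function :: "real \<Rightarrow> real \<Rightarrow> (real \<Rightarrow> real) \<Rightarrow> (real \<Rightarrow> real) \<Rightarrow> bool" where
  "test_function a b \<phi> \<phi>' \<longleftrightarrow>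
     (\<forall>x. (\<phi> has_real_derivative \<phi>' x) (at x)) \<and> continuous_on UNIV \<phi>' \<and>
     (\<exists>c d. a < c \<and> d < b \<and> (\<forall>x. x \<notin> {c..d} \<longrightarrow> \<phi> x = 0))"

text \<open>The weak derivative in one dimension, as in Brezis, Functional Analysis, Sobolev Spaces and
  Partial Differential Equations, Section 8.2 (once continuously differentiable test functions).
  It is meaningful for locally integrable u and v; below it is only used for functions in L2.\<close>

definition has_weak_derivative ::
  "real \<Rightarrow> real \<Rightarrow> (real \<Rightarrow> real) \<Rightarrow> (real \<Rightarrow> real) \<Rightarrow> bool" where
  "has_weak_derivative a b u v \<longleftrightarrow>
     (\<forall>\<phi> \<phi>'. test_function a b \<phi> \<phi>' \<longrightarrow>
        integral\<^sup>L (lebesgue_on {a<..<b}) (\<lambda>x. u x * \<phi>' x) =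
        - integral\<^sup>L (lebesgue_on {a<..<b}) (\<lambda>x. v x * \<phi> x))"

text \<open>A weak derivative is unique up to a null set, so the choice does not affect the norms.\<close>

definition weak_deriv :: "real \<Rightarrow> real \<Rightarrow> (real \<Rightarrow> real) \<Rightarrow> real \<Rightarrow> real" where
  "weak_deriv a b u = (SOME v. v \<in> L2_space a b \<and> has_weak_derivative a b u v)"

fun sobolev_int :: "real \<Rightarrow> real \<Rightarrow> nat \<Rightarrow> (real \<Rightarrow> real) set" where
  "sobolev_int a b 0 = L2_space a b"
| "sobolev_int a b (Suc k) =
     {u \<in> L2_space a b. \<exists>v \<in> sobolev_int a b k. has_weak_derivative a b u v}"

text \<open>The integrand of the squared Sobolev-Slobodeckij seminorm of order \<theta> strictly between 0
  and 1. On the diagonal, which is a null set, it takes the value 0.\<close>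

definition slobodeckij_integrand :: "real \<Rightarrow> (real \<Rightarrow> real) \<Rightarrow> real \<times> real \<Rightarrow> real" where
  "slobodeckij_integrand \<theta> w = (\<lambda>(x, y). (w x - w y)\<^sup>2 / \<bar>x - y\<bar> powr (1 + 2 * \<theta>))"

definition sobolev_space :: "real \<Rightarrow> real \<Rightarrow> real \<Rightarrow> (real \<Rightarrow> real) set" where
  "sobolev_space a b s =
     {u \<in> sobolev_int a b (nat \<lfloor>s\<rfloor>).
        frac s \<noteq> 0 \<longrightarrow>
        integrable (lebesgue_on {a<..<b} \<Otimes>\<^sub>M lebesgue_on {a<..<b})
          (slobodeckij_integrand (frac s) ((weak_deriv a b ^^ nat \<lfloor>s\<rfloor>) u))}"

definition sobolev_norm :: "real \<Rightarrow> real \<Rightarrow> real \<Rightarrow> (real \<Rightarrow> real) \<Rightarrow> real" where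
  "sobolev_norm a b s u = sqrt (
     (\<Sum>j\<le>nat \<lfloor>s\<rfloor>. integral\<^sup>L (lebesgue_on {a<..<b}) (\<lambda>x. ((weak_deriv a b ^^ j) u x)\<^sup>2)) +
     (if frac s = 0 then 0
      else integral\<^sup>L (lebesgue_on {a<..<b} \<Otimes>\<^sub>M lebesgue_on {a<..<b})
             (slobodeckij_integrand (frac s) ((weak_deriv a b ^^ nat \<lfloor>s\<rfloor>) u))))"

definition L2_vec :: "real \<Rightarrow> real \<Rightarrow> (real \<Rightarrow> real^'m) set" where
  "L2_vec a b = {u. \<forall>i. (\<lambda>x. u x $ i) \<in> L2_space a b}"

definition sobolev_vec :: "real \<Rightarrow> real \<Rightarrow> real \<Rightarrow> (real \<Rightarrow> real^'m) set" where
  "sobolev_vec a b s = {u. \<forall>i. (\<lambda>x. u x $ i) \<in> sobolev_space a b s}"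

definition sobolev_vec_norm :: "real \<Rightarrow> real \<Rightarrow> real \<Rightarrow> (real \<Rightarrow> real^'m) \<Rightarrow> real" where
  "sobolev_vec_norm a b s u = sqrt (\<Sum>i\<in>UNIV. (sobolev_norm a b s (\<lambda>x. u x $ i))\<^sup>2)"

section \<open>The continuous problem\<close>

definition neg_semidef :: "real^'m^'m \<Rightarrow> bool" where
  "neg_semidef A \<longleftrightarrow> (\<forall>x. x \<bullet> (A *v x) \<le> 0)"

text \<open>Since the source term is only square integrable, the equation holds in the sense of weak
  derivatives, for the continuous representative of Y.\<close>

definition solves_ode ::
  "real \<Rightarrow> real^'m^'m \<Rightarrow> (real \<Rightarrow> real^'m) \<Rightarrow> real^'m \<Rightarrow> (real \<Rightarrow> real^'m) \<Rightarrow> bool" where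
  "solves_ode T D R Y0 Y \<longleftrightarrow>
     continuous_on {0..T} Y \<and> Y 0 = Y0 \<and>
     (\<forall>i. has_weak_derivative 0 T (\<lambda>x. Y x $ i) (\<lambda>x. (D *v Y x + R x) $ i))"

section \<open>The discrete problem\<close>

definition is_partition :: "real \<Rightarrow> nat \<Rightarrow> (nat \<Rightarrow> real) \<Rightarrow> bool" where
  "is_partition T N t \<longleftrightarrow> N \<ge> 1 \<and> t 0 = 0 \<and> t N = T \<and> (\<forall>n<N. t n < t (Suc n))"

definition subint :: "(nat \<Rightarrow> real) \<Rightarrow> nat \<Rightarrow> real set" where
  "subint t n = {t n <..< t (Suc n)}"

definition mesh_size :: "nat \<Rightarrow> (nat \<Rightarrow> real) \<Rightarrow> real" where
  "mesh_size N t = Max ((\<lambda>n. t (Suc n) - t n) ` {..<N})"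

definition vec_poly_on :: "nat \<Rightarrow> real set \<Rightarrow> (real \<Rightarrow> real^'m) \<Rightarrow> bool" where
  "vec_poly_on m S v \<longleftrightarrow>
     (\<exists>p :: 'm \<Rightarrow> real poly. \<forall>i. degree (p i) \<le> m \<and> (\<forall>x\<in>S. v x $ i = poly (p i) x))"

definition V_space :: "real \<Rightarrow> nat \<Rightarrow> (nat \<Rightarrow> real) \<Rightarrow> nat \<Rightarrow> (real \<Rightarrow> real^'m) set" where
  "V_space T N t m = {v. continuous_on {0..T} v \<and> (\<forall>n<N. vec_poly_on m (subint t n) v)}"

text \<open>The local L2 projection, as a relation: it determines w on every open subinterval, and
  leaves the values at the nodes free.\<close>

definition is_local_proj ::
  "nat \<Rightarrow> (nat \<Rightarrow> real) \<Rightarrow> nat \<Rightarrow> (real \<Rightarrow> real^'m) \<Rightarrow> (real \<Rightarrow> real^'m) \<Rightarrow> bool" where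
  "is_local_proj N t m v w \<longleftrightarrow>
     (\<forall>n<N. vec_poly_on m (subint t n) w \<and>
        (\<forall>q. vec_poly_on m (subint t n) q \<longrightarrow>
           integral\<^sup>L (lebesgue_on (subint t n)) (\<lambda>x. w x \<bullet> q x) =
           integral\<^sup>L (lebesgue_on (subint t n)) (\<lambda>x. v x \<bullet> q x)))"

definition galerkin_solution ::
  "real \<Rightarrow> real^'m^'m \<Rightarrow> (real \<Rightarrow> real^'m) \<Rightarrow> real^'m \<Rightarrow> nat \<Rightarrow> (nat \<Rightarrow> real) \<Rightarrow> nat \<Rightarrow>
   (real \<Rightarrow> real^'m) \<Rightarrow> bool" where
  "galerkin_solution T D R Y0 N t r Yr \<longleftrightarrow>
     Yr \<in> V_space T N t r \<and> Yr 0 = Y0 \<and>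
     (\<exists>PY PR. is_local_proj N t (r - 1) Yr PY \<and> is_local_proj N t (r - 1) R PR \<and>
        (\<forall>n<N. \<forall>x\<in>subint t n. (Yr has_vector_derivative (D *v PY x + PR x)) (at x)))"

end

theory Submission
  imports Defs "HOL-Computational_Algebra.Fundamental_Theorem_Algebra"
begin

text \<open>The nodal error is estimated by duality with the discrete adjoint problem
  \<open>\<phi>' = - D\<^sup>T P \<phi>\<close> on each subinterval, \<open>P\<close> being the local projection of degree \<open>r - 1\<close>. Testing the
  error with \<open>\<phi>\<close> leaves only the moment of \<open>Y'\<close> against \<open>(I - P) \<phi>\<close>, a multiple of the Legendre
  polynomial \<open>L\<close> of degree \<open>r\<close>. With \<open>A = - D\<^sup>T\<close>, the solutions are
  \<open>\<phi> = (\<Sum>j\<le>r. L\<^sup>(\<^sup>j\<^sup>) A\<^sup>r\<^sup>-\<^sup>j \<psi>)\<close> and \<open>(I - P) \<phi> = L A\<^sup>r \<psi>\<close>, so the powers of \<open>D\<close>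
  move onto \<open>Y\<close>. The zeros of the scalar characteristic polynomial \<open>\<Sum>j\<le>r. L\<^sup>(\<^sup>j\<^sup>)(b) z\<^sup>r\<^sup>-\<^sup>j\<close>
  have real part at most \<open>- 2 / (b - a)\<close>; factoring it shows that \<open>\<psi>\<close> is smaller than \<open>\<phi>(b)\<close>
  by the factor \<open>((b - a) / 2)\<^sup>r\<close>, up to the normalisation of \<open>L\<close>. This is the second half of
  the order in \<open>\<tau>\<close>, and \<open>2\<^sup>-\<^sup>r\<close> absorbs \<open>r\<^sup>-\<^sup>s\<close>, so the first half needs no estimate that is sharp in
  \<open>r\<close>: the moment of \<open>(D\<^sup>r Y)'\<close> against \<open>L\<close> is integrated by parts with the Rodrigues formula.\<close>

section \<open>Legendre polynomials on an interval\<close>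

text \<open>Since \<open>R\<close> is only square integrable, \<open>Y\<close> itself is only known
  to have one weak derivative; higher regularity is available only for the r-th power of
  \<open>D\<close> applied to \<open>Y\<close>, and \<open>D\<close> may be singular. The powers of
  \<open>D\<close> must therefore come out of the dual solution, which is why it is written through
  \<psi> and not through its terminal value. Semidefiniteness acts twice. It bounds the dual
  solution at the left node by its value at the right node with factor 1, so the contributions of
  the subintervals add up without exponential growth. It also bounds each factor
  \<open>A - z\<close> of the characteristic polynomial below by \<open>- Re z\<close>, for
  non-normal \<open>A\<close> too. The Legendre polynomial stays unnormalised: its end point value
  and its L2 norm enter in reciprocal positions, linked by
  \<open>(b - a) L(b)^2 = (2 r + 1) ||L||^2\<close>, so the scaling cancels. The factor
  \<open>T^(1/2)\<close> is Cauchy-Schwarz over the subintervals, whose lengths add up to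
  \<open>T\<close>. The constant is the largest value of \<open>x^s 2^(-x)\<close> over positive
  real x, so it depends on s alone.\<close>

lemma continuous_integrable_open_interval:
  fixes f :: "real \<Rightarrow> real"
  assumes "continuous_on {a..b} f"
  shows "integrable (lebesgue_on {a<..<b}) f"
proof -
  have "integrable (lebesgue_on {a..b}) f"
    using assms by (rule continuous_imp_integrable_real)
  then have "set_integrable lebesgue {a..b} f"
    by (simp add: integrable_restrict_space set_integrable_def)
  then have "set_integrable lebesgue {a<..<b} f"
    by (rule set_integrable_subset) auto
  then show ?thesis
    by (simp add: integrable_restrict_space set_integrable_def)
qed

lemma integral_open_interval_continuous:
  fixes f :: "real \<Rightarrow> real"
  assumes "continuous_on {a..b} f"
  shows "integral\<^sup>L (lebesgue_on {a<..<b}) f = integral {a..b} f"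
  using lebesgue_integral_eq_integral[OF continuous_integrable_open_interval[OF assms]]
  by (simp add: integral_open_interval_real)

definition pint :: "real \<Rightarrow> real \<Rightarrow> real poly \<Rightarrow> real" where
  "pint a b p = integral\<^sup>L (lebesgue_on {a<..<b}) (poly p)"

lemma poly_eqI_real:
  fixes p q :: "real poly"
  assumes "\<And>x. poly p x = poly q x"
  shows "p = q"
  using assms poly_eq_poly_eq_iff by blast

lemma integrable_poly [simp]: "integrable (lebesgue_on {a<..<b}) (poly (p :: real poly))"
  by (intro continuous_integrable_open_interval continuous_intros)

lemma pint_0 [simp]: "pint a b 0 = 0"
proof -
  have "poly (0 :: real poly) = (\<lambda>_. 0)" by auto
  then show ?thesis by (simp add: pint_def)
qed

lemma pint_add: "pint a b (p + q) = pint a b p + pint a b q"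
proof -
  have "poly (p + q) = (\<lambda>x. poly p x + poly q x)" by auto
  then show ?thesis by (simp add: pint_def)
qed

lemma pint_diff: "pint a b (p - q) = pint a b p - pint a b q"
proof -
  have "poly (p - q) = (\<lambda>x. poly p x - poly q x)" by auto
  then show ?thesis by (simp add: pint_def)
qed

lemma pint_minus: "pint a b (- p) = - pint a b p"
  using pint_diff[of a b 0 p] by simp

lemma pint_smult: "pint a b (smult c p) = c * pint a b p"
proof -
  have "poly (smult c p) = (\<lambda>x. c * poly p x)" by auto
  then show ?thesis by (simp add: pint_def)
qed

lemma pint_nonneg:
  assumes "\<And>x. a < x \<Longrightarrow> x < b \<Longrightarrow> poly p x \<ge> 0"
  shows "pint a b p \<ge> 0"
  unfolding pint_def by (intro Bochner_Integration.integral_nonneg) (use assms in auto)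

lemma pint_square_nonneg: "pint a b (p * p) \<ge> 0"
  by (rule pint_nonneg) auto

lemma pint_pderiv:
  assumes "a \<le> b"
  shows "pint a b (pderiv p) = poly p b - poly p a"
proof -
  have "(poly (pderiv p) has_integral poly p b - poly p a) {a..b}"
    using assms
    by (intro fundamental_theorem_of_calculus)
       (auto simp flip: has_real_derivative_iff_has_vector_derivative
             intro!: DERIV_subset[OF poly_DERIV])
  then show ?thesis
    by (simp add: pint_def integral_open_interval_continuous continuous_on_poly integral_unique)
qed

lemma pint_by_parts:
  assumes "a \<le> b"
  shows "pint a b (pderiv p * q) = poly (p * q) b - poly (p * q) a - pint a b (p * pderiv q)"
  using pint_pderiv[OF assms, of "p * q"] by (simp add: pderiv_mult pint_add algebra_simps)

lemma pint_square_pos: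
  assumes "a < b" "p \<noteq> 0"
  shows "pint a b (p * p) > 0"
proof -
  have "pint a b (p * p) \<noteq> 0"
  proof
    assume "pint a b (p * p) = 0"
    then have "integral {a..b} (poly (p * p)) = 0"
      by (simp add: pint_def integral_open_interval_continuous continuous_on_poly del: poly_mult)
    moreover have "continuous_on {a..b} (poly (p * p))"
      by (intro continuous_intros)
    moreover have "poly (p * p) x \<ge> 0" for x
      by simp
    ultimately have "\<forall>x\<in>{a..b}. poly (p * p) x = 0"
      using integral_eq_0_iff assms(1) by blast
    then have "{a..b} \<subseteq> {x. poly p x = 0}"
      by auto
    then show False
      using assms poly_roots_finite[of p] infinite_Icc[of a b] finite_subset by blast
  qed
  then show ?thesis
    using pint_square_nonneg[of a b p] by simp
qed

section \<open>Rodrigues formula, orthogonality and end point values\<close>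

lemma dvd_pderiv_linear_power:
  fixes p :: "'a :: idom poly"
  assumes "[:c, 1:] ^ Suc n dvd p"
  shows "[:c, 1:] ^ n dvd pderiv p"
proof -
  obtain q where p: "p = [:c, 1:] ^ Suc n * q"
    using assms by (auto elim: dvdE)
  have "pderiv p = [:c, 1:] ^ n * ([:c, 1:] * pderiv q + smult (of_nat (Suc n)) q)"
    unfolding p pderiv_mult pderiv_power_Suc by (simp add: algebra_simps pderiv_pCons)
  then show ?thesis
    by simp
qed

text \<open>For k = r this is the Legendre polynomial of the interval up to a constant factor. The
  members with k < r are iterated antiderivatives of it that vanish at both ends, which is what
  makes integration by parts free of boundary terms.\<close>

definition rodrigues :: "real \<Rightarrow> real \<Rightarrow> nat \<Rightarrow> nat \<Rightarrow> real poly" where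
  "rodrigues a b r k = (pderiv ^^ k) (([:-a, 1:] * [:-b, 1:]) ^ r)"

abbreviation legendre :: "real \<Rightarrow> real \<Rightarrow> nat \<Rightarrow> real poly" where
  "legendre a b r \<equiv> rodrigues a b r r"

lemma rodrigues_Suc: "rodrigues a b r (Suc k) = pderiv (rodrigues a b r k)"
  by (simp add: rodrigues_def)

text \<open>Both end points are zeros of order r of the underived product, and each differentiation
  costs one order; below r at least one order is left.\<close>

lemma rodrigues_end_points:
  assumes "k < r"
  shows "poly (rodrigues a b r k) a = 0" "poly (rodrigues a b r k) b = 0"
proof -
  have dvd: "[:-c, 1:] ^ (r - k) dvd rodrigues a b r k" if "c = a \<or> c = b" "k \<le> r" for c k
    using that(2)
  proof (induction k)
    case 0
    have "[:-c, 1:] dvd [:-a, 1:] * [:-b, 1:]"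
      using that(1) dvd_triv_left[of "[:-a, 1:]" "[:-b, 1:]"] dvd_triv_right[of "[:-b, 1:]" "[:-a, 1:]"]
      by metis
    then show ?case
      by (simp add: rodrigues_def dvd_power_same del: mult_pCons_left mult_pCons_right)
  next
    case (Suc k)
    then show ?case
      using dvd_pderiv_linear_power[of "-c" "r - Suc k" "rodrigues a b r k"]
      by (simp add: rodrigues_Suc Suc_diff_Suc del: power_Suc)
  qed
  have "poly (rodrigues a b r k) c = 0" if "c = a \<or> c = b" for c
    using dvd_trans[OF dvd_power[of "r - k" "[:-c, 1:]"] dvd[OF that, of k]] assms
    by (simp add: poly_eq_0_iff_dvd)
  then show "poly (rodrigues a b r k) a = 0" "poly (rodrigues a b r k) b = 0"
    by auto
qed

lemma degree_pderiv_funpow: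
  "degree ((pderiv ^^ k) (p :: real poly)) = degree p - k"
  by (induction k) (auto simp: degree_pderiv)

lemma degree_rodrigues: "degree (rodrigues a b r k) = 2 * r - k"
  unfolding rodrigues_def
  by (simp add: degree_pderiv_funpow degree_power_eq degree_mult_eq del: mult_pCons_left mult_pCons_right)

lemma legendre_nonzero: "legendre a b r \<noteq> 0"
proof (cases "r = 0")
  case True
  then show ?thesis by (simp add: rodrigues_def)
next
  case False
  then show ?thesis
    using degree_rodrigues[of a b r r] by (metis degree_0 diff_add_inverse2 mult_2)
qed

lemma degree_legendre [simp]: "degree (legendre a b r) = r"
  by (simp add: degree_rodrigues)

text \<open>Each integration by parts lowers the index and differentiates \<open>q\<close>; the
  boundary terms vanish, and \<open>q\<close> is exhausted before the index is.\<close>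

lemma rodrigues_orthogonal:
  assumes "a \<le> b" "k \<le> r" "degree q < k"
  shows "pint a b (rodrigues a b r k * q) = 0"
  using assms(2,3)
proof (induction k arbitrary: q)
  case (Suc k)
  have "pint a b (rodrigues a b r k * pderiv q) = 0"
  \<comment> \<open>A constant \<open>q\<close> is treated apart: its derivative still has
    \<open>degree\<close> 0, which is not below k when k = 0.\<close>
  proof (cases "degree q = 0")
    case True
    then have "pderiv q = 0"
      by (simp add: pderiv_eq_0_iff)
    then show ?thesis by simp
  next
    case False
    then show ?thesis
      using Suc by (intro Suc.IH) (auto simp: degree_pderiv)
  qed
  then show ?case
    using Suc.prems rodrigues_end_points[of k r a b]
    by (simp add: rodrigues_Suc pint_by_parts[OF assms(1)])
qed auto

lemma degree_less_if_coeff_0: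
  assumes "degree p \<le> r" "coeff p r = 0" "r > 0"
  shows "degree p < r"
  using assms by (metis degree_0 le_neq_implies_less leading_coeff_0_iff)

text \<open>Only the component of \<open>q\<close> along L contributes: subtracting it lowers the
  degree, and the rest is orthogonal to L.\<close>

lemma pint_legendre_mult:
  assumes "a \<le> b" "r > 0" "degree q \<le> r" "coeff q r = c * lead_coeff (legendre a b r)"
  shows "pint a b (legendre a b r * q) = c * pint a b (legendre a b r * legendre a b r)"
proof -
  let ?L = "legendre a b r"
  have "degree (q - smult c ?L) < r"
    using assms by (intro degree_less_if_coeff_0 degree_diff_le) auto
  then have "pint a b (?L * (q - smult c ?L)) = 0"
    using assms by (intro rodrigues_orthogonal) auto
  then show ?thesis
    by (simp add: right_diff_distrib pint_diff pint_smult)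
qed

text \<open>Integrate the derivative of (t - a) L^2. The boundary term is the left-hand side; in the
  other part (t - a) L' has degree r and r times the leading coefficient of L, whence 2 r +
  1.\<close>

lemma legendre_end_point:
  assumes "a < b" "r > 0"
  shows "(b - a) * (poly (legendre a b r) b)\<^sup>2 =
    (2 * real r + 1) * pint a b (legendre a b r * legendre a b r)"
proof -
  let ?L = "legendre a b r"
  let ?t = "[:-a, 1:] :: real poly"
  have nz: "pderiv ?L \<noteq> 0"
    using assms(2) by (simp add: pderiv_eq_0_iff)
  have deg: "degree (?t * pderiv ?L) = r"
    using nz assms(2) by (subst degree_mult_eq) (auto simp: degree_pderiv)
  have "coeff (?t * pderiv ?L) r = real r * lead_coeff ?L"
  proof -
    have "lead_coeff (?t * pderiv ?L) = lead_coeff (pderiv ?L)"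
      by (subst lead_coeff_mult) simp
    then show ?thesis
      using assms(2) deg by (simp add: degree_pderiv coeff_pderiv)
  qed
  then have tL: "pint a b (?L * (?t * pderiv ?L)) = real r * pint a b (?L * ?L)"
    using assms deg by (intro pint_legendre_mult) auto
  have "pint a b (pderiv (?t * (?L * ?L))) = (b - a) * (poly ?L b)\<^sup>2"
    using assms by (subst pint_pderiv) (auto simp: power2_eq_square algebra_simps)
  moreover have "pderiv (?t * (?L * ?L)) = ?L * ?L + smult 2 (?L * (?t * pderiv ?L))"
    unfolding pderiv_mult by (rule poly_eqI_real) (simp add: pderiv_pCons algebra_simps)
  ultimately show ?thesis
    using tL by (simp add: pint_add pint_smult algebra_simps)
qed

section \<open>Cauchy-Schwarz and Poincare inequalities\<close>

lemma Cauchy_Schwarz_integral: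
  fixes f g :: "'a \<Rightarrow> real"
  assumes "integrable M (\<lambda>x. (f x)\<^sup>2)" "integrable M (\<lambda>x. (g x)\<^sup>2)" "integrable M (\<lambda>x. f x * g x)"
  shows "(integral\<^sup>L M (\<lambda>x. f x * g x))\<^sup>2 \<le>
    integral\<^sup>L M (\<lambda>x. (f x)\<^sup>2) * integral\<^sup>L M (\<lambda>x. (g x)\<^sup>2)"
proof -
  define A B C where "A = integral\<^sup>L M (\<lambda>x. (f x)\<^sup>2)" "B = integral\<^sup>L M (\<lambda>x. f x * g x)"
    "C = integral\<^sup>L M (\<lambda>x. (g x)\<^sup>2)"
  have quad: "A - 2 * t * B + t\<^sup>2 * C \<ge> 0" for t
  proof -
    have "0 \<le> integral\<^sup>L M (\<lambda>x. (f x - t * g x)\<^sup>2)"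
      by simp
    also have "(\<lambda>x. (f x - t * g x)\<^sup>2) = (\<lambda>x. ((f x)\<^sup>2 - 2 * t * (f x * g x)) + t\<^sup>2 * (g x)\<^sup>2)"
      by (auto simp: power2_eq_square algebra_simps)
    also have "integral\<^sup>L M \<dots> = A - 2 * t * B + t\<^sup>2 * C"
      using assms by (simp add: A_B_C_def)
    finally show ?thesis .
  qed
  have "C \<ge> 0"
    by (simp add: A_B_C_def)
  show ?thesis
  proof (cases "C = 0")
    case True
    have "B = 0"
    proof (rule ccontr)
      assume "B \<noteq> 0"
      \<comment> \<open>With C = 0 the quadratic is affine in t; this t gives it the value
        -1.\<close>
      then show False
        using quad[of "(A + 1) / (2 * B)"] True by simp
    qed
    then show ?thesis
      using True by (simp flip: A_B_C_def)
  next
    case False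
    then have "A * C - B\<^sup>2 \<ge> 0"
      using mult_nonneg_nonneg[OF quad[of "B / C"] \<open>C \<ge> 0\<close>] False
      by (simp add: power2_eq_square algebra_simps)
    then show ?thesis
      by (simp flip: A_B_C_def)
  qed
qed

lemma pint_Cauchy_Schwarz: "(pint a b (p * q))\<^sup>2 \<le> pint a b (p * p) * pint a b (q * q)"
proof -
  have fn: "poly (p * q) = (\<lambda>x. poly p x * poly q x)" for p q :: "real poly"
    by auto
  have "integrable (lebesgue_on {a<..<b}) (\<lambda>x. poly p x * poly q x)" for p q
    using integrable_poly[of a b "p * q"] by (simp add: fn)
  then show ?thesis
    using Cauchy_Schwarz_integral[of "lebesgue_on {a<..<b}" "poly p" "poly q"]
    by (simp add: pint_def power2_eq_square fn)
qed

lemma pint_mono: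
  assumes "\<And>x. a < x \<Longrightarrow> x < b \<Longrightarrow> poly p x \<le> poly q x"
  shows "pint a b p \<le> pint a b q"
  using pint_nonneg[of a b "q - p"] assms by (simp add: pint_diff)

lemma pint_const: "a \<le> b \<Longrightarrow> pint a b [:c:] = c * (b - a)"
  using pint_pderiv[of a b "[:0, c:]"] by (simp add: pderiv_pCons algebra_simps)

text \<open>\<open>p x\<close> is the integral of the derivative from a, so Cauchy-Schwarz gives a
  pointwise bound by (b - a) times the full energy; one more integration gives the second
  factor.\<close>

lemma pint_poincare:
  assumes "a < b" "poly p a = 0"
  shows "pint a b (p * p) \<le> (b - a)\<^sup>2 * pint a b (pderiv p * pderiv p)"
proof -
  let ?K = "pint a b (pderiv p * pderiv p)"
  have "poly (p * p) x \<le> poly [:(b - a) * ?K:] x" if x: "a < x" "x < b" for x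
  proof -
    have "(poly p x)\<^sup>2 = (pint a x (pderiv p * 1))\<^sup>2"
      using assms x by (simp add: pint_pderiv)
    also have "\<dots> \<le> pint a x (pderiv p * pderiv p) * pint a x (1 * 1)"
      by (rule pint_Cauchy_Schwarz)
    also have "pint a x (1 * 1) = x - a"
      using x pint_const[of a x 1] by (simp add: one_pCons)
    also have "pint a x (pderiv p * pderiv p) \<le> ?K"
    proof -
      have c: "continuous_on S (poly q)" for S and q :: "real poly"
        by (intro continuous_intros)
      show ?thesis
        unfolding pint_def integral_open_interval_continuous[OF c]
        using x by (intro integral_subset_le integrable_continuous_real c) auto
    qed
    then have "pint a x (pderiv p * pderiv p) * (x - a) \<le> ?K * (b - a)"
      using x by (intro mult_mono) (auto simp: pint_square_nonneg)
    finally show ?thesis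
      by (simp add: power2_eq_square algebra_simps)
  qed
  then have "pint a b (p * p) \<le> pint a b [:(b - a) * ?K:]"
    by (rule pint_mono)
  then show ?thesis
    using assms by (simp add: pint_const power2_eq_square mult_ac)
qed

text \<open>Going back from the Legendre polynomial through its antiderivatives, which vanish at a,
  costs one Poincare factor each.\<close>

lemma pint_rodrigues_le:
  assumes "a < b" "j \<le> r"
  shows "pint a b (rodrigues a b r (r - j) * rodrigues a b r (r - j)) \<le>
    (b - a) ^ (2 * j) * pint a b (legendre a b r * legendre a b r)"
  using assms(2)
proof (induction j)
  case (Suc j)
  have r: "r - j = Suc (r - Suc j)"
    using Suc.prems by simp
  have "pint a b (rodrigues a b r (r - Suc j) * rodrigues a b r (r - Suc j)) \<le>
      (b - a)\<^sup>2 * pint a b (rodrigues a b r (r - j) * rodrigues a b r (r - j))"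
    unfolding r rodrigues_Suc
    using Suc.prems by (intro pint_poincare assms rodrigues_end_points) auto
  also have "\<dots> \<le> (b - a)\<^sup>2 * ((b - a) ^ (2 * j) * pint a b (legendre a b r * legendre a b r))"
    using Suc by (intro mult_left_mono) auto
  finally show ?case
    by (simp add: power2_eq_square mult_ac)
qed simp

text \<open>The weights are an abstract sequence so that one calculus serves two cases: the
  components of \<open>A^k \<psi>\<close> for the dual solution, and the real and imaginary parts of
  \<open>z^k\<close> for the scalar problem.\<close>

definition legendre_sum :: "real \<Rightarrow> real \<Rightarrow> nat \<Rightarrow> (nat \<Rightarrow> real) \<Rightarrow> real poly" where
  "legendre_sum a b r f = (\<Sum>j\<le>r. smult (f (r - j)) ((pderiv ^^ j) (legendre a b r)))"

lemma legendre_sum_lincomb: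
  "legendre_sum a b r (\<lambda>k. c * f k + d * g k) =
   smult c (legendre_sum a b r f) + smult d (legendre_sum a b r g)"
  by (intro poly_eqI_real) (simp add: legendre_sum_def poly_sum sum.distrib sum_distrib_left algebra_simps)

lemma degree_legendre_sum: "degree (legendre_sum a b r f) \<le> r"
  unfolding legendre_sum_def
  by (rule degree_sum_le) (auto intro!: order_trans[OF degree_smult_le] simp: degree_pderiv_funpow)

lemma coeff_legendre_sum:
  "coeff (legendre_sum a b r f) r = f r * lead_coeff (legendre a b r)"
proof (cases "r = 0")
  case False
  have "coeff ((pderiv ^^ j) (legendre a b r)) r = 0" if "j \<in> {..r} - {0}" for j
    using that False by (intro coeff_eq_0) (auto simp: degree_pderiv_funpow)
  then have "coeff (legendre_sum a b r f) r = (\<Sum>j\<in>{0}. f (r - j) * coeff ((pderiv ^^ j) (legendre a b r)) r)"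
    unfolding legendre_sum_def coeff_sum by (intro sum.mono_neutral_cong_right) auto
  then show ?thesis by simp
qed (simp add: legendre_sum_def)

text \<open>Differentiation shifts the derivatives of L by one, hence the weights the other way. The
  sum with shifted weights has one extra term, the multiple of L itself; at the other end the
  derivative of order r + 1 vanishes.\<close>

lemma pderiv_legendre_sum:
  "pderiv (legendre_sum a b r f) =
   legendre_sum a b r (\<lambda>k. f (Suc k)) - smult (f (Suc r)) (legendre a b r)"
proof -
  let ?L = "legendre a b r"
  have 0: "(pderiv ^^ Suc r) ?L = 0"
    using degree_pderiv_funpow[of r ?L] by (simp add: pderiv_eq_0_iff)
  have "legendre_sum a b r (\<lambda>k. f (Suc k)) =
      (\<Sum>j\<le>Suc r. smult (f (Suc r - j)) ((pderiv ^^ j) ?L))"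
    using 0 by (simp add: legendre_sum_def Suc_diff_le del: funpow.simps)
  also have "\<dots> = smult (f (Suc r)) ?L + (\<Sum>j\<le>r. smult (f (r - j)) ((pderiv ^^ Suc j) ?L))"
    by (subst sum.atMost_Suc_shift) (simp del: funpow.simps add: funpow_0)
  also have "(\<Sum>j\<le>r. smult (f (r - j)) ((pderiv ^^ Suc j) ?L)) = pderiv (legendre_sum a b r f)"
    using higher_pderiv_sum[of 1 "\<lambda>j. smult (f (r - j)) ((pderiv ^^ j) ?L)" "{..r}"] by (simp add: legendre_sum_def pderiv_smult)
  finally show ?thesis by simp
qed

text \<open>The local L2 projection of the sum onto degree below r: the part removed is a multiple
  of L and carries the whole coefficient of degree r.\<close>

definition legendre_low :: "real \<Rightarrow> real \<Rightarrow> nat \<Rightarrow> (nat \<Rightarrow> real) \<Rightarrow> real poly" where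
  "legendre_low a b r f = legendre_sum a b r f - smult (f r) (legendre a b r)"

lemma degree_legendre_low: "r > 0 \<Longrightarrow> degree (legendre_low a b r f) < r"
  unfolding legendre_low_def
  by (intro degree_less_if_coeff_0 degree_diff_le)
     (auto simp: degree_legendre_sum coeff_legendre_sum)

text \<open>For weights with a linear recursion this is the discrete equation: the derivative is the
  rate applied to the projected solution.\<close>

lemma pderiv_legendre_sum_lincomb:
  assumes "\<And>k. f (Suc k) = c * f k + d * g k"
  shows "pderiv (legendre_sum a b r f) =
    smult c (legendre_low a b r f) + smult d (legendre_low a b r g)"
  using assms
  by (simp add: pderiv_legendre_sum legendre_low_def legendre_sum_lincomb smult_diff_right smult_add_left)

section \<open>Zeros of the characteristic polynomial\<close>

text \<open>Symmetry in the two end points: twice the integrand is the derivative of (t - a)(t - b)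
  g^2, which integrates to zero, plus (b - a) g^2.\<close>

lemma pint_end_point_test:
  assumes "a < b"
  shows "pint a b (pderiv ([:-b, 1:] * g) * ([:-a, 1:] * g)) = (b - a) / 2 * pint a b (g * g)"
proof -
  let ?w = "[:-a, 1:] * [:-b, 1:] :: real poly"
  have "pint a b (pderiv (?w * (g * g))) = 0"
    using assms by (simp add: pint_pderiv del: mult_pCons_left mult_pCons_right)
  moreover have "smult 2 (pderiv ([:-b, 1:] * g) * ([:-a, 1:] * g)) =
      pderiv (?w * (g * g)) + smult (b - a) (g * g)"
    unfolding pderiv_mult by (intro poly_eqI_real) (simp add: pderiv_pCons algebra_simps)
  then have "2 * pint a b (pderiv ([:-b, 1:] * g) * ([:-a, 1:] * g)) =
      pint a b (pderiv (?w * (g * g))) + (b - a) * pint a b (g * g)"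
    by (metis pint_add pint_smult)
  ultimately show ?thesis
    by simp
qed

text \<open>With m = t - (a + b)/2 one has (t - a)(b - t) = (b - a)^2/4 - m^2, and m g has component
  c L along L, so by Pythagoras the integral of m^2 g^2 is at least c^2 ||L||^2.\<close>

lemma pint_mult_midpoint_ge:
  assumes "a < b" "r > 0" "degree ([:-b, 1:] * g) \<le> r"
    and "coeff ([:-b, 1:] * g) r = c * lead_coeff (legendre a b r)"
  shows "pint a b ([:-a, 1:] * [:b, -1:] * (g * g)) + c\<^sup>2 * pint a b (legendre a b r * legendre a b r)
    \<le> (b - a)\<^sup>2 / 4 * pint a b (g * g)"
proof -
  let ?L = "legendre a b r" and ?m = "[:-(a + b) / 2, 1:]"
  let ?e = "?m * g - smult c ?L"
  \<comment> \<open>Replacing t - b by m changes the product by a multiple of \<open>g\<close>, of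
    degree below r, so the coefficient of degree r is the same.\<close>
  have split: "?m * g = [:-b, 1:] * g + smult ((b - a) / 2) g"
    by (intro poly_eqI_real) (simp add: field_simps)
  have dg: "degree g < r"
    using assms(2,3) by (cases "g = 0") (auto simp: degree_mult_eq simp del: mult_pCons_left)
  have "degree ?e < r"
  proof (rule degree_less_if_coeff_0[OF _ _ assms(2)])
    show "degree ?e \<le> r"
      unfolding split using assms(3) dg
      by (intro degree_diff_le degree_add_le order_trans[OF degree_smult_le])
         (auto simp del: mult_pCons_left)
    show "coeff ?e r = 0"
      unfolding split using assms(4) dg by (simp add: coeff_eq_0 del: mult_pCons_left)
  qed
  then have orth: "pint a b (?L * ?e) = 0"
    using assms(1) by (intro rodrigues_orthogonal) auto
  have "?m * ?m * (g * g) = smult (c\<^sup>2) (?L * ?L) + smult (2 * c) (?L * ?e) + ?e * ?e"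
    by (intro poly_eqI_real) (simp add: power2_eq_square algebra_simps)
  then have "pint a b (?m * ?m * (g * g)) = c\<^sup>2 * pint a b (?L * ?L) + pint a b (?e * ?e)"
    using orth by (simp add: pint_add pint_smult del: mult_pCons_left mult_pCons_right)
  moreover have "[:-a, 1:] * [:b, -1:] * (g * g) = smult ((b - a)\<^sup>2 / 4) (g * g) - ?m * ?m * (g * g)"
    by (intro poly_eqI_real) (simp add: power2_eq_square field_simps)
  ultimately show ?thesis
    using pint_square_nonneg[of a b ?e] by (simp only: pint_diff pint_smult)
qed

text \<open>At a zero the combination with weights \<open>\<zeta> ^ k\<close> is a collocation solution for
  the scalar equation with rate \<open>\<zeta>\<close> that vanishes at the right end point, so it has the form
  \<open>(t - b) g\<close>; it is tested with \<open>(t - a) g\<close>. Real and imaginary parts are kept apart.\<close>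

lemma legendre_characteristic_root:
  fixes z :: complex
  assumes "a < b" "r > 0"
    and root: "(\<Sum>j\<le>r. of_real (poly ((pderiv ^^ j) (legendre a b r)) b) * z ^ (r - j)) = 0"
  shows "Re z \<le> - (2 / (b - a))"
proof -
  let ?L = "legendre a b r"
  define f1 f2 where "f1 = (\<lambda>k. Re (z ^ k))" "f2 = (\<lambda>k. Im (z ^ k))"
  define S1 S2 where "S1 = legendre_sum a b r f1" "S2 = legendre_sum a b r f2"
  define q1 q2 where "q1 = legendre_low a b r f1" "q2 = legendre_low a b r f2"
  have "poly S1 b = 0" "poly S2 b = 0"
    using arg_cong[OF root, of Re] arg_cong[OF root, of Im]
    by (auto simp: S1_S2_def f1_f2_def legendre_sum_def poly_sum mult_ac)
  then obtain g1 g2 where g1: "S1 = [:-b, 1:] * g1" and g2: "S2 = [:-b, 1:] * g2"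
    unfolding poly_eq_0_iff_dvd by (auto elim!: dvdE)
  have d1: "pderiv S1 = smult (Re z) q1 + smult (- Im z) q2"
    unfolding S1_S2_def q1_q2_def by (rule pderiv_legendre_sum_lincomb) (simp add: f1_f2_def)
  have d2: "pderiv S2 = smult (Im z) q1 + smult (Re z) q2"
    unfolding S1_S2_def q1_q2_def
    by (subst add.commute, rule pderiv_legendre_sum_lincomb) (simp add: f1_f2_def algebra_simps)
  define v1 v2 where "v1 = [:-a, 1:] * g1" "v2 = [:-a, 1:] * g2"
  have v: "v1 = S1 + smult (b - a) g1" "v2 = S2 + smult (b - a) g2"
    unfolding v1_v2_def g1 g2 by (auto intro!: poly_eqI_real simp: algebra_simps)
  have deg: "degree S1 \<le> r" "degree S2 \<le> r"
    and lead: "coeff S1 r = f1 r * lead_coeff ?L" "coeff S2 r = f2 r * lead_coeff ?L"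
    unfolding S1_S2_def by (simp_all only: degree_legendre_sum coeff_legendre_sum)
  have dg: "degree g1 < r" "degree g2 < r"
    using deg \<open>r > 0\<close> unfolding g1 g2
    by (cases "g1 = 0"; cases "g2 = 0"; auto simp: degree_mult_eq simp del: mult_pCons_left)+
  have degv: "degree v1 \<le> r" "degree v2 \<le> r"
    unfolding v using deg dg by (auto intro!: degree_add_le order_trans[OF degree_smult_le])
  have leadv: "coeff v1 r = f1 r * lead_coeff ?L" "coeff v2 r = f2 r * lead_coeff ?L"
    unfolding v using dg lead by (simp_all add: coeff_eq_0)
  let ?LL = "pint a b (?L * ?L)"
  have Lv: "pint a b (?L * v1) = f1 r * ?LL" "pint a b (?L * v2) = f2 r * ?LL"
    using assms degv leadv by (auto intro: pint_legendre_mult)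
  define w1 w2 where "w1 = pint a b ([:-a, 1:] * [:b, -1:] * (g1 * g1))"
    "w2 = pint a b ([:-a, 1:] * [:b, -1:] * (g2 * g2))"
  have S1v1: "pint a b (S1 * v1) = - w1" and S2v2: "pint a b (S2 * v2) = - w2"
    unfolding w1_w2_def v1_v2_def g1 g2 pint_minus[symmetric]
    by (auto intro!: arg_cong[of _ _ "pint a b"] poly_eqI_real simp: algebra_simps)
  have S12: "S1 * v2 = S2 * v1"
    unfolding v1_v2_def g1 g2 by (simp only: ac_simps)
  have q: "q1 = S1 - smult (f1 r) ?L" "q2 = S2 - smult (f2 r) ?L"
    by (simp_all add: q1_q2_def S1_S2_def legendre_low_def)
  have q1v1: "pint a b (q1 * v1) = - (w1 + (f1 r)\<^sup>2 * ?LL)"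
    and q2v2: "pint a b (q2 * v2) = - (w2 + (f2 r)\<^sup>2 * ?LL)"
    and qv: "pint a b (q1 * v2) = pint a b (q2 * v1)"
    unfolding q
    by (simp_all add: left_diff_distrib pint_diff pint_smult Lv S1v1 S2v2 S12 power2_eq_square)
  define G where "G = pint a b (g1 * g1) + pint a b (g2 * g2)"
  define N where "N = w1 + w2 + ((f1 r)\<^sup>2 + (f2 r)\<^sup>2) * ?LL"
  \<comment> \<open>The sum is the real part of a complex inner product: the terms with
    \<open>Im z\<close> cancel by \<open>qv\<close>.\<close>
  have "(b - a) / 2 * G = pint a b (pderiv S1 * v1) + pint a b (pderiv S2 * v2)"
    unfolding G_def g1 g2 v1_v2_def pint_end_point_test[OF assms(1)] by (simp add: algebra_simps)
  also have "\<dots> = - Re z * N"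
    unfolding d1 d2
    by (simp add: distrib_right left_diff_distrib pint_add pint_diff pint_smult pint_minus
        q1v1 q2v2 qv N_def) (simp add: algebra_simps)
  finally have GN: "(b - a) / 2 * G = - Re z * N" .
  have NG: "N \<le> (b - a)\<^sup>2 / 4 * G"
    using add_mono[OF pint_mult_midpoint_ge[OF assms(1,2) deg(1)[unfolded g1] lead(1)[unfolded g1]]
        pint_mult_midpoint_ge[OF assms(1,2) deg(2)[unfolded g2] lead(2)[unfolded g2]]]
    unfolding N_def G_def w1_w2_def by (simp only: ring_distribs ac_simps)
  \<comment> \<open>A zero root would leave only the term j = r of the sum, a nonzero multiple of
    the leading coefficient. With z nonzero the weight \<open>z ^ r\<close> makes \<open>N\<close>
    positive below.\<close>
  have "z \<noteq> 0"
  proof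
    assume "z = 0"
    then have "(\<Sum>j\<le>r. of_real (poly ((pderiv ^^ j) ?L) b) * z ^ (r - j)) =
        (\<Sum>j\<in>{r}. of_real (poly ((pderiv ^^ j) ?L) b) * z ^ (r - j))"
      by (intro sum.mono_neutral_right) auto
    then have "poly ((pderiv ^^ r) ?L) b = 0"
      using root by simp
    moreover have "degree ((pderiv ^^ r) ?L) = 0"
      by (simp add: degree_pderiv_funpow)
    then obtain c where c: "(pderiv ^^ r) ?L = [:c:]"
      by (rule degree_eq_zeroE)
    moreover have "coeff ((pderiv ^^ r) ?L) 0 = pochhammer 1 r * lead_coeff ?L"
      by (simp add: coeff_higher_pderiv)
    ultimately have "lead_coeff ?L = 0"
      by (auto simp: pochhammer_fact[symmetric])
    then show False
      using legendre_nonzero[of a b r] by (simp only: leading_coeff_0_iff)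
  qed
  have "pint a b ([:-a, 1:] * [:b, -1:] * (g * g)) \<ge> 0" for g
  proof (rule pint_nonneg)
    fix x
    assume "a < x" "x < b"
    moreover have "poly ([:-a, 1:] * [:b, -1:] * (g * g)) x = (x - a) * (b - x) * (poly g x)\<^sup>2"
      by (simp add: power2_eq_square algebra_simps)
    ultimately show "0 \<le> poly ([:-a, 1:] * [:b, -1:] * (g * g)) x"
      by simp
  qed
  then have w: "w1 \<ge> 0" "w2 \<ge> 0"
    unfolding w1_w2_def by blast+
  have "(f1 r)\<^sup>2 + (f2 r)\<^sup>2 > 0"
    using \<open>z \<noteq> 0\<close> by (simp add: f1_f2_def complex_neq_0[symmetric])
  then have "N > 0"
    using w pint_square_pos[OF assms(1) legendre_nonzero[of a b r]] by (simp add: N_def add_nonneg_pos)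
  \<comment> \<open>\<open>NG\<close> bounds \<open>N\<close> by (b - a)^2/4 times \<open>G\<close>,
    and \<open>GN\<close> evaluates (b - a)/2 times \<open>G\<close>; the ratio of the two factors
    is the 2/(b - a) of the claim.\<close>
  have "(2 / (b - a)) * N \<le> (2 / (b - a)) * ((b - a)\<^sup>2 / 4 * G)"
    using NG assms(1) by (intro mult_left_mono) auto
  also have "\<dots> = (b - a) / 2 * G"
    using assms(1) by (simp add: power2_eq_square field_simps)
  finally have "(2 / (b - a)) * N \<le> (- Re z) * N"
    using GN by simp
  then have "2 / (b - a) \<le> - Re z"
    using \<open>N > 0\<close> mult_le_cancel_right_pos by blast
  then show ?thesis
    by simp
qed

section \<open>Lower bound for the characteristic polynomial of an accretive operator\<close>

text \<open>Complex multiplication on the complexification \<open>V \<times> V\<close> of a real space \<open>V\<close>.\<close>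

definition cmul :: "complex \<Rightarrow> 'v :: real_vector \<times> 'v \<Rightarrow> 'v \<times> 'v" where
  "cmul c P = (Re c *\<^sub>R fst P - Im c *\<^sub>R snd P, Im c *\<^sub>R fst P + Re c *\<^sub>R snd P)"

lemma cmul_simps [simp]:
  "cmul 0 P = 0" "cmul c 0 = 0"
  by (simp_all add: cmul_def zero_prod_def)

lemma cmul_add_left: "cmul (c + d) P = cmul c P + cmul d P"
  by (simp add: cmul_def algebra_simps)

lemma cmul_add_right: "cmul c (P + Q) = cmul c P + cmul c Q"
  by (simp add: cmul_def algebra_simps)

lemma cmul_cmul: "cmul c (cmul d P) = cmul (c * d) P"
  by (simp add: cmul_def algebra_simps)

lemma cmul_sum: "cmul c (sum f A) = (\<Sum>i\<in>A. cmul c (f i))"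
  by (induction A rule: infinite_finite_induct) (auto simp: cmul_add_right)

lemma norm_cmul:
  fixes P :: "'v :: real_inner \<times> 'v"
  shows "norm (cmul c P) = cmod c * norm P"
proof -
  have "cmul c P \<bullet> cmul c P = (cmod c)\<^sup>2 * (P \<bullet> P)"
    unfolding cmod_power2
    by (cases P) (simp add: cmul_def power2_eq_square algebra_simps inner_commute)
  then show ?thesis
    by (simp add: norm_eq_sqrt_inner real_sqrt_mult)
qed

lemma inner_cmul:
  fixes P :: "'v :: real_inner \<times> 'v"
  shows "P \<bullet> cmul c P = Re c * (P \<bullet> P)"
  by (cases P) (simp add: cmul_def algebra_simps inner_commute)

definition op_poly :: "('v \<Rightarrow> 'v) \<Rightarrow> complex poly \<Rightarrow> 'v :: real_vector \<times> 'v \<Rightarrow> 'v \<times> 'v" where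
  "op_poly A p P = (\<Sum>i\<le>degree p. cmul (coeff p i) ((map_prod A A ^^ i) P))"

lemma op_poly_eq_sum:
  assumes "degree p \<le> n"
  shows "op_poly A p P = (\<Sum>i\<le>n. cmul (coeff p i) ((map_prod A A ^^ i) P))"
  unfolding op_poly_def using assms
  by (intro sum.mono_neutral_left) (auto simp: coeff_eq_0)

lemma linear_map_prod: "linear A \<Longrightarrow> linear (map_prod A A)"
  by (rule linearI) (auto simp: linear_add linear_scale)

lemma op_poly_mult_linear:
  assumes "linear A"
  shows "op_poly A ([:-z, 1:] * q) P = map_prod A A (op_poly A q P) - cmul z (op_poly A q P)"
proof -
  let ?F = "map_prod A A" and ?n = "degree q"
  have F_cmul: "?F (cmul c P) = cmul c (?F P)" for c P
    using assms by (simp add: cmul_def linear_diff linear_add linear_scale map_prod_def split: prod.split)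
  have pCons: "op_poly A (pCons 0 q) P = ?F (op_poly A q P)"
  proof -
    have "op_poly A (pCons 0 q) P = (\<Sum>i\<le>Suc ?n. cmul (coeff (pCons 0 q) i) ((?F ^^ i) P))"
      by (intro op_poly_eq_sum degree_pCons_le)
    also have "\<dots> = (\<Sum>i\<le>?n. ?F (cmul (coeff q i) ((?F ^^ i) P)))"
      by (subst sum.atMost_Suc_shift) (simp add: F_cmul)
    also have "\<dots> = ?F (op_poly A q P)"
      by (simp add: op_poly_def linear_sum[OF linear_map_prod[OF assms]])
    finally show ?thesis .
  qed
  have "op_poly A ([:-z, 1:] * q) P = op_poly A (smult (-z) q + pCons 0 q) P"
    by simp
  also have "\<dots> = op_poly A (smult (-z) q) P + op_poly A (pCons 0 q) P"
  proof -
    have "degree (smult (-z) q) \<le> Suc ?n" "degree (pCons 0 q) \<le> Suc ?n"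
      "degree (smult (-z) q + pCons 0 q) \<le> Suc ?n"
      by (auto intro!: degree_diff_le order_trans[OF degree_smult_le] order_trans[OF degree_pCons_le])
    then show ?thesis
      by (simp only: op_poly_eq_sum[of _ "Suc ?n"] coeff_add cmul_add_left sum.distrib)
  qed
  also have "op_poly A (smult (-z) q) P = - cmul z (op_poly A q P)"
  proof -
    have "op_poly A (smult (-z) q) P = cmul (-z) (op_poly A q P)"
      by (subst op_poly_eq_sum[of _ ?n]) (auto simp: op_poly_def cmul_sum cmul_cmul)
    then show ?thesis
      by (simp add: cmul_def prod_eq_iff)
  qed
  finally show ?thesis
    by (simp add: pCons)
qed

text \<open>One zero z is split off per step. With X the image of P under the remaining factor,
  accretivity makes the inner product of X with (A - z) X at least - Re z |X|^2, hence at least c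
  |X|^2, and Cauchy-Schwarz turns this into a factor c in the norm.\<close>

lemma norm_op_poly_ge:
  fixes A :: "'v :: real_inner \<Rightarrow> 'v"
  assumes "linear A" "\<And>x. x \<bullet> A x \<ge> 0" "c \<ge> 0"
    and "\<And>z. poly p z = 0 \<Longrightarrow> Re z \<le> - c"
  shows "cmod (lead_coeff p) * c ^ degree p * norm P \<le> norm (op_poly A p P)"
  using assms(4)
proof (induction "degree p" arbitrary: p)
  case 0
  then show ?case
    by (simp add: op_poly_def norm_cmul)
next
  case (Suc n)
  then have "\<not> constant (poly p)"
    by (simp add: constant_degree)
  then obtain z where z: "poly p z = 0"
    using fundamental_theorem_of_algebra by blast
  then obtain q where p: "p = [:-z, 1:] * q"
    by (auto simp: poly_eq_0_iff_dvd elim: dvdE)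
  have "q \<noteq> 0"
    using Suc(2) p by auto
  then have deg: "degree p = Suc (degree q)"
    unfolding p by (subst degree_mult_eq) auto
  have lead: "lead_coeff p = lead_coeff q"
    unfolding p by (subst lead_coeff_mult) simp
  define X where "X = op_poly A q P"
  have IH: "cmod (lead_coeff q) * c ^ degree q * norm P \<le> norm X"
    unfolding X_def
  proof (rule Suc(1))
    show "n = degree q"
      using Suc(2) deg by simp
    show "Re w \<le> - c" if "poly q w = 0" for w
      using that Suc.prems[of w] p by simp
  qed
  have "c * norm X * norm X \<le> - Re z * (X \<bullet> X)"
    using Suc.prems[OF z] mult_right_mono[of c "- Re z" "X \<bullet> X"]
    by (simp add: dot_square_norm power2_eq_square mult_ac)
  also have "\<dots> \<le> X \<bullet> map_prod A A X - X \<bullet> cmul z X"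
    unfolding inner_cmul using assms(2) by (cases X) (simp add: add_nonneg_nonneg)
  also have "\<dots> \<le> norm X * norm (map_prod A A X - cmul z X)"
    unfolding inner_diff_right[symmetric] by (rule norm_cauchy_schwarz)
  finally have "norm X * (c * norm X) \<le> norm X * norm (op_poly A p P)"
    unfolding p op_poly_mult_linear[OF assms(1)] X_def by (simp add: mult_ac)
  then have "c * norm X \<le> norm (op_poly A p P)"
    by (cases "X = 0") (auto simp: mult_le_cancel_left)
  moreover have "c * (cmod (lead_coeff q) * c ^ degree q * norm P) \<le> c * norm X"
    using IH assms(3) by (rule mult_left_mono)
  ultimately show ?case
    unfolding lead unfolding deg by (simp add: mult_ac)
qed

text \<open>Parametrised by \<psi>, from which all coefficients arise by applying powers of
  \<open>A\<close>; the parameter that matches a given terminal value is found later by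
  injectivity.\<close>

definition dual_vec :: "real \<Rightarrow> real \<Rightarrow> nat \<Rightarrow> ('v \<Rightarrow> 'v) \<Rightarrow> 'v \<Rightarrow> real \<Rightarrow> 'v :: real_vector" where
  "dual_vec a b r A \<psi> t = (\<Sum>j\<le>r. poly ((pderiv ^^ j) (legendre a b r)) t *\<^sub>R (A ^^ (r - j)) \<psi>)"

text \<open>At b the dual vector is the characteristic polynomial of \<open>A\<close> applied to
  \<psi>; its leading coefficient, the term j = 0, is L(b), and its zeros are those located
  above.\<close>

lemma norm_dual_vec_ge:
  fixes A :: "'v :: real_inner \<Rightarrow> 'v"
  assumes "a < b" "r > 0" "linear A" "\<And>x. x \<bullet> A x \<ge> 0"
  shows "\<bar>poly (legendre a b r) b\<bar> * (2 / (b - a)) ^ r * norm \<psi> \<le> norm (dual_vec a b r A \<psi> b)"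
proof -
  let ?L = "legendre a b r"
  define l where "l j = poly ((pderiv ^^ j) ?L) b" for j
  \<comment> \<open>Power i of z carries the derivative of order r - i, so the degree is r once L(b)
    is nonzero.\<close>
  define Q :: "complex poly" where "Q = (\<Sum>i\<le>r. monom (of_real (l (r - i))) i)"
  have coeff_Q: "coeff Q i = (if i \<le> r then of_real (l (r - i)) else 0)" for i
    by (simp add: Q_def coeff_sum)
  have "l 0 \<noteq> 0"
  proof
    assume "l 0 = 0"
    then show False
      using legendre_end_point[OF assms(1,2)] pint_square_pos[OF assms(1) legendre_nonzero[of a b r]]
      by (simp add: l_def)
  qed
  then have deg: "degree Q = r"
    by (intro antisym degree_le le_degree) (auto simp: coeff_Q)
  have rev: "(\<Sum>i\<le>r. f (r - i) i) = (\<Sum>j\<le>r. f j (r - j))" for f :: "nat \<Rightarrow> nat \<Rightarrow> 'x :: comm_monoid_add"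
    using sum.nat_diff_reindex[of "\<lambda>j. f j (r - j)" "Suc r"]
    by (simp add: lessThan_Suc_atMost)
  have "cmod (lead_coeff Q) * (2 / (b - a)) ^ degree Q * norm (\<psi>, 0::'v) \<le> norm (op_poly A Q (\<psi>, 0))"
  proof (rule norm_op_poly_ge[OF assms(3,4)])
    fix z
    assume "poly Q z = 0"
    then have "(\<Sum>i\<le>r. of_real (l (r - i)) * z ^ i) = 0"
      by (simp add: Q_def poly_sum poly_monom)
    then show "Re z \<le> - (2 / (b - a))"
      using legendre_characteristic_root[OF assms(1,2), of z]
        rev[of "\<lambda>j i. of_real (l j) * z ^ i"]
      by (simp add: l_def)
  qed (use assms(1) in auto)
  moreover have "op_poly A Q (\<psi>, 0) = (dual_vec a b r A \<psi> b, 0)"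
  proof -
    have "A 0 = 0"
      using assms(3) by (rule linear_0)
    then have pow: "(map_prod A A ^^ i) (\<psi>, 0) = ((A ^^ i) \<psi>, 0)" for i
      by (induction i) auto
    have "op_poly A Q (\<psi>, 0) = (\<Sum>i\<le>r. (l (r - i) *\<^sub>R (A ^^ i) \<psi>, 0))"
      unfolding op_poly_def deg pow by (intro sum.cong) (auto simp: coeff_Q cmul_def)
    also have "\<dots> = (dual_vec a b r A \<psi> b, 0)"
      using rev[of "\<lambda>j i. l j *\<^sub>R (A ^^ i) \<psi>"]
      by (simp add: prod_eq_iff fst_sum snd_sum dual_vec_def l_def)
    finally show ?thesis .
  qed
  ultimately show ?thesis
    using deg by (simp add: coeff_Q l_def norm_Pair)
qed

section \<open>Weak derivatives\<close>

lemma integral_open_interval_restrict: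
  fixes f :: "real \<Rightarrow> real"
  assumes "\<alpha> \<le> a" "b \<le> \<beta>" "\<And>x. x \<notin> {a<..<b} \<Longrightarrow> f x = 0"
  shows "integral\<^sup>L (lebesgue_on {\<alpha><..<\<beta>}) f = integral\<^sup>L (lebesgue_on {a<..<b}) f"
proof -
  have "indicator {\<alpha><..<\<beta>} x *\<^sub>R f x = indicator {a<..<b} x *\<^sub>R f x" for x
    using assms by (cases "x \<in> {a<..<b}") (auto simp: indicator_def)
  then have "(\<lambda>x. indicator {\<alpha><..<\<beta>} x *\<^sub>R f x) = (\<lambda>x. indicator {a<..<b} x *\<^sub>R f x)"
    by (rule ext)
  moreover have "integral\<^sup>L (lebesgue_on {c<..<d}) f = integral\<^sup>L lebesgue (\<lambda>x. indicator {c<..<d} x *\<^sub>R f x)" for c d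
    by (rule integral_restrict_space) simp
  ultimately show ?thesis
    by (simp only:)
qed

lemma integrable_open_subinterval:
  fixes f :: "real \<Rightarrow> real"
  assumes "integrable (lebesgue_on {\<alpha><..<\<beta>}) f" "\<alpha> \<le> a" "b \<le> \<beta>"
  shows "integrable (lebesgue_on {a<..<b}) f"
proof -
  have "set_integrable lebesgue {\<alpha><..<\<beta>} f"
    using assms by (simp add: integrable_restrict_space set_integrable_def)
  then have "set_integrable lebesgue {a<..<b} f"
    by (rule set_integrable_subset) (use assms in auto)
  then show ?thesis
    by (simp add: integrable_restrict_space set_integrable_def)
qed

lemma continuous_borel_measurable_open_interval:
  fixes f :: "real \<Rightarrow> real"
  shows "continuous_on {a..b} f \<Longrightarrow> f \<in> borel_measurable (lebesgue_on {a<..<b})"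
  by (rule borel_measurable_integrable[OF continuous_integrable_open_interval])

lemma integrable_mult_continuous:
  fixes u g :: "real \<Rightarrow> real"
  assumes "integrable (lebesgue_on {a<..<b}) u" "continuous_on {a..b} g"
  shows "integrable (lebesgue_on {a<..<b}) (\<lambda>x. u x * g x)"
proof -
  have "compact (g ` {a..b})"
    using assms(2) by (intro compact_continuous_image) auto
  then obtain B where B: "\<And>x. x \<in> {a..b} \<Longrightarrow> \<bar>g x\<bar> \<le> B"
    by (force dest!: compact_imp_bounded simp: bounded_iff)
  show ?thesis
  proof (rule Bochner_Integration.integrable_bound[of _ "\<lambda>x. B * u x"])
    show "integrable (lebesgue_on {a<..<b}) (\<lambda>x. B * u x)"
      using assms(1) by simp
    show "(\<lambda>x. u x * g x) \<in> borel_measurable (lebesgue_on {a<..<b})"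
      by (intro borel_measurable_times borel_measurable_integrable[OF assms(1)]
          continuous_borel_measurable_open_interval assms(2))
    have "\<bar>u x\<bar> * \<bar>g x\<bar> \<le> \<bar>B\<bar> * \<bar>u x\<bar>" if "a < x" "x < b" for x
      using mult_right_mono[OF B[of x], of "\<bar>u x\<bar>"] mult_right_mono[OF abs_ge_self[of B], of "\<bar>u x\<bar>"] that
      by (simp add: mult.commute)
    then show "AE x in lebesgue_on {a<..<b}. norm (u x * g x) \<le> norm (B * u x)"
      by (intro AE_I2) (auto simp: abs_mult)
  qed
qed

lemma L2_space_integrable:
  assumes "u \<in> L2_space a b"
  shows "integrable (lebesgue_on {a<..<b}) u"
proof (rule Bochner_Integration.integrable_bound[of _ "\<lambda>x. 1 + (u x)\<^sup>2"])
  have "integrable (lebesgue_on {a<..<b}) (\<lambda>x. 1 :: real)"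
    by (rule continuous_integrable_open_interval) auto
  then show "integrable (lebesgue_on {a<..<b}) (\<lambda>x. 1 + (u x)\<^sup>2)"
    using assms by (simp add: L2_space_def)
  show "u \<in> borel_measurable (lebesgue_on {a<..<b})"
    using assms by (simp add: L2_space_def)
  have "\<bar>y\<bar> \<le> 1 + y\<^sup>2" for y :: real
    by (cases "\<bar>y\<bar> \<le> 1") (use power_increasing[of 1 2 "\<bar>y\<bar>"] in \<open>auto simp: add_increasing2\<close>)
  then show "AE x in lebesgue_on {a<..<b}. norm (u x) \<le> norm (1 + (u x)\<^sup>2)"
    by simp
qed

text \<open>A C^1 step from 0 on y <= 1 to 1 on y >= 3; its derivative is the hat with peak 1 at y =
  2 and area 1. Test functions are once continuously differentiable, so piecewise quadratics
  suffice. Starting at 1 and not at 0 leaves room for compact support.\<close>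

definition ramp :: "real \<Rightarrow> real" where
  "ramp y = ((max 0 (y - 1))\<^sup>2 - 2 * (max 0 (y - 2))\<^sup>2 + (max 0 (y - 3))\<^sup>2) / 2"

definition ramp' :: "real \<Rightarrow> real" where
  "ramp' y = max 0 (y - 1) - 2 * max 0 (y - 2) + max 0 (y - 3)"

lemma has_real_derivative_max_0_square:
  "((\<lambda>x :: real. (max 0 x)\<^sup>2) has_real_derivative 2 * max 0 x) (at x)"
proof -
  consider "x < 0" | "x > 0" | "x = 0"
    by linarith
  then show ?thesis
  proof cases
    case 1
    have "((\<lambda>x :: real. 0) has_real_derivative 2 * max 0 x) (at x)"
      using 1 by (auto intro!: derivative_eq_intros)
    then show ?thesis
      by (rule has_field_derivative_transform_within_open[of _ _ _ "{..<0}"]) (use 1 in auto)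
  next
    case 2
    have "((\<lambda>x :: real. x\<^sup>2) has_real_derivative 2 * max 0 x) (at x)"
      using 2 by (auto intro!: derivative_eq_intros)
    then show ?thesis
      by (rule has_field_derivative_transform_within_open[of _ _ _ "{0<..}"]) (use 2 in auto)
  next
    case 3
    have "((\<lambda>h. (max 0 h)\<^sup>2 / h) \<longlongrightarrow> 0) (at (0 :: real))"
    proof (rule Lim_null_comparison[of _ "\<lambda>h. \<bar>h\<bar>"])
      show "\<forall>\<^sub>F h in at 0. norm ((max 0 h)\<^sup>2 / h) \<le> \<bar>h :: real\<bar>"
        by (intro always_eventually) (auto simp: max_def power2_eq_square)
    qed (auto intro!: tendsto_eq_intros)
    then show ?thesis
      using 3 by (simp add: DERIV_def)
  qed
qed

lemma ramp_derivative: "(ramp has_real_derivative ramp' y) (at y)"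
  unfolding ramp_def ramp'_def
  by (rule derivative_eq_intros DERIV_fun_pow has_real_derivative_max_0_square[THEN DERIV_chain2] refl
      | simp)+

lemma continuous_on_ramp': "continuous_on S ramp'"
  unfolding ramp'_def by (intro continuous_intros)

lemma ramp_eq_0: "y \<le> 1 \<Longrightarrow> ramp y = 0"
  and ramp_eq_1: "y \<ge> 3 \<Longrightarrow> ramp y = 1"
  and ramp'_eq_0: "y \<le> 1 \<or> y \<ge> 3 \<Longrightarrow> ramp' y = 0"
  and ramp'_nonneg: "ramp' y \<ge> 0" and ramp'_le: "ramp' y \<le> 1"
  by (auto simp: ramp_def ramp'_def max_def power2_eq_square algebra_simps)

lemma ramp_nonneg: "ramp y \<ge> 0" and ramp_le: "ramp y \<le> 1"
proof -
  have mono: "mono ramp"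
    by (rule monoI) (meson DERIV_nonneg_imp_nondecreasing ramp_derivative ramp'_nonneg)
  show "ramp y \<ge> 0"
    using monoD[OF mono, of "min y 1" y] by (simp add: ramp_eq_0)
  show "ramp y \<le> 1"
    using monoD[OF mono, of y "max y 3"] by (simp add: ramp_eq_1)
qed

definition cutoff :: "real \<Rightarrow> real \<Rightarrow> nat \<Rightarrow> real \<Rightarrow> real" where
  "cutoff a b n x = ramp (real n * (x - a)) * ramp (real n * (b - x))"

definition cutoff' :: "real \<Rightarrow> real \<Rightarrow> nat \<Rightarrow> real \<Rightarrow> real" where
  "cutoff' a b n x = real n * ramp' (real n * (x - a)) * ramp (real n * (b - x)) -
     real n * ramp' (real n * (b - x)) * ramp (real n * (x - a))"

lemma cutoff_derivative: "(cutoff a b n has_real_derivative cutoff' a b n x) (at x)"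
  unfolding cutoff_def cutoff'_def
  by (rule derivative_eq_intros ramp_derivative[THEN DERIV_chain2] refl | simp add: algebra_simps)+

lemma continuous_on_cutoff: "continuous_on S (cutoff a b n)"
  by (meson DERIV_continuous_on cutoff_derivative has_field_derivative_at_within)

lemma continuous_on_cutoff': "continuous_on S (cutoff' a b n)"
proof -
  have 1: "continuous_on S ramp" for S
    by (meson DERIV_continuous_on ramp_derivative has_field_derivative_at_within)
  show ?thesis
    unfolding cutoff'_def
    by (intro continuous_intros continuous_on_compose2[OF 1[of UNIV]]
        continuous_on_compose2[OF continuous_on_ramp'[of UNIV]]) auto
qed

lemma cutoff_outside: "n > 0 \<Longrightarrow> x \<notin> {a + 1 / n..b - 1 / n} \<Longrightarrow> cutoff a b n x = 0"
  by (auto simp: cutoff_def ramp_eq_0 field_simps not_le)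

lemma cutoff'_outside:
  assumes "x \<notin> {a<..<b}"
  shows "cutoff' a b n x = 0"
proof -
  have "real n * (x - a) \<le> 0 \<or> real n * (b - x) \<le> 0"
    using assms by (auto simp: mult_nonneg_nonpos)
  then have "real n * (x - a) \<le> 1 \<or> real n * (b - x) \<le> 1"
    by linarith
  then show ?thesis
    by (auto simp: cutoff'_def ramp_eq_0 ramp'_eq_0)
qed

lemma cutoff_bounds: "\<bar>cutoff a b n x\<bar> \<le> 1"
  by (simp add: cutoff_def abs_mult ramp_nonneg ramp_le mult_le_one)

section \<open>Integration by parts for weak derivatives on a subinterval\<close>

lemma eventually_nat_mult_ge:
  assumes "c > (0 :: real)"
  shows "\<forall>\<^sub>F n in sequentially. real n * c \<ge> K"
proof -
  have "filterlim (\<lambda>n. real n * c) at_top sequentially"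
    using assms by (intro filterlim_at_top_mult_tendsto_pos[OF tendsto_const _ filterlim_real_sequentially]) auto
  then show ?thesis
    by (simp add: filterlim_at_top)
qed

lemma cutoff_tendsto:
  assumes "a < x" "x < b"
  shows "(\<lambda>n. cutoff a b n x) \<longlonglongrightarrow> 1" "(\<lambda>n. cutoff' a b n x) \<longlonglongrightarrow> 0"
proof -
  have "\<forall>\<^sub>F n in sequentially. real n * (x - a) \<ge> 3 \<and> real n * (b - x) \<ge> 3"
    using assms by (intro eventually_conj eventually_nat_mult_ge) auto
  then have "\<forall>\<^sub>F n in sequentially. cutoff a b n x = 1 \<and> cutoff' a b n x = 0"
    by eventually_elim (simp add: cutoff_def cutoff'_def ramp_eq_1 ramp'_eq_0)
  then show "(\<lambda>n. cutoff a b n x) \<longlonglongrightarrow> 1" "(\<lambda>n. cutoff' a b n x) \<longlonglongrightarrow> 0"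
    by (auto intro!: tendsto_eventually elim: eventually_mono)
qed

lemma integrable_mult_cutoff_tendsto:
  fixes f :: "real \<Rightarrow> real"
  assumes "integrable (lebesgue_on {a<..<b}) f"
  shows "(\<lambda>n. integral\<^sup>L (lebesgue_on {a<..<b}) (\<lambda>x. f x * cutoff a b n x)) \<longlonglongrightarrow>
    integral\<^sup>L (lebesgue_on {a<..<b}) f"
proof (rule integral_dominated_convergence[where w = "\<lambda>x. \<bar>f x\<bar>"])
  show "f \<in> borel_measurable (lebesgue_on {a<..<b})"
    using assms by (rule borel_measurable_integrable)
  show "(\<lambda>x. f x * cutoff a b n x) \<in> borel_measurable (lebesgue_on {a<..<b})" for n
    by (intro borel_measurable_integrable integrable_mult_continuous assms continuous_on_cutoff)
  show "AE x in lebesgue_on {a<..<b}. (\<lambda>n. f x * cutoff a b n x) \<longlonglongrightarrow> f x"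
    by (intro AE_I2) (auto intro!: tendsto_eq_intros cutoff_tendsto)
  show "AE x in lebesgue_on {a<..<b}. norm (f x * cutoff a b n x) \<le> \<bar>f x\<bar>" for n
    using cutoff_bounds by (intro AE_I2) (auto simp: abs_mult mult_left_le)
qed (use assms in auto)

text \<open>\<open>g\<close> times the cutoff is an admissible test function, and every term except
  the one with \<open>cutoff'\<close> converges by domination. The limit of that term is then
  computed independently: zero when \<open>g\<close> vanishes at the ends, boundary values when
  \<open>u\<close> is continuous.\<close>

lemma weak_derivative_cutoff_tendsto:
  assumes "has_weak_derivative \<alpha> \<beta> u v" "\<alpha> \<le> a" "b \<le> \<beta>"
    and u: "integrable (lebesgue_on {a<..<b}) u" and v: "integrable (lebesgue_on {a<..<b}) v"
    and g: "\<And>x. (g has_real_derivative g' x) (at x)" "continuous_on UNIV g'"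
  shows "(\<lambda>n. integral\<^sup>L (lebesgue_on {a<..<b}) (\<lambda>x. u x * g x * cutoff' a b n x)) \<longlonglongrightarrow>
    - integral\<^sup>L (lebesgue_on {a<..<b}) (\<lambda>x. u x * g' x + v x * g x)"
proof -
  let ?M = "lebesgue_on {a<..<b}"
  have cg: "continuous_on S g" and cg': "continuous_on S g'" for S
    using g by (auto intro: continuous_on_subset DERIV_continuous_on has_field_derivative_at_within)
  have int: "integrable ?M (\<lambda>x. u x * g' x)" "integrable ?M (\<lambda>x. v x * g x)"
    "integrable ?M (\<lambda>x. u x * g x)"
    using u v cg cg' by (auto intro: integrable_mult_continuous)
  have "integral\<^sup>L ?M (\<lambda>x. u x * g x * cutoff' a b n x) =
      - integral\<^sup>L ?M (\<lambda>x. (u x * g' x + v x * g x) * cutoff a b n x)" if "n > 0" for n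
  proof -
    let ?\<phi> = "\<lambda>x. g x * cutoff a b n x" and ?\<phi>' = "\<lambda>x. g x * cutoff' a b n x + g' x * cutoff a b n x"
    have "test_function \<alpha> \<beta> ?\<phi> ?\<phi>'"
      unfolding test_function_def
    proof (intro conjI allI)
      show "(?\<phi> has_real_derivative ?\<phi>' x) (at x)" for x
        using DERIV_mult[OF g(1) cutoff_derivative] by (simp add: add.commute mult.commute)
      show "continuous_on UNIV ?\<phi>'"
        by (intro continuous_intros cg cg' continuous_on_cutoff continuous_on_cutoff')
      have "1 / real n > 0"
        using that by simp
      then have "\<alpha> < a + 1 / real n" "b - 1 / real n < \<beta>"
        using assms(2,3) by linarith+
      then show "\<exists>c d. \<alpha> < c \<and> d < \<beta> \<and> (\<forall>x. x \<notin> {c..d} \<longrightarrow> ?\<phi> x = 0)"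
        using cutoff_outside[OF that] by (metis mult_zero_right)
    qed
    then have "integral\<^sup>L (lebesgue_on {\<alpha><..<\<beta>}) (\<lambda>x. u x * ?\<phi>' x) =
        - integral\<^sup>L (lebesgue_on {\<alpha><..<\<beta>}) (\<lambda>x. v x * ?\<phi> x)"
      using assms(1) unfolding has_weak_derivative_def by blast
    moreover have "cutoff a b n x = 0" if "x \<notin> {a<..<b}" for x
    proof -
      have "1 / real n > 0"
        using \<open>n > 0\<close> by simp
      then have "x \<notin> {a + 1 / real n..b - 1 / real n}"
        using that unfolding greaterThanLessThan_iff atLeastAtMost_iff by linarith
      then show ?thesis
        by (rule cutoff_outside[OF \<open>n > 0\<close>])
    qed
    ultimately have "integral\<^sup>L ?M (\<lambda>x. u x * ?\<phi>' x) = - integral\<^sup>L ?M (\<lambda>x. v x * ?\<phi> x)"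
      using assms(2,3) by (subst (asm) (1 2) integral_open_interval_restrict) (auto simp: cutoff'_outside)
    moreover have "integral\<^sup>L ?M (\<lambda>x. u x * ?\<phi>' x) =
        integral\<^sup>L ?M (\<lambda>x. u x * g x * cutoff' a b n x) + integral\<^sup>L ?M (\<lambda>x. u x * g' x * cutoff a b n x)"
      using integrable_mult_continuous[OF int(3) continuous_on_cutoff']
        integrable_mult_continuous[OF int(1) continuous_on_cutoff]
      by (subst Bochner_Integration.integral_add[symmetric]) (auto simp: algebra_simps)
    moreover have "integral\<^sup>L ?M (\<lambda>x. (u x * g' x + v x * g x) * cutoff a b n x) =
        integral\<^sup>L ?M (\<lambda>x. u x * g' x * cutoff a b n x) + integral\<^sup>L ?M (\<lambda>x. v x * ?\<phi> x)"
      using integrable_mult_continuous[OF int(1) continuous_on_cutoff]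
        integrable_mult_continuous[OF int(2) continuous_on_cutoff]
      by (subst Bochner_Integration.integral_add[symmetric]) (auto simp: algebra_simps)
    ultimately show ?thesis
      by simp
  qed
  then have "\<forall>\<^sub>F n in sequentially. - integral\<^sup>L ?M (\<lambda>x. (u x * g' x + v x * g x) * cutoff a b n x) =
      integral\<^sup>L ?M (\<lambda>x. u x * g x * cutoff' a b n x)"
    by (intro eventually_sequentiallyI[of 1]) simp
  then show ?thesis
    using int by (intro Lim_transform_eventually[OF tendsto_minus[OF integrable_mult_cutoff_tendsto]]) auto
qed

text \<open>The derivative of the cutoff is of size n, but only within 3/n of an end, where
  \<open>g\<close> is at most K times the distance to it. The product stays bounded and tends to
  zero pointwise, so no boundary value of \<open>u\<close> appears.\<close>

lemma weak_by_parts_vanishing: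
  assumes "has_weak_derivative \<alpha> \<beta> u v" "\<alpha> \<le> a" "b \<le> \<beta>"
    and u: "integrable (lebesgue_on {a<..<b}) u" and v: "integrable (lebesgue_on {a<..<b}) v"
    and g: "\<And>x. (g has_real_derivative g' x) (at x)" "continuous_on UNIV g'"
    and "g a = 0" "g b = 0"
  shows "integral\<^sup>L (lebesgue_on {a<..<b}) (\<lambda>x. v x * g x) =
    - integral\<^sup>L (lebesgue_on {a<..<b}) (\<lambda>x. u x * g' x)"
proof -
  let ?M = "lebesgue_on {a<..<b}"
  have cg: "continuous_on S g" and cg': "continuous_on S g'" for S
    using g by (auto intro: continuous_on_subset DERIV_continuous_on has_field_derivative_at_within)
  have "compact (g' ` {a..b})"
    by (intro compact_continuous_image cg') auto
  then obtain K where K: "\<And>x. x \<in> {a..b} \<Longrightarrow> \<bar>g' x\<bar> \<le> K"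
    by (force dest!: compact_imp_bounded simp: bounded_iff)
  have lip: "\<bar>g x - g y\<bar> \<le> K * \<bar>x - y\<bar>" if "x \<in> {a..b}" "y \<in> {a..b}" for x y
    using field_differentiable_bound[of "{a..b}" g g' K x y] K that g(1)
    by (auto intro: has_field_derivative_at_within)
  have ramp'_mult: "ramp' y * y \<le> 3" if "y \<ge> 0" for y
    using that mult_mono[of "ramp' y" 1 y 3] by (cases "y \<ge> 3") (auto simp: ramp'_eq_0 ramp'_le ramp'_nonneg)
  have part: "\<bar>g x * (real n * ramp' (real n * d) * ramp y)\<bar> \<le> 3 * K"
    if "\<bar>g x\<bar> \<le> K * d" "d \<ge> 0" "K \<ge> 0" for x n d y
  proof -
    have "\<bar>g x * (real n * ramp' (real n * d) * ramp y)\<bar> = \<bar>g x\<bar> * (real n * ramp' (real n * d)) * ramp y"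
      by (simp add: abs_mult ramp'_nonneg ramp_nonneg)
    also have "\<dots> \<le> (K * d) * (real n * ramp' (real n * d)) * 1"
      using that by (intro mult_mono) (auto simp: ramp'_nonneg ramp_nonneg ramp_le)
    also have "\<dots> = K * (ramp' (real n * d) * (real n * d))"
      by (simp add: mult_ac)
    also have "\<dots> \<le> K * 3"
      using that by (intro mult_left_mono ramp'_mult) auto
    finally show ?thesis by simp
  qed
  have bound: "\<bar>g x * cutoff' a b n x\<bar> \<le> 6 * K" if "a < x" "x < b" for n x
  proof -
    have "K \<ge> 0"
      using K[of x] that by simp
    moreover have "\<bar>g x\<bar> \<le> K * (x - a)" "\<bar>g x\<bar> \<le> K * (b - x)"
      using lip[of x a] lip[of x b] that assms(8,9) by auto
    ultimately show ?thesis
      using part[of x "x - a" n "real n * (b - x)"] part[of x "b - x" n "real n * (x - a)"] that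
      unfolding cutoff'_def right_diff_distrib by linarith
  qed
  have "(\<lambda>n. integral\<^sup>L ?M (\<lambda>x. u x * g x * cutoff' a b n x)) \<longlonglongrightarrow> integral\<^sup>L ?M (\<lambda>x. 0)"
  proof (rule integral_dominated_convergence[where w = "\<lambda>x. 6 * K * \<bar>u x\<bar>"])
    show "(\<lambda>x. u x * g x * cutoff' a b n x) \<in> borel_measurable ?M" for n
      by (intro borel_measurable_integrable integrable_mult_continuous u cg continuous_on_cutoff')
    show "AE x in ?M. (\<lambda>n. u x * g x * cutoff' a b n x) \<longlonglongrightarrow> 0"
      by (intro AE_I2) (auto intro!: tendsto_eq_intros cutoff_tendsto)
    have "\<bar>u x * g x * cutoff' a b n x\<bar> \<le> 6 * K * \<bar>u x\<bar>" if "a < x" "x < b" for n x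
      using mult_left_mono[OF bound[OF that, of n], of "\<bar>u x\<bar>"] by (simp add: abs_mult mult_ac)
    then show "AE x in ?M. norm (u x * g x * cutoff' a b n x) \<le> 6 * K * \<bar>u x\<bar>" for n
      by (intro AE_I2) auto
  qed (use u in auto)
  then have "(\<lambda>n. integral\<^sup>L ?M (\<lambda>x. u x * g x * cutoff' a b n x)) \<longlonglongrightarrow> 0"
    by simp
  from LIMSEQ_unique[OF this weak_derivative_cutoff_tendsto[OF assms(1-7)]]
  show ?thesis
    using integrable_mult_continuous[OF u cg'] integrable_mult_continuous[OF v cg] by simp
qed

text \<open>The mass concentrates where \<open>h\<close> is close to \<open>h p\<close>. The point
  \<open>p\<close> may be an end point: the kernels used below are one-sided and carry their whole
  mass inside the interval.\<close>

lemma approximate_identity_tendsto: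
  fixes h :: "real \<Rightarrow> real" and k :: "nat \<Rightarrow> real \<Rightarrow> real"
  assumes h: "continuous_on {a..b} h" and p: "p \<in> {a..b}"
    and k: "\<And>n. continuous_on {a..b} (k n)" "\<And>n x. k n x \<ge> 0"
    and mass: "\<forall>\<^sub>F n in sequentially. integral\<^sup>L (lebesgue_on {a<..<b}) (k n) = 1"
    and supp: "\<And>d. d > 0 \<Longrightarrow> \<forall>\<^sub>F n in sequentially. \<forall>x\<in>{a<..<b}. \<bar>x - p\<bar> \<ge> d \<longrightarrow> k n x = 0"
  shows "(\<lambda>n. integral\<^sup>L (lebesgue_on {a<..<b}) (\<lambda>x. h x * k n x)) \<longlonglongrightarrow> h p"
proof (rule tendstoI)
  let ?M = "lebesgue_on {a<..<b}"
  fix e :: real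
  assume "e > 0"
  then obtain d where d: "d > 0" "\<And>x. x \<in> {a..b} \<Longrightarrow> \<bar>x - p\<bar> < d \<Longrightarrow> \<bar>h x - h p\<bar> < e / 2"
    using h p unfolding continuous_on_iff dist_real_def by (meson half_gt_zero)
  show "\<forall>\<^sub>F n in sequentially. dist (integral\<^sup>L ?M (\<lambda>x. h x * k n x)) (h p) < e"
    using mass supp[OF d(1)]
  proof eventually_elim
    case (elim n)
    have int: "integrable ?M (\<lambda>x. h x * k n x)" "integrable ?M (k n)"
      using h k by (auto intro!: continuous_integrable_open_interval continuous_intros)
    have int': "integrable ?M (\<lambda>x. (h x - h p) * k n x)"
      using h k by (auto intro!: continuous_integrable_open_interval continuous_intros)
    have "integral\<^sup>L ?M (\<lambda>x. h x * k n x) - h p =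
        integral\<^sup>L ?M (\<lambda>x. h x * k n x) - integral\<^sup>L ?M (\<lambda>x. h p * k n x)"
      using elim int by simp
    also have "\<dots> = integral\<^sup>L ?M (\<lambda>x. (h x - h p) * k n x)"
      using int by (subst Bochner_Integration.integral_diff[symmetric]) (auto simp: algebra_simps)
    also have "\<bar>\<dots>\<bar> \<le> integral\<^sup>L ?M (\<lambda>x. \<bar>(h x - h p) * k n x\<bar>)"
      by (rule integral_abs_bound)
    also have "\<dots> \<le> integral\<^sup>L ?M (\<lambda>x. e / 2 * k n x)"
    proof (rule integral_mono)
      fix x
      assume "x \<in> space ?M"
      then have x: "x \<in> {a<..<b}"
        by simp
      show "\<bar>(h x - h p) * k n x\<bar> \<le> e / 2 * k n x"
      proof (cases "\<bar>x - p\<bar> < d")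
        case True
        then have "\<bar>h x - h p\<bar> * k n x \<le> e / 2 * k n x"
          using d(2)[of x] x k(2)[of n x] by (intro mult_right_mono) auto
        then show ?thesis
          using k(2)[of n x] by (simp add: abs_mult)
      next
        case False
        then have "k n x = 0"
          using elim(2) x by force
        then show ?thesis
          by simp
      qed
    qed (use int int' in auto)
    also have "\<dots> = e / 2"
      using elim by simp
    finally show ?case
      using \<open>e > 0\<close> by (simp add: dist_real_def)
  qed
qed

text \<open>Near each end the derivative of the cutoff is, up to sign, an approximate identity at
  that end, so the limit term is a difference of boundary values.\<close>

lemma weak_by_parts_continuous:
  assumes "has_weak_derivative \<alpha> \<beta> u v" "\<alpha> \<le> a" "b \<le> \<beta>" "a < b"
    and u: "continuous_on {a..b} u" and v: "integrable (lebesgue_on {a<..<b}) v"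
    and g: "\<And>x. (g has_real_derivative g' x) (at x)" "continuous_on UNIV g'"
  shows "integral\<^sup>L (lebesgue_on {a<..<b}) (\<lambda>x. u x * g' x + v x * g x) = u b * g b - u a * g a"
proof -
  let ?M = "lebesgue_on {a<..<b}"
  have cg: "continuous_on S g" for S
    using g by (auto intro: continuous_on_subset DERIV_continuous_on has_field_derivative_at_within)
  define h where "h x = u x * g x" for x
  have h: "continuous_on {a..b} h"
    unfolding h_def by (intro continuous_intros u cg)
  define ka kb where "ka n x = real n * ramp' (real n * (x - a))"
    and "kb n x = real n * ramp' (real n * (b - x))" for n :: nat and x
  have ck: "continuous_on S (ka n)" "continuous_on S (kb n)" for S n
    unfolding ka_def kb_def
    by (intro continuous_intros continuous_on_compose2[OF continuous_on_ramp'[of UNIV]]; simp)+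
  have nonneg: "ka n x \<ge> 0" "kb n x \<ge> 0" for n x
    by (simp_all add: ka_def kb_def ramp'_nonneg)
  \<comment> \<open>Each ramp is complete at distance 3/n from its end point; 6 keeps the two apart,
    so wherever one factor varies the other one equals 1.\<close>
  have large: "\<forall>\<^sub>F n in sequentially. 6 \<le> real n * (b - a)"
    using \<open>a < b\<close> by (intro eventually_nat_mult_ge) auto
  have FTC: "integral\<^sup>L ?M f = F b - F a"
    if "continuous_on {a..b} f" "\<And>x. (F has_real_derivative f x) (at x)" for f F
  proof -
    have "(f has_integral (F b - F a)) {a..b}"
      using \<open>a < b\<close> that(2)
      by (intro fundamental_theorem_of_calculus)
        (auto simp flip: has_real_derivative_iff_has_vector_derivative intro: has_field_derivative_at_within)
    then show ?thesis
      using integral_open_interval_continuous[OF that(1)] by (simp add: integral_unique)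
  qed
  have limit_a: "(\<lambda>n. integral\<^sup>L ?M (\<lambda>x. h x * ka n x)) \<longlonglongrightarrow> h a"
  proof (rule approximate_identity_tendsto[OF h _ ck(1) nonneg(1)])
    show "\<forall>\<^sub>F n in sequentially. integral\<^sup>L ?M (ka n) = 1"
      using large
    proof eventually_elim
      case (elim n)
      have "((\<lambda>x. ramp (real n * (x - a))) has_real_derivative ka n x) (at x)" for x
      proof -
        have "((\<lambda>x. real n * (x - a)) has_real_derivative real n) (at x)"
          by (auto intro!: derivative_eq_intros)
        from DERIV_chain2[OF ramp_derivative this] show ?thesis
          by (simp add: ka_def mult.commute)
      qed
      from FTC[OF ck(1) this] show ?case
        using elim by (simp add: ramp_eq_0 ramp_eq_1)
    qed
    fix d :: real
    assume "d > 0"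
    then have "\<forall>\<^sub>F n in sequentially. 3 \<le> real n * d"
      by (rule eventually_nat_mult_ge)
    then show "\<forall>\<^sub>F n in sequentially. \<forall>x\<in>{a<..<b}. d \<le> \<bar>x - a\<bar> \<longrightarrow> ka n x = 0"
    proof eventually_elim
      case (elim n)
      then show ?case
        by (auto simp: ka_def intro!: disjI2 ramp'_eq_0 order_trans[OF elim] mult_left_mono)
    qed
  qed (use \<open>a < b\<close> in auto)
  have limit_b: "(\<lambda>n. integral\<^sup>L ?M (\<lambda>x. h x * kb n x)) \<longlonglongrightarrow> h b"
  proof (rule approximate_identity_tendsto[OF h _ ck(2) nonneg(2)])
    show "\<forall>\<^sub>F n in sequentially. integral\<^sup>L ?M (kb n) = 1"
      using large
    proof eventually_elim
      case (elim n)
      have "((\<lambda>x. - ramp (real n * (b - x))) has_real_derivative kb n x) (at x)" for x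
      proof -
        have "((\<lambda>x. real n * (b - x)) has_real_derivative - real n) (at x)"
          by (auto intro!: derivative_eq_intros)
        from DERIV_minus[OF DERIV_chain2[OF ramp_derivative this]] show ?thesis
          by (simp add: kb_def mult.commute)
      qed
      from FTC[OF ck(2) this] show ?case
        using elim by (simp add: ramp_eq_0 ramp_eq_1)
    qed
    fix d :: real
    assume "d > 0"
    then have "\<forall>\<^sub>F n in sequentially. 3 \<le> real n * d"
      by (rule eventually_nat_mult_ge)
    then show "\<forall>\<^sub>F n in sequentially. \<forall>x\<in>{a<..<b}. d \<le> \<bar>x - b\<bar> \<longrightarrow> kb n x = 0"
    proof eventually_elim
      case (elim n)
      then show ?case
        by (auto simp: kb_def intro!: disjI2 ramp'_eq_0 order_trans[OF elim] mult_left_mono)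
    qed
  qed (use \<open>a < b\<close> in auto)
  have "\<forall>\<^sub>F n in sequentially. integral\<^sup>L ?M (\<lambda>x. h x * ka n x) - integral\<^sup>L ?M (\<lambda>x. h x * kb n x) =
      integral\<^sup>L ?M (\<lambda>x. u x * g x * cutoff' a b n x)"
    using large
  proof eventually_elim
    case (elim n)
    have "real n * (x - a) \<ge> 3 \<or> real n * (b - x) \<ge> 3" for x
      using elim by (simp add: algebra_simps) linarith
    then have eq: "cutoff' a b n x = ka n x - kb n x" for x
      using ramp_eq_1[of "real n * (x - a)"] ramp_eq_1[of "real n * (b - x)"]
        ramp'_eq_0[of "real n * (x - a)"] ramp'_eq_0[of "real n * (b - x)"]
      by (simp only: cutoff'_def ka_def kb_def) (metis mult.right_neutral mult_zero_left mult_zero_right)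
    have "integrable ?M (\<lambda>x. h x * ka n x)" "integrable ?M (\<lambda>x. h x * kb n x)"
      by (intro continuous_integrable_open_interval continuous_intros h ck)+
    then show ?case
      by (subst Bochner_Integration.integral_diff[symmetric]) (auto simp: h_def eq right_diff_distrib)
  qed
  then have "(\<lambda>n. integral\<^sup>L ?M (\<lambda>x. u x * g x * cutoff' a b n x)) \<longlonglongrightarrow> h a - h b"
    by (rule Lim_transform_eventually[OF tendsto_diff[OF limit_a limit_b]])
  from LIMSEQ_unique[OF this weak_derivative_cutoff_tendsto[OF assms(1-3)
      continuous_integrable_open_interval[OF u] v g]]
  show ?thesis
    by (simp add: h_def)
qed

text \<open>The difference quotients of a test function are themselves test functions, and they converge
  boundedly to its derivative.\<close>

lemma integral_test_function_derivative_eq_0: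
  assumes f: "integrable (lebesgue_on {\<alpha><..<\<beta>}) f"
    and orth: "\<And>\<phi> \<phi>'. test_function \<alpha> \<beta> \<phi> \<phi>' \<Longrightarrow> integral\<^sup>L (lebesgue_on {\<alpha><..<\<beta>}) (\<lambda>x. f x * \<phi> x) = 0"
    and test: "test_function \<alpha> \<beta> \<phi> \<phi>'"
  shows "integral\<^sup>L (lebesgue_on {\<alpha><..<\<beta>}) (\<lambda>x. f x * \<phi>' x) = 0"
proof -
  let ?M = "lebesgue_on {\<alpha><..<\<beta>}"
  obtain c d where cd: "\<alpha> < c" "d < \<beta>" "\<And>x. x \<notin> {c..d} \<Longrightarrow> \<phi> x = 0"
    and der: "\<And>x. (\<phi> has_real_derivative \<phi>' x) (at x)" and cont': "continuous_on UNIV \<phi>'"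
    using test unfolding test_function_def by blast
  have cont: "continuous_on S \<phi>" for S
    using der by (auto intro: DERIV_continuous_on has_field_derivative_at_within)
  define q where "q n x = real (Suc n) * (\<phi> (x + 1 / real (Suc n)) - \<phi> x)" for n x
  define q' where "q' n x = real (Suc n) * (\<phi>' (x + 1 / real (Suc n)) - \<phi>' x)" for n x
  have "compact (\<phi>' ` {\<alpha>..\<beta> + 1})"
    by (intro compact_continuous_image continuous_on_subset[OF cont']) auto
  then obtain K where K: "\<And>x. x \<in> {\<alpha>..\<beta> + 1} \<Longrightarrow> \<bar>\<phi>' x\<bar> \<le> K"
    by (force dest!: compact_imp_bounded simp: bounded_iff)
  have bound: "\<bar>q n x\<bar> \<le> K" if "\<alpha> < x" "x < \<beta>" for n x
  proof -
    obtain z where z: "x < z" "z < x + 1 / real (Suc n)"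
      "\<phi> (x + 1 / real (Suc n)) - \<phi> x = (x + 1 / real (Suc n) - x) * \<phi>' z"
      using MVT2[of x "x + 1 / real (Suc n)" \<phi> \<phi>'] der by auto
    then have "q n x = \<phi>' z"
      by (simp add: q_def)
    moreover have "1 / real (Suc n) \<le> 1"
      by simp
    then have "z \<in> {\<alpha>..\<beta> + 1}"
      using z that unfolding atLeastAtMost_iff by linarith
    ultimately show ?thesis
      using K by simp
  qed
  have test_q: "\<forall>\<^sub>F n in sequentially. test_function \<alpha> \<beta> (q n) (q' n)"
  proof -
    have "\<forall>\<^sub>F n in sequentially. 1 / real (Suc n) < c - \<alpha>"
      using cd(1) order_tendstoD(2)[OF LIMSEQ_Suc[OF lim_1_over_n], of "c - \<alpha>"] by simp
    then show ?thesis
    proof eventually_elim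
      case (elim n)
      show ?case
        unfolding test_function_def
      proof (intro conjI allI)
        show "(q n has_real_derivative q' n x) (at x)" for x
          unfolding q_def q'_def
          by (rule derivative_eq_intros der[THEN DERIV_chain2] der refl | simp)+
        show "continuous_on UNIV (q' n)"
          unfolding q'_def by (intro continuous_intros continuous_on_compose2[OF cont'] cont') auto
        \<comment> \<open>The forward quotient extends the support to the left only, which is why
          1/(n + 1) has to stay below \<open>c - \<alpha>\<close>.\<close>
        have "q n x = 0" if "x \<notin> {c - 1 / real (Suc n)..d}" for x
        proof -
          have "x \<notin> {c..d} \<and> x + 1 / real (Suc n) \<notin> {c..d}"
          proof -
            have "1 / real (Suc n) > 0"
              by simp
            then show "x \<notin> {c..d} \<and> x + 1 / real (Suc n) \<notin> {c..d}"
              using that unfolding atLeastAtMost_iff by linarith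
          qed
          then show ?thesis
            unfolding q_def by (simp add: cd(3))
        qed
        then show "\<exists>c d. \<alpha> < c \<and> d < \<beta> \<and> (\<forall>x. x \<notin> {c..d} \<longrightarrow> q n x = 0)"
          using elim cd(2) by (intro exI[of _ "c - 1 / real (Suc n)"] exI[of _ d]) auto
      qed
    qed
  qed
  have limit: "(\<lambda>n. q n x) \<longlonglongrightarrow> \<phi>' x" for x
  proof -
    have "((\<lambda>h. (\<phi> (x + h) - \<phi> x) / h) \<longlongrightarrow> \<phi>' x) (at 0)"
      using der[of x] by (simp add: DERIV_def)
    moreover have "filterlim (\<lambda>n. 1 / real (Suc n)) (at 0) sequentially"
      unfolding filterlim_at using LIMSEQ_Suc[OF lim_1_over_n] by auto
    ultimately have "(\<lambda>n. (\<phi> (x + 1 / real (Suc n)) - \<phi> x) / (1 / real (Suc n))) \<longlonglongrightarrow> \<phi>' x"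
      by (rule filterlim_compose)
    then show ?thesis
      by (simp add: q_def mult.commute)
  qed
  have cq: "continuous_on S (q n)" for S n
    unfolding q_def by (intro continuous_intros continuous_on_compose2[OF cont[of UNIV]] cont) auto
  have "(\<lambda>n. integral\<^sup>L ?M (\<lambda>x. f x * q n x)) \<longlonglongrightarrow> integral\<^sup>L ?M (\<lambda>x. f x * \<phi>' x)"
  proof (rule integral_dominated_convergence[where w = "\<lambda>x. K * \<bar>f x\<bar>"])
    show "(\<lambda>x. f x * q n x) \<in> borel_measurable ?M" for n
      by (intro borel_measurable_integrable integrable_mult_continuous f cq)
    show "(\<lambda>x. f x * \<phi>' x) \<in> borel_measurable ?M"
      by (intro borel_measurable_integrable integrable_mult_continuous f continuous_on_subset[OF cont']) auto
    show "AE x in ?M. (\<lambda>n. f x * q n x) \<longlonglongrightarrow> f x * \<phi>' x"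
      by (intro AE_I2 tendsto_intros limit)
    have "\<bar>f x * q n x\<bar> \<le> K * \<bar>f x\<bar>" if "\<alpha> < x" "x < \<beta>" for x n
      using mult_left_mono[OF bound[OF that, of n], of "\<bar>f x\<bar>"] by (simp add: abs_mult mult_ac)
    then show "AE x in ?M. norm (f x * q n x) \<le> K * \<bar>f x\<bar>" for n
      by (intro AE_I2) auto
  qed (use f in auto)
  moreover have "\<forall>\<^sub>F n in sequentially. integral\<^sup>L ?M (\<lambda>x. f x * q n x) = 0"
    using test_q by eventually_elim (rule orth)
  then have "(\<lambda>n. integral\<^sup>L ?M (\<lambda>x. f x * q n x)) \<longlonglongrightarrow> 0"
    by (rule tendsto_eventually)
  ultimately show ?thesis
    by (rule LIMSEQ_unique)
qed

section \<open>Iterated weak derivatives\<close>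

lemma test_function_continuous:
  assumes "test_function \<alpha> \<beta> \<phi> \<phi>'"
  shows "continuous_on S \<phi>" "continuous_on S \<phi>'"
  using assms unfolding test_function_def
  by (auto intro: DERIV_continuous_on has_field_derivative_at_within continuous_on_subset)

text \<open>Two weak derivatives agree against all test functions, but here they have to agree
  against \<open>\<phi>'\<close>, which is merely continuous;
  \<open>integral_test_function_derivative_eq_0\<close> closes this gap.\<close>

lemma has_weak_derivative_transfer:
  assumes v: "v \<in> L2_space \<alpha> \<beta>" "has_weak_derivative \<alpha> \<beta> u v"
    and w: "w \<in> L2_space \<alpha> \<beta>" "has_weak_derivative \<alpha> \<beta> u w"
    and v': "has_weak_derivative \<alpha> \<beta> v v'"
  shows "has_weak_derivative \<alpha> \<beta> w v'"
  unfolding has_weak_derivative_def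
proof (intro allI impI)
  let ?M = "lebesgue_on {\<alpha><..<\<beta>}"
  fix \<phi> \<phi>'
  assume test: "test_function \<alpha> \<beta> \<phi> \<phi>'"
  have int: "integrable ?M (\<lambda>x. v x * \<psi> x)" "integrable ?M (\<lambda>x. w x * \<psi> x)"
    if "continuous_on {\<alpha>..\<beta>} \<psi>" for \<psi>
    using that v w by (auto intro: integrable_mult_continuous L2_space_integrable)
  have diff: "integral\<^sup>L ?M (\<lambda>x. (w x - v x) * \<psi> x) = integral\<^sup>L ?M (\<lambda>x. w x * \<psi> x) - integral\<^sup>L ?M (\<lambda>x. v x * \<psi> x)"
    if "continuous_on {\<alpha>..\<beta>} \<psi>" for \<psi>
    using int[OF that] by (subst Bochner_Integration.integral_diff[symmetric]) (auto simp: algebra_simps)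
  have "integral\<^sup>L ?M (\<lambda>x. (w x - v x) * \<phi>' x) = 0"
  proof (rule integral_test_function_derivative_eq_0[OF _ _ test])
    show "integrable ?M (\<lambda>x. w x - v x)"
      using v w by (auto intro: L2_space_integrable)
    show "integral\<^sup>L ?M (\<lambda>x. (w x - v x) * \<psi> x) = 0" if "test_function \<alpha> \<beta> \<psi> \<psi>'" for \<psi> \<psi>'
      using v(2) w(2) that unfolding has_weak_derivative_def
      by (subst diff[OF test_function_continuous(1)[OF that]]) force
  qed
  then show "integral\<^sup>L ?M (\<lambda>x. w x * \<phi>' x) = - integral\<^sup>L ?M (\<lambda>x. v' x * \<phi> x)"
    using v' test unfolding has_weak_derivative_def
    by (subst (asm) diff[OF test_function_continuous(2)[OF test]]) simp
qed

text \<open>\<open>weak_deriv\<close> chooses some square integrable derivative, not necessarily the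
  regular one that membership provides; the transfer lemma lets the chosen one inherit further
  derivatives.\<close>

lemma weak_deriv_sobolev_int:
  assumes "u \<in> sobolev_int \<alpha> \<beta> (Suc k)"
  shows "weak_deriv \<alpha> \<beta> u \<in> sobolev_int \<alpha> \<beta> k" "has_weak_derivative \<alpha> \<beta> u (weak_deriv \<alpha> \<beta> u)"
proof -
  have L2: "sobolev_int \<alpha> \<beta> k \<subseteq> L2_space \<alpha> \<beta>" for k
    by (cases k) auto
  obtain v where v: "v \<in> sobolev_int \<alpha> \<beta> k" "has_weak_derivative \<alpha> \<beta> u v"
    using assms by auto
  then have "v \<in> L2_space \<alpha> \<beta> \<and> has_weak_derivative \<alpha> \<beta> u v"
    using L2 by blast
  then have w: "weak_deriv \<alpha> \<beta> u \<in> L2_space \<alpha> \<beta>" "has_weak_derivative \<alpha> \<beta> u (weak_deriv \<alpha> \<beta> u)"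
    unfolding weak_deriv_def by (metis (mono_tags, lifting) someI_ex)+
  show "has_weak_derivative \<alpha> \<beta> u (weak_deriv \<alpha> \<beta> u)"
    by fact
  show "weak_deriv \<alpha> \<beta> u \<in> sobolev_int \<alpha> \<beta> k"
  proof (cases k)
    case (Suc l)
    then obtain v' where "v' \<in> sobolev_int \<alpha> \<beta> l" "has_weak_derivative \<alpha> \<beta> v v'"
      using v by auto
    moreover have "has_weak_derivative \<alpha> \<beta> (weak_deriv \<alpha> \<beta> u) v'"
      using has_weak_derivative_transfer[OF _ v(2) w] v(1) L2 \<open>has_weak_derivative \<alpha> \<beta> v v'\<close> by blast
    ultimately show ?thesis
      using w Suc by auto
  qed (use w in simp)
qed

lemma weak_deriv_funpow_sobolev_int:
  assumes "u \<in> sobolev_int \<alpha> \<beta> k" "j \<le> k"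
  shows "(weak_deriv \<alpha> \<beta> ^^ j) u \<in> sobolev_int \<alpha> \<beta> (k - j)"
  using assms(2)
proof (induction j)
  case (Suc j)
  then show ?case
    using weak_deriv_sobolev_int(1)[of "(weak_deriv \<alpha> \<beta> ^^ j) u" \<alpha> \<beta> "k - Suc j"]
    by (simp add: Suc_diff_Suc del: sobolev_int.simps)
qed (use assms in simp)

lemma
  assumes "u \<in> sobolev_int \<alpha> \<beta> k"
  shows weak_deriv_funpow_L2: "j \<le> k \<Longrightarrow> (weak_deriv \<alpha> \<beta> ^^ j) u \<in> L2_space \<alpha> \<beta>"
    and weak_deriv_funpow_Suc: "j < k \<Longrightarrow>
      has_weak_derivative \<alpha> \<beta> ((weak_deriv \<alpha> \<beta> ^^ j) u) ((weak_deriv \<alpha> \<beta> ^^ Suc j) u)"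
proof -
  show "(weak_deriv \<alpha> \<beta> ^^ j) u \<in> L2_space \<alpha> \<beta>" if "j \<le> k"
    using weak_deriv_funpow_sobolev_int[OF assms that] by (cases "k - j") auto
  show "has_weak_derivative \<alpha> \<beta> ((weak_deriv \<alpha> \<beta> ^^ j) u) ((weak_deriv \<alpha> \<beta> ^^ Suc j) u)" if "j < k"
    using weak_deriv_funpow_sobolev_int[OF assms, of j] that
      weak_deriv_sobolev_int(2)[of "(weak_deriv \<alpha> \<beta> ^^ j) u" \<alpha> \<beta> "k - Suc j"]
    by (simp add: Suc_diff_Suc del: sobolev_int.simps)
qed

section \<open>Local moments of Sobolev functions\<close>

lemma partition_mono:
  assumes "is_partition T N t" "i \<le> j" "j \<le> N"
  shows "t i \<le> t j"
  using assms(2,3)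
proof (induction j rule: dec_induct)
  case (step j)
  moreover have "t j < t (Suc j)"
    using assms(1) step.prems by (simp add: is_partition_def)
  ultimately show ?case
    by simp
qed simp

lemma sum_indicator_subint_le_1:
  assumes "is_partition T N t"
  shows "(\<Sum>n<N. indicator (subint t n) x :: real) \<le> 1"
proof -
  note mono = partition_mono[OF assms]
  have uniq: "m = n" if "m < N" "n < N" "x \<in> subint t m" "x \<in> subint t n" for m n
    using that mono[of "Suc m" n] mono[of "Suc n" m]
    by (cases m n rule: linorder_cases) (auto simp: subint_def)
  have "(\<Sum>n<N. indicator (subint t n) x :: real) = real (card {n \<in> {..<N}. x \<in> subint t n})"
    by (simp add: indicator_def sum.If_cases Int_def)
  also have "card {n \<in> {..<N}. x \<in> subint t n} \<le> 1"
    using uniq by (intro card_le_Suc0_iff_eq[THEN iffD2, simplified One_nat_def[symmetric]]) auto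
  finally show ?thesis by simp
qed

lemma partition_bounds:
  assumes "is_partition T N t" "n < N"
  shows "0 \<le> t n" "t n < t (Suc n)" "t (Suc n) \<le> T"
proof -
  note mono = partition_mono[OF assms(1)]
  show "0 \<le> t n" "t n < t (Suc n)" "t (Suc n) \<le> T"
    using mono[of 0 n] mono[of "Suc n" N] assms by (auto simp: is_partition_def)
qed

text \<open>The weights are dominated by indicators of disjoint sets, so they sum to at most 1
  pointwise. The map \<open>p\<close> lets the same argument serve single integrals
  (\<open>id\<close>) and double integrals (\<open>fst\<close>).\<close>

lemma sum_integral_partition_le:
  fixes \<Phi> :: "'a \<Rightarrow> real"
  assumes "is_partition T N t" "integrable M \<Phi>" "\<And>q. \<Phi> q \<ge> 0"
    and "\<And>n. n < N \<Longrightarrow> integrable M (\<lambda>q. \<omega> n q * \<Phi> q)"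
    and "\<And>n q. n < N \<Longrightarrow> \<omega> n q \<le> indicator (subint t n) (p q)"
  shows "(\<Sum>n<N. integral\<^sup>L M (\<lambda>q. \<omega> n q * \<Phi> q)) \<le> integral\<^sup>L M \<Phi>"
proof -
  have "(\<Sum>n<N. integral\<^sup>L M (\<lambda>q. \<omega> n q * \<Phi> q)) = integral\<^sup>L M (\<lambda>q. \<Sum>n<N. \<omega> n q * \<Phi> q)"
    using assms(4) by (subst Bochner_Integration.integral_sum) auto
  also have "\<dots> \<le> integral\<^sup>L M \<Phi>"
  proof (rule integral_mono)
    fix q
    have "(\<Sum>n<N. \<omega> n q) \<le> (\<Sum>n<N. indicator (subint t n) (p q))"
      by (intro sum_mono assms(5)) simp
    also have "\<dots> \<le> 1"
      by (rule sum_indicator_subint_le_1[OF assms(1)])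
    finally show "(\<Sum>n<N. \<omega> n q * \<Phi> q) \<le> \<Phi> q"
      using mult_right_mono[OF _ assms(3), of "\<Sum>n<N. \<omega> n q" 1 q] by (simp add: sum_distrib_right)
  qed (use assms in auto)
  finally show ?thesis .
qed

section \<open>Moments bounded by the fractional seminorm and by the L2 norm\<close>

lemma integral_product_measure:
  fixes f :: "'a \<Rightarrow> real" and g :: "'b \<Rightarrow> real"
  assumes "pair_sigma_finite M1 M2" "integrable M1 f" "integrable M2 g"
  shows "integrable (M1 \<Otimes>\<^sub>M M2) (\<lambda>q. f (fst q) * g (snd q))"
    and "integral\<^sup>L (M1 \<Otimes>\<^sub>M M2) (\<lambda>q. f (fst q) * g (snd q)) = integral\<^sup>L M1 f * integral\<^sup>L M2 g"
proof -
  interpret pair_sigma_finite M1 M2 by fact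
  have [measurable]: "f \<in> borel_measurable M1" "g \<in> borel_measurable M2"
    using assms by auto
  show int: "integrable (M1 \<Otimes>\<^sub>M M2) (\<lambda>q. f (fst q) * g (snd q))"
    using assms by (intro Fubini_integrable) (auto simp: abs_mult)
  show "integral\<^sup>L (M1 \<Otimes>\<^sub>M M2) (\<lambda>q. f (fst q) * g (snd q)) = integral\<^sup>L M1 f * integral\<^sup>L M2 g"
    using integral_fst'[OF int] by simp
qed

lemma finite_measure_lebesgue_on_interval: "finite_measure (lebesgue_on {a<..<b :: real})"
  by (intro finite_measureI, cases "a \<le> b") (simp_all add: emeasure_restrict_space space_restrict_space)

lemma indicator_measurable_lebesgue_on [measurable]:
  "(indicator {a<..<b :: real} :: real \<Rightarrow> real) \<in> borel_measurable (lebesgue_on {c<..<d})"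
  by (intro measurable_restrict_space1 borel_measurable_indicator) simp

lemma integral_indicator_subinterval:
  fixes f :: "real \<Rightarrow> real"
  assumes "\<alpha> \<le> a" "b \<le> \<beta>"
  shows "integral\<^sup>L (lebesgue_on {\<alpha><..<\<beta>}) (\<lambda>x. indicator {a<..<b} x * f x) =
    integral\<^sup>L (lebesgue_on {a<..<b}) f"
  using integral_open_interval_restrict[OF assms, of "\<lambda>x. indicator {a<..<b} x * f x"]
  by (auto intro: Bochner_Integration.integral_cong)

lemma integrable_indicator_mult:
  fixes f :: "'a \<Rightarrow> real"
  assumes "integrable M f" "\<omega> \<in> borel_measurable M" "\<And>x. 0 \<le> \<omega> x \<and> \<omega> x \<le> 1"
  shows "integrable M (\<lambda>x. \<omega> x * f x)"
  by (rule Bochner_Integration.integrable_bound[OF assms(1)])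
     (use assms in \<open>auto simp: abs_mult intro!: mult_left_le_one_le borel_measurable_times\<close>)

text \<open>Since \<open>p\<close> has mean zero, \<open>v\<close> may be replaced by its difference from its mean value,
  which the double integral controls.\<close>

lemma slobodeckij_moment_le:
  assumes "0 \<le> a" "a < b" "b \<le> T"
    and v: "v \<in> L2_space 0 T"
    and slob: "integrable (lebesgue_on {0<..<T} \<Otimes>\<^sub>M lebesgue_on {0<..<T}) (slobodeckij_integrand \<theta> v)"
    and "\<theta> > 0" and mean: "pint a b p = 0"
  shows "(integral\<^sup>L (lebesgue_on {a<..<b}) (\<lambda>x. v x * poly p x))\<^sup>2 \<le>
    (b - a) powr (2 * \<theta>) * pint a b (p * p) *
    integral\<^sup>L (lebesgue_on {0<..<T} \<Otimes>\<^sub>M lebesgue_on {0<..<T})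
      (\<lambda>q. (indicator {a<..<b} (fst q) * indicator {a<..<b} (snd q)) * slobodeckij_integrand \<theta> v q)"
proof -
  define M where "M = lebesgue_on {0<..<T}"
  define \<omega> where "\<omega> = (indicator {a<..<b} :: real \<Rightarrow> real)"
  interpret finite_measure M
    unfolding M_def by (rule finite_measure_lebesgue_on_interval)
  have pair: "pair_sigma_finite M M" ..
  have vint: "integrable M v"
    using L2_space_integrable[OF v] by (simp add: M_def)
  have [measurable]: "v \<in> borel_measurable M" "\<omega> \<in> borel_measurable M" "poly p \<in> borel_measurable M"
    using vint by (auto simp: M_def \<omega>_def intro: borel_measurable_integrable)
  have [measurable]: "(\<lambda>q. \<bar>fst q - snd q\<bar>) \<in> borel_measurable (M \<Otimes>\<^sub>M M)"
  proof -
    have [measurable]: "(\<lambda>x :: real. x) \<in> borel_measurable M"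
      unfolding M_def by (intro continuous_borel_measurable_open_interval continuous_intros)
    have "(\<lambda>q. fst q) \<in> borel_measurable (M \<Otimes>\<^sub>M M)" "(\<lambda>q. snd q) \<in> borel_measurable (M \<Otimes>\<^sub>M M)"
      by (rule measurable_compose[OF measurable_fst] measurable_compose[OF measurable_snd]; measurable)+
    then show ?thesis
      by measurable
  qed
  have \<omega>: "0 \<le> \<omega> x \<and> \<omega> x \<le> 1" "\<omega> x * \<omega> x = \<omega> x" for x
    by (auto simp: \<omega>_def indicator_def)
  have \<omega>_int: "integral\<^sup>L M (\<lambda>x. \<omega> x * f x) = integral\<^sup>L (lebesgue_on {a<..<b}) f" for f
    unfolding M_def \<omega>_def using assms by (intro integral_indicator_subinterval) auto
  have int_\<omega>: "integrable M (\<lambda>x. \<omega> x * f x)" if "integrable M f" for f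
    using that \<omega>(1) by (intro integrable_indicator_mult) auto
  have int_v: "integrable M (\<lambda>x. \<omega> x * v x)"
    by (rule int_\<omega>[OF vint])
  have int_p: "integrable M (\<lambda>x. \<omega> x * poly q x)" for q
    by (rule int_\<omega>) (simp add: M_def)
  have int_1: "integrable M \<omega>"
    using int_\<omega>[of "\<lambda>_. 1"] by simp
  have "continuous_on {0..T} (poly p)"
    by (intro continuous_intros)
  then have int_vp: "integrable M (\<lambda>x. \<omega> x * (v x * poly p x))"
    using vint unfolding M_def[symmetric] by (intro int_\<omega>) (simp add: M_def integrable_mult_continuous)
  define h where "h = b - a"
  have h: "integral\<^sup>L M \<omega> = h"
    using \<omega>_int[of "\<lambda>_. 1"] assms by (simp add: h_def measure_restrict_space)
  \<comment> \<open>Half of the Slobodeckij exponent: the weight is split between \<open>f\<close>,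
    whose square is the localised integrand of the seminorm, and \<open>g\<close>, so that it
    cancels in \<open>f * g\<close>.\<close>
  define e where "e = (1 + 2 * \<theta>) / 2"
  define f where "f q = \<omega> (fst q) * \<omega> (snd q) * ((v (fst q) - v (snd q)) / \<bar>fst q - snd q\<bar> powr e)" for q
  define g where "g q = \<omega> (fst q) * \<omega> (snd q) * (\<bar>fst q - snd q\<bar> powr e * poly p (fst q))" for q
  have [measurable]: "f \<in> borel_measurable (M \<Otimes>\<^sub>M M)" "g \<in> borel_measurable (M \<Otimes>\<^sub>M M)"
    unfolding f_def g_def by measurable
  have sq: "(\<bar>d\<bar> powr e)\<^sup>2 = \<bar>d\<bar> powr (1 + 2 * \<theta>)" for d :: real
    by (simp add: power2_eq_square e_def flip: powr_add)
  have f2: "(f q)\<^sup>2 = (\<omega> (fst q) * \<omega> (snd q)) * slobodeckij_integrand \<theta> v q" for q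
  proof -
    have "(\<omega> x)\<^sup>2 = \<omega> x" for x
      using \<omega>(2) by (simp only: power2_eq_square)
    then show ?thesis
      by (cases q) (simp add: f_def power_mult_distrib power_divide sq slobodeckij_integrand_def)
  qed
  have fg: "f q * g q = (\<omega> (fst q) * (v (fst q) * poly p (fst q))) * \<omega> (snd q) -
      (\<omega> (fst q) * poly p (fst q)) * (\<omega> (snd q) * v (snd q))" for q
  proof -
    \<comment> \<open>On the diagonal both sides are 0 because of the difference of the values of
      \<open>v\<close>.\<close>
    have "f q * g q = (\<omega> (fst q) * \<omega> (fst q)) * (\<omega> (snd q) * \<omega> (snd q)) *
        (v (fst q) - v (snd q)) * poly p (fst q)"
      by (cases "fst q = snd q") (auto simp: f_def g_def)
    then show ?thesis
      by (simp add: \<omega>(2) algebra_simps)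
  qed
  have g2: "(g q)\<^sup>2 \<le> h powr (1 + 2 * \<theta>) * ((\<omega> (fst q) * poly (p * p) (fst q)) * \<omega> (snd q))" for q
  proof (cases "fst q \<in> {a<..<b} \<and> snd q \<in> {a<..<b}")
    case True
    then have "\<bar>fst q - snd q\<bar> powr (1 + 2 * \<theta>) \<le> h powr (1 + 2 * \<theta>)"
      using \<open>\<theta> > 0\<close> by (intro powr_mono2) (auto simp: h_def)
    then show ?thesis
      using True by (auto simp: g_def \<omega>_def power_mult_distrib sq power2_eq_square[of "poly p _"]
          intro!: mult_right_mono)
  qed (auto simp: g_def \<omega>_def)
  have int_fg: "integrable (M \<Otimes>\<^sub>M M) (\<lambda>q. f q * g q)"
    unfolding fg by (intro Bochner_Integration.integrable_diff integral_product_measure(1) pair int_vp int_1 int_v int_p)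
  \<comment> \<open>Expanding (v x - v y) p x over the square gives h times the moment minus a
    product of two integrals, which vanishes with the mean of \<open>p\<close>.\<close>
  have "integral\<^sup>L (M \<Otimes>\<^sub>M M) (\<lambda>q. f q * g q) =
      integral\<^sup>L M (\<lambda>x. \<omega> x * (v x * poly p x)) * h - integral\<^sup>L M (\<lambda>x. \<omega> x * poly p x) * integral\<^sup>L M (\<lambda>x. \<omega> x * v x)"
    unfolding fg h[symmetric]
    using integral_product_measure[OF pair int_vp int_1] integral_product_measure[OF pair int_p int_v]
    by (subst Bochner_Integration.integral_diff) auto
  also have "integral\<^sup>L M (\<lambda>x. \<omega> x * poly p x) = 0"
    using mean by (simp add: \<omega>_int pint_def)
  finally have fg_eq: "integral\<^sup>L (M \<Otimes>\<^sub>M M) (\<lambda>q. f q * g q) =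
      h * integral\<^sup>L (lebesgue_on {a<..<b}) (\<lambda>x. v x * poly p x)"
    by (simp add: \<omega>_int)
  have int_f2: "integrable (M \<Otimes>\<^sub>M M) (\<lambda>q. (f q)\<^sup>2)"
    unfolding f2 using slob \<omega>
    by (intro integrable_indicator_mult) (auto simp: M_def[symmetric] intro: mult_le_one)
  have int_bound: "integrable (M \<Otimes>\<^sub>M M)
      (\<lambda>q. h powr (1 + 2 * \<theta>) * ((\<omega> (fst q) * poly (p * p) (fst q)) * \<omega> (snd q)))"
    by (intro integrable_mult_right integral_product_measure(1) pair int_p int_1)
  have int_g2: "integrable (M \<Otimes>\<^sub>M M) (\<lambda>q. (g q)\<^sup>2)"
  proof (rule Bochner_Integration.integrable_bound[OF int_bound])
    show "AE q in M \<Otimes>\<^sub>M M. norm ((g q)\<^sup>2) \<le>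
        norm (h powr (1 + 2 * \<theta>) * ((\<omega> (fst q) * poly (p * p) (fst q)) * \<omega> (snd q)))"
    proof (rule AE_I2)
      fix q
      show "norm ((g q)\<^sup>2) \<le> norm (h powr (1 + 2 * \<theta>) * ((\<omega> (fst q) * poly (p * p) (fst q)) * \<omega> (snd q)))"
        unfolding real_norm_def abs_power2 by (rule order_trans[OF g2 abs_ge_self])
    qed
  qed measurable
  have "integral\<^sup>L (M \<Otimes>\<^sub>M M) (\<lambda>q. (g q)\<^sup>2) \<le> integral\<^sup>L (M \<Otimes>\<^sub>M M)
      (\<lambda>q. h powr (1 + 2 * \<theta>) * ((\<omega> (fst q) * poly (p * p) (fst q)) * \<omega> (snd q)))"
    by (rule integral_mono[OF int_g2 int_bound g2])
  also have "\<dots> = h powr (1 + 2 * \<theta>) * (pint a b (p * p) * h)"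
    using integral_product_measure(2)[OF pair int_p[of "p * p"] int_1] by (simp only: integral_mult_right_zero h \<omega>_int pint_def)
  also have "\<dots> = h\<^sup>2 * (h powr (2 * \<theta>) * pint a b (p * p))"
    using assms by (simp add: powr_add h_def power2_eq_square)
  finally have G: "integral\<^sup>L (M \<Otimes>\<^sub>M M) (\<lambda>q. (g q)\<^sup>2) \<le> h\<^sup>2 * (h powr (2 * \<theta>) * pint a b (p * p))" .
  have "(h * integral\<^sup>L (lebesgue_on {a<..<b}) (\<lambda>x. v x * poly p x))\<^sup>2 \<le>
      integral\<^sup>L (M \<Otimes>\<^sub>M M) (\<lambda>q. (f q)\<^sup>2) * integral\<^sup>L (M \<Otimes>\<^sub>M M) (\<lambda>q. (g q)\<^sup>2)"
    unfolding fg_eq[symmetric] by (rule Cauchy_Schwarz_integral[OF int_f2 int_g2 int_fg])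
  also have "\<dots> \<le> integral\<^sup>L (M \<Otimes>\<^sub>M M) (\<lambda>q. (f q)\<^sup>2) * (h\<^sup>2 * (h powr (2 * \<theta>) * pint a b (p * p)))"
    by (rule mult_left_mono[OF G]) simp
  also have "\<dots> = h\<^sup>2 * (h powr (2 * \<theta>) * pint a b (p * p) * integral\<^sup>L (M \<Otimes>\<^sub>M M) (\<lambda>q. (f q)\<^sup>2))"
    by (simp only: mult_ac)
  finally have "h\<^sup>2 * (integral\<^sup>L (lebesgue_on {a<..<b}) (\<lambda>x. v x * poly p x))\<^sup>2 \<le>
      h\<^sup>2 * (h powr (2 * \<theta>) * pint a b (p * p) * integral\<^sup>L (M \<Otimes>\<^sub>M M) (\<lambda>q. (f q)\<^sup>2))"
    by (simp only: power_mult_distrib)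
  then have "(integral\<^sup>L (lebesgue_on {a<..<b}) (\<lambda>x. v x * poly p x))\<^sup>2 \<le>
      h powr (2 * \<theta>) * pint a b (p * p) * integral\<^sup>L (M \<Otimes>\<^sub>M M) (\<lambda>q. (f q)\<^sup>2)"
    using assms by (simp add: h_def)
  then show ?thesis
    by (simp only: f2 h_def \<omega>_def M_def)
qed

text \<open>Derivatives move from the Legendre polynomial to \<open>z\<close> through the Rodrigues
  antiderivatives, whose zeros at the ends remove the boundary terms; the number of moves is limited
  both by the regularity, k - 1, and by r.\<close>

lemma weak_deriv_moment:
  assumes z: "z \<in> sobolev_int \<alpha> \<beta> k" and ab: "\<alpha> \<le> a" "b \<le> \<beta>" and j: "Suc j \<le> k" "j \<le> r"
  shows "integral\<^sup>L (lebesgue_on {a<..<b}) (\<lambda>x. weak_deriv \<alpha> \<beta> z x * poly (legendre a b r) x) =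
    (-1) ^ j * integral\<^sup>L (lebesgue_on {a<..<b})
      (\<lambda>x. (weak_deriv \<alpha> \<beta> ^^ Suc j) z x * poly (rodrigues a b r (r - j)) x)"
  using j
proof (induction j)
  case (Suc j)
  have r: "r - j = Suc (r - Suc j)"
    using Suc.prems by simp
  have L2: "integrable (lebesgue_on {a<..<b}) ((weak_deriv \<alpha> \<beta> ^^ i) z)" if "i \<le> k" for i
    by (rule integrable_open_subinterval[OF L2_space_integrable[OF weak_deriv_funpow_L2[OF z that]] ab])
  have "integral\<^sup>L (lebesgue_on {a<..<b}) (\<lambda>x. (weak_deriv \<alpha> \<beta> ^^ Suc (Suc j)) z x * poly (rodrigues a b r (r - Suc j)) x) =
      - integral\<^sup>L (lebesgue_on {a<..<b}) (\<lambda>x. (weak_deriv \<alpha> \<beta> ^^ Suc j) z x * poly (rodrigues a b r (r - j)) x)"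
    using Suc.prems
    by (intro weak_by_parts_vanishing[OF weak_deriv_funpow_Suc[OF z] ab] L2)
       (auto simp: r rodrigues_Suc rodrigues_end_points simp del: funpow.simps intro!: continuous_intros poly_DERIV)
  then show ?case
    using Suc by simp
qed simp

text \<open>The energy is an integral over the whole interval with an indicator, the form in which
  it is summed over a partition.\<close>

lemma L2_moment_le:
  assumes v: "v \<in> L2_space \<alpha> \<beta>" and ab: "\<alpha> \<le> a" "b \<le> \<beta>"
  shows "(integral\<^sup>L (lebesgue_on {a<..<b}) (\<lambda>x. v x * poly p x))\<^sup>2 \<le>
    pint a b (p * p) * integral\<^sup>L (lebesgue_on {\<alpha><..<\<beta>}) (\<lambda>x. indicator {a<..<b} x * (v x)\<^sup>2)"
proof -
  have p: "(\<lambda>x. (poly p x)\<^sup>2) = poly (p * p)"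
    by (auto simp: power2_eq_square)
  have "integrable (lebesgue_on {a<..<b}) (\<lambda>x. (v x)\<^sup>2)" "integrable (lebesgue_on {a<..<b}) v"
    using v L2_space_integrable[OF v] ab by (auto simp: L2_space_def intro: integrable_open_subinterval)
  moreover have "continuous_on {a..b} (poly p)"
    by (intro continuous_intros)
  ultimately have "(integral\<^sup>L (lebesgue_on {a<..<b}) (\<lambda>x. v x * poly p x))\<^sup>2 \<le>
      integral\<^sup>L (lebesgue_on {a<..<b}) (\<lambda>x. (v x)\<^sup>2) * pint a b (p * p)"
    using Cauchy_Schwarz_integral[of "lebesgue_on {a<..<b}" v "poly p"]
    by (simp only: p pint_def integrable_poly integrable_mult_continuous)
  then show ?thesis
    by (simp add: integral_indicator_subinterval[OF ab] mult.commute)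
qed

lemma sobolev_norm_square_ge:
  assumes "s \<ge> 0"
  shows "j \<le> nat \<lfloor>s\<rfloor> \<Longrightarrow>
      integral\<^sup>L (lebesgue_on {a<..<b}) (\<lambda>x. ((weak_deriv a b ^^ j) u x)\<^sup>2) \<le> (sobolev_norm a b s u)\<^sup>2"
    and "frac s \<noteq> 0 \<Longrightarrow> integral\<^sup>L (lebesgue_on {a<..<b} \<Otimes>\<^sub>M lebesgue_on {a<..<b})
      (slobodeckij_integrand (frac s) ((weak_deriv a b ^^ nat \<lfloor>s\<rfloor>) u)) \<le> (sobolev_norm a b s u)\<^sup>2"
proof -
  define I where "I j = integral\<^sup>L (lebesgue_on {a<..<b}) (\<lambda>x. ((weak_deriv a b ^^ j) u x)\<^sup>2)" for j
  define J where "J = integral\<^sup>L (lebesgue_on {a<..<b} \<Otimes>\<^sub>M lebesgue_on {a<..<b})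
      (slobodeckij_integrand (frac s) ((weak_deriv a b ^^ nat \<lfloor>s\<rfloor>) u))"
  have I: "I j \<ge> 0" for j
    by (simp add: I_def)
  have J: "J \<ge> 0"
    unfolding J_def by (intro Bochner_Integration.integral_nonneg) (auto simp: slobodeckij_integrand_def split: prod.split)
  have norm: "(sobolev_norm a b s u)\<^sup>2 = (\<Sum>j\<le>nat \<lfloor>s\<rfloor>. I j) + (if frac s = 0 then 0 else J)"
    using I J by (simp add: sobolev_norm_def I_def[symmetric] J_def[symmetric] sum_nonneg add_nonneg_nonneg)
  show "I j \<le> (sobolev_norm a b s u)\<^sup>2" if "j \<le> nat \<lfloor>s\<rfloor>" for j
    unfolding norm using I J that by (intro order_trans[OF member_le_sum[of j "{..nat \<lfloor>s\<rfloor>}" I]]) auto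
  show "J \<le> (sobolev_norm a b s u)\<^sup>2" if "frac s \<noteq> 0"
    unfolding norm using I that by (simp add: sum_nonneg)
qed

text \<open>The local energy \<open>e\<close> is the part on the subinterval of the highest order term of the Sobolev
  norm that \<open>r\<close> integrations by parts can reach.\<close>

lemma sobolev_moment_bound:
  assumes s: "s \<ge> 1" and r: "r \<ge> 1" and z: "z \<in> sobolev_space 0 T s"
  obtains e :: "real \<Rightarrow> real \<Rightarrow> real" where
    "\<And>a b. e a b \<ge> 0"
    "\<And>a b. 0 \<le> a \<Longrightarrow> a < b \<Longrightarrow> b \<le> T \<Longrightarrow>
      (integral\<^sup>L (lebesgue_on {a<..<b}) (\<lambda>x. weak_deriv 0 T z x * poly (legendre a b r) x))\<^sup>2 \<le>
      (b - a) powr (2 * min (real r) (s - 1)) * pint a b (legendre a b r * legendre a b r) * e a b"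
    "\<And>N t. is_partition T N t \<Longrightarrow> (\<Sum>n<N. e (t n) (t (Suc n))) \<le> (sobolev_norm 0 T s z)\<^sup>2"
proof -
  define k where "k = nat \<lfloor>s\<rfloor>"
  define v where "v j = (weak_deriv 0 T ^^ j) z" for j
  have k: "k \<ge> 1" "real k \<le> s" "s < real k + 1" "s = real k + frac s"
    using s by (auto simp: k_def frac_def le_nat_iff)
  have z_int: "z \<in> sobolev_int 0 T k"
    using z by (simp add: sobolev_space_def k_def)
  have moment: "(integral\<^sup>L (lebesgue_on {a<..<b}) (\<lambda>x. weak_deriv 0 T z x * poly (legendre a b r) x))\<^sup>2 =
      (integral\<^sup>L (lebesgue_on {a<..<b}) (\<lambda>x. v (Suc j) x * poly (rodrigues a b r (r - j)) x))\<^sup>2"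
    if "0 \<le> a" "b \<le> T" "Suc j \<le> k" "j \<le> r" for a b j
    unfolding weak_deriv_moment[OF z_int that] v_def by (simp add: power_mult_distrib flip: power_mult)
  have power_powr: "(b - a) ^ (2 * j) = (b - a) powr (2 * real j)" if "a < b" for a b :: real and j
    using powr_realpow[of "b - a" "2 * j"] that by simp
  show ?thesis
  proof (cases "frac s = 0 \<or> k > r")
    case True
    \<comment> \<open>In this case plain L2 energies reach the exponent: either all r
      antiderivatives are used, or s is an integer and k - 1 = s - 1.\<close>
    define j where "j = min r (k - 1)"
    have "real k = s \<or> k > r"
      using True k(4) by linarith
    then have j: "Suc j \<le> k" "j \<le> r" "real j = min (real r) (s - 1)"
      using k(1,2) r by (auto simp: j_def min_def of_nat_diff)
    have L2: "v (Suc j) \<in> L2_space 0 T"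
      unfolding v_def by (rule weak_deriv_funpow_L2[OF z_int j(1)])
    define e where "e a b = integral\<^sup>L (lebesgue_on {0<..<T}) (\<lambda>x. indicator {a<..<b} x * (v (Suc j) x)\<^sup>2)" for a b
    show ?thesis
    proof
      show e0: "e a b \<ge> 0" for a b
        by (simp add: e_def)
      show "(integral\<^sup>L (lebesgue_on {a<..<b}) (\<lambda>x. weak_deriv 0 T z x * poly (legendre a b r) x))\<^sup>2 \<le>
          (b - a) powr (2 * min (real r) (s - 1)) * pint a b (legendre a b r * legendre a b r) * e a b"
        if "0 \<le> a" "a < b" "b \<le> T" for a b
        unfolding moment[OF that(1,3) j(1,2)]
        using order_trans[OF L2_moment_le[OF L2 that(1,3)] mult_right_mono[OF pint_rodrigues_le[OF that(2) j(2)] e0, unfolded e_def]]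
        by (simp only: e_def power_powr[OF that(2)] j(3))
      show "(\<Sum>n<N. e (t n) (t (Suc n))) \<le> (sobolev_norm 0 T s z)\<^sup>2" if "is_partition T N t" for N t
      proof -
        have sq: "integrable (lebesgue_on {0<..<T}) (\<lambda>x. (v (Suc j) x)\<^sup>2)"
          using L2 by (simp add: L2_space_def)
        have "(\<Sum>n<N. e (t n) (t (Suc n))) \<le> integral\<^sup>L (lebesgue_on {0<..<T}) (\<lambda>x. (v (Suc j) x)\<^sup>2)"
          unfolding e_def
        proof (rule sum_integral_partition_le[OF that sq, where p = id])
          show "integrable (lebesgue_on {0<..<T}) (\<lambda>x. indicator {t n<..<t (Suc n)} x * (v (Suc j) x)\<^sup>2)" for n
            by (intro integrable_indicator_mult sq) auto
        qed (auto simp: subint_def)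
        also have "\<dots> \<le> (sobolev_norm 0 T s z)\<^sup>2"
          using sobolev_norm_square_ge(1)[of s "Suc j" 0 T z] s j(1) by (simp only: v_def k_def)
        finally show ?thesis .
      qed
    qed
  next
    case False
    \<comment> \<open>All k - 1 integer steps are used and j < r, so an antiderivative of mean zero
      is left, from which the seminorm extracts the remaining exponent
      \<open>\<theta>\<close>.\<close>
    define j where "j = k - 1"
    define \<theta> where "\<theta> = frac s"
    have j: "Suc j = k" "j < r"
      using False k by (auto simp: j_def)
    have \<theta>: "\<theta> > 0" "min (real r) (s - 1) = real j + \<theta>"
      using False k j frac_ge_0[of s] by (auto simp: \<theta>_def min_def)
    have L2: "v k \<in> L2_space 0 T"
      unfolding v_def by (rule weak_deriv_funpow_L2[OF z_int]) simp
    let ?MM = "lebesgue_on {0<..<T} \<Otimes>\<^sub>M lebesgue_on {0<..<T}"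
    have slob: "integrable ?MM (slobodeckij_integrand \<theta> (v k))"
      using z False by (simp add: sobolev_space_def v_def k_def \<theta>_def)
    have slob0: "slobodeckij_integrand \<theta> (v k) q \<ge> 0" for q
      by (auto simp: slobodeckij_integrand_def split: prod.split)
    define e where "e a b = integral\<^sup>L ?MM
        (\<lambda>q. (indicator {a<..<b} (fst q) * indicator {a<..<b} (snd q)) * slobodeckij_integrand \<theta> (v k) q)" for a b
    show ?thesis
    proof
      show e0: "e a b \<ge> 0" for a b
        unfolding e_def by (intro Bochner_Integration.integral_nonneg mult_nonneg_nonneg slob0) auto
      show "(integral\<^sup>L (lebesgue_on {a<..<b}) (\<lambda>x. weak_deriv 0 T z x * poly (legendre a b r) x))\<^sup>2 \<le>
          (b - a) powr (2 * min (real r) (s - 1)) * pint a b (legendre a b r * legendre a b r) * e a b"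
        if ab: "0 \<le> a" "a < b" "b \<le> T" for a b
      proof -
        let ?p = "rodrigues a b r (r - j)" and ?LL = "pint a b (legendre a b r * legendre a b r)"
        have "r - j = Suc (r - Suc j)"
          using j by simp
        then have mean: "pint a b ?p = 0"
          using ab j by (simp add: rodrigues_Suc pint_pderiv rodrigues_end_points)
        have "(integral\<^sup>L (lebesgue_on {a<..<b}) (\<lambda>x. weak_deriv 0 T z x * poly (legendre a b r) x))\<^sup>2 \<le>
            (b - a) powr (2 * \<theta>) * pint a b (?p * ?p) * e a b"
          using moment[OF ab(1,3), of j] j slobodeckij_moment_le[OF ab L2 slob \<theta>(1) mean] by (simp add: e_def)
        also have "\<dots> \<le> (b - a) powr (2 * \<theta>) * ((b - a) ^ (2 * j) * ?LL) * e a b"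
          using ab j by (intro mult_right_mono mult_left_mono e0 pint_rodrigues_le) auto
        also have "\<dots> = (b - a) powr (2 * min (real r) (s - 1)) * ?LL * e a b"
          unfolding \<theta>(2) power_powr[OF ab(2)] by (simp add: powr_add distrib_left)
        finally show ?thesis .
      qed
      show "(\<Sum>n<N. e (t n) (t (Suc n))) \<le> (sobolev_norm 0 T s z)\<^sup>2" if "is_partition T N t" for N t
      proof -
        have "(\<Sum>n<N. e (t n) (t (Suc n))) \<le> integral\<^sup>L ?MM (slobodeckij_integrand \<theta> (v k))"
          unfolding e_def
        proof (rule sum_integral_partition_le[OF that slob slob0, where p = fst])
          show "integrable ?MM (\<lambda>q. (indicator {t n<..<t (Suc n)} (fst q) * indicator {t n<..<t (Suc n)} (snd q)) *
              slobodeckij_integrand \<theta> (v k) q)" for n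
            by (intro integrable_indicator_mult slob) (auto intro: mult_le_one)
        qed (auto simp: subint_def indicator_def)
        also have "\<dots> \<le> (sobolev_norm 0 T s z)\<^sup>2"
          using sobolev_norm_square_ge(2)[of s 0 T z] s \<theta>(1) by (simp add: v_def k_def \<theta>_def)
        finally show ?thesis .
      qed
    qed
  qed
qed

section \<open>The discrete dual problem\<close>

definition legendre_vec :: "real \<Rightarrow> real \<Rightarrow> nat \<Rightarrow> (real^'m \<Rightarrow> real^'m) \<Rightarrow> real^'m \<Rightarrow> 'm \<Rightarrow> real poly" where
  "legendre_vec a b r A \<psi> i = legendre_sum a b r (\<lambda>k. (A ^^ k) \<psi> $ i)"

definition legendre_low_vec :: "real \<Rightarrow> real \<Rightarrow> nat \<Rightarrow> (real^'m \<Rightarrow> real^'m) \<Rightarrow> real^'m \<Rightarrow> 'm \<Rightarrow> real poly" where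
  "legendre_low_vec a b r A \<psi> i = legendre_low a b r (\<lambda>k. (A ^^ k) \<psi> $ i)"

lemma dual_vec_nth: "dual_vec a b r A \<psi> x $ i = poly (legendre_vec a b r A \<psi> i) x"
  by (simp add: dual_vec_def legendre_vec_def legendre_sum_def poly_sum mult.commute)

lemma legendre_vec_split:
  "legendre_vec a b r A \<psi> i = legendre_low_vec a b r A \<psi> i + smult ((A ^^ r) \<psi> $ i) (legendre a b r)"
  by (simp add: legendre_vec_def legendre_low_vec_def legendre_low_def)

lemma legendre_sum_sum:
  "legendre_sum a b r (\<lambda>k. \<Sum>j\<in>S. c j * f j k) = (\<Sum>j\<in>S. smult (c j) (legendre_sum a b r (f j)))"
  by (intro poly_eqI_real)
     (simp add: legendre_sum_def poly_sum sum_distrib_left sum_distrib_right mult_ac sum.swap[of _ S])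

text \<open>The discrete adjoint equation: shifting the weights by one applies \<open>B\<close> to
  them, and subtracting the extra multiple of L turns each sum into its projection.\<close>

lemma pderiv_legendre_vec:
  fixes B :: "real^'m^'m"
  shows "poly (pderiv (legendre_vec a b r ((*v) B) \<psi> i)) x =
    (B *v (\<chi> j. poly (legendre_low_vec a b r ((*v) B) \<psi> j) x)) $ i"
proof -
  let ?A = "(*v) B"
  have "pderiv (legendre_vec a b r ?A \<psi> i) =
      legendre_sum a b r (\<lambda>k. \<Sum>j\<in>UNIV. B $ i $ j * (?A ^^ k) \<psi> $ j) -
      smult (\<Sum>j\<in>UNIV. B $ i $ j * (?A ^^ r) \<psi> $ j) (legendre a b r)"
    by (simp add: legendre_vec_def pderiv_legendre_sum matrix_vector_mult_def)
  also have "\<dots> = (\<Sum>j\<in>UNIV. smult (B $ i $ j) (legendre_low_vec a b r ?A \<psi> j))"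
    by (simp add: legendre_sum_sum legendre_low_vec_def legendre_low_def smult_sum smult_diff_right sum_subtractf)
  finally show ?thesis
    by (simp add: poly_sum matrix_vector_mult_def)
qed

text \<open>The derivative of |\<phi>|^2 is twice the inner product of \<phi> and \<phi>'. As
  \<phi>' has degree below r, \<phi> may be replaced by its projection P \<phi>, and \<phi>' = B P
  \<phi> makes the integral nonnegative. The dual problem is thus stable backwards in time.\<close>

lemma norm_dual_vec_le:
  fixes B :: "real^'m^'m"
  assumes "a < b" "r > 0" "\<And>x. x \<bullet> (B *v x) \<ge> 0"
  shows "norm (dual_vec a b r ((*v) B) \<psi> a) \<le> norm (dual_vec a b r ((*v) B) \<psi> b)"
proof -
  let ?\<Phi> = "legendre_vec a b r ((*v) B) \<psi>" and ?p = "legendre_low_vec a b r ((*v) B) \<psi>" and ?L = "legendre a b r"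
  have "degree (pderiv (?\<Phi> i)) < r" for i
    using degree_legendre_sum[of a b r "\<lambda>k. ((*v) B ^^ k) \<psi> $ i"] assms(2)
    unfolding degree_pderiv legendre_vec_def by linarith
  then have orth: "pint a b (?L * pderiv (?\<Phi> i)) = 0" for i
    using assms(1) by (intro rodrigues_orthogonal) auto
  have "(norm (dual_vec a b r ((*v) B) \<psi> b))\<^sup>2 - (norm (dual_vec a b r ((*v) B) \<psi> a))\<^sup>2 =
      (\<Sum>i\<in>UNIV. poly (?\<Phi> i * ?\<Phi> i) b - poly (?\<Phi> i * ?\<Phi> i) a)"
    by (simp add: power2_norm_eq_inner inner_vec_def dual_vec_nth sum_subtractf)
  also have "\<dots> = (\<Sum>i\<in>UNIV. pint a b (pderiv (?\<Phi> i * ?\<Phi> i)))"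
    using assms(1) by (simp only: pint_pderiv less_imp_le)
  also have "\<dots> = (\<Sum>i\<in>UNIV. 2 * pint a b (?p i * pderiv (?\<Phi> i)))"
  proof (rule sum.cong)
    fix i
    have "pint a b (pderiv (?\<Phi> i * ?\<Phi> i)) = 2 * pint a b (?\<Phi> i * pderiv (?\<Phi> i))"
      unfolding pderiv_mult pint_add by simp
    also have "?\<Phi> i * pderiv (?\<Phi> i) = ?p i * pderiv (?\<Phi> i) + smult (((*v) B ^^ r) \<psi> $ i) (?L * pderiv (?\<Phi> i))"
      by (subst (1) legendre_vec_split) (simp add: distrib_right)
    finally show "pint a b (pderiv (?\<Phi> i * ?\<Phi> i)) = 2 * pint a b (?p i * pderiv (?\<Phi> i))"
      by (simp add: pint_add pint_smult orth)
  qed simp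
  also have "\<dots> = 2 * pint a b (\<Sum>i\<in>UNIV. ?p i * pderiv (?\<Phi> i))"
  proof -
    have "pint a b (sum f S) = (\<Sum>i\<in>S. pint a b (f i))" for f and S :: "'m set"
      by (induction S rule: infinite_finite_induct) (auto simp: pint_add)
    then show ?thesis
      by (simp add: sum_distrib_left)
  qed
  also have "\<dots> \<ge> 0"
  proof -
    have "poly (\<Sum>i\<in>UNIV. ?p i * pderiv (?\<Phi> i)) x \<ge> 0" for x
      using assms(3)[of "\<chi> j. poly (?p j) x"]
      by (simp add: poly_sum pderiv_legendre_vec inner_vec_def)
    then show ?thesis
      by (simp add: pint_nonneg)
  qed
  finally have "(norm (dual_vec a b r ((*v) B) \<psi> a))\<^sup>2 \<le> (norm (dual_vec a b r ((*v) B) \<psi> b))\<^sup>2"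
    by simp
  then show ?thesis
    by (rule power2_le_imp_le) simp
qed

text \<open>The lower bound makes the linear map from \<psi> to the terminal value injective, and in
  finite dimension it is then onto. This admits the nodal error itself as terminal value.\<close>

lemma dual_vec_surj:
  fixes B :: "real^'m^'m"
  assumes "a < b" "r > 0" "\<And>x. x \<bullet> (B *v x) \<ge> 0"
  obtains \<psi> where "dual_vec a b r ((*v) B) \<psi> b = v"
proof -
  have pow: "linear ((*v) B ^^ k)" for k
  proof (induction k)
    case (Suc k)
    then show ?case
      unfolding funpow.simps by (intro linear_compose matrix_vector_mul_linear)
  qed (simp add: linear_iff)
  have lin: "linear (\<lambda>\<psi>. dual_vec a b r ((*v) B) \<psi> b)"
    unfolding dual_vec_def by (intro linear_compose_sum ballI linear_compose_scale_right pow)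
  have "\<bar>poly (legendre a b r) b\<bar> > 0"
    using legendre_end_point[OF assms(1,2)] pint_square_pos[OF assms(1) legendre_nonzero[of a b r]]
    by (auto simp: zero_less_mult_iff)
  then have c: "\<bar>poly (legendre a b r) b\<bar> * (2 / (b - a)) ^ r > 0"
    using assms(1) by simp
  have "inj (\<lambda>\<psi>. dual_vec a b r ((*v) B) \<psi> b)"
    unfolding linear_injective_0[OF lin]
  proof (intro allI impI)
    fix \<psi>
    assume "dual_vec a b r ((*v) B) \<psi> b = 0"
    then have "\<bar>poly (legendre a b r) b\<bar> * (2 / (b - a)) ^ r * norm \<psi> \<le> 0"
      using norm_dual_vec_ge[OF assms(1,2) matrix_vector_mul_linear assms(3), of \<psi>] by simp
    then show "\<psi> = 0"
      using c by (metis linorder_not_le mult_pos_pos zero_less_norm_iff)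
  qed
  then have "surj (\<lambda>\<psi>. dual_vec a b r ((*v) B) \<psi> b)"
    using lin linear_injective_imp_surjective by blast
  then show ?thesis
    using that by (metis surjD)
qed

lemma integrable_inner_poly:
  fixes f q :: "real \<Rightarrow> real^'m"
  assumes "\<And>i. integrable (lebesgue_on {a<..<b}) (\<lambda>x. f x $ i)" "vec_poly_on m {a<..<b} q"
  shows "integrable (lebesgue_on {a<..<b}) (\<lambda>x. f x \<bullet> q x)"
proof -
  obtain p where p: "\<And>i x. x \<in> {a<..<b} \<Longrightarrow> q x $ i = poly (p i) x"
    using assms(2) unfolding vec_poly_on_def by blast
  have "integrable (lebesgue_on {a<..<b}) (\<lambda>x. f x $ i * poly (p i) x)" for i
    by (intro integrable_mult_continuous assms(1) continuous_intros)
  then have "integrable (lebesgue_on {a<..<b}) (\<lambda>x. f x $ i * q x $ i)" for i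
    by (rule Bochner_Integration.integrable_cong[THEN iffD1, rotated -1]) (auto simp: p)
  then show ?thesis
    by (simp add: inner_vec_def)
qed

lemma inner_minus_transpose: "x \<bullet> (- transpose D *v y) = - ((D *v x) \<bullet> y)" for D :: "real^'m^'m"
proof -
  have "(- transpose D) *v y = - (y v* D)"
    by (simp add: vec_eq_iff matrix_vector_mult_def vector_matrix_mult_def transpose_def sum_negf mult.commute)
  then show ?thesis
    by (simp add: inner_commute[of x] dot_lmul_matrix inner_commute[of y])
qed

text \<open>On one subinterval the discrete dual solution \<open>\<phi>\<close> satisfies \<open>\<phi>' = - D\<^sup>T P \<phi>\<close>, where \<open>P\<close> is the
  local projection, so only the component of \<open>\<phi>\<close> along the highest Legendre polynomial sees the residual.\<close>

lemma galerkin_dual_identity: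
  fixes D :: "real^'m^'m" and \<psi> :: "real^'m"
  assumes ab: "0 \<le> a" "a < b" "b \<le> T" and r: "r \<ge> 1"
    and R: "R \<in> L2_vec 0 T" and Y: "solves_ode T D R Y0 Y"
    and X: "continuous_on {a..b} X"
    and der: "\<And>x. x \<in> {a<..<b} \<Longrightarrow> (X has_vector_derivative (D *v PY x + PR x)) (at x)"
    and PY: "vec_poly_on (r - 1) {a<..<b} PY"
      "\<And>q. vec_poly_on (r - 1) {a<..<b} q \<Longrightarrow>
        integral\<^sup>L (lebesgue_on {a<..<b}) (\<lambda>x. PY x \<bullet> q x) = integral\<^sup>L (lebesgue_on {a<..<b}) (\<lambda>x. X x \<bullet> q x)"
    and PR: "vec_poly_on (r - 1) {a<..<b} PR"
      "\<And>q. vec_poly_on (r - 1) {a<..<b} q \<Longrightarrow>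
        integral\<^sup>L (lebesgue_on {a<..<b}) (\<lambda>x. PR x \<bullet> q x) = integral\<^sup>L (lebesgue_on {a<..<b}) (\<lambda>x. R x \<bullet> q x)"
  defines "A \<equiv> (*v) (- transpose D)"
  defines "\<phi> \<equiv> dual_vec a b r A \<psi>"
  shows "(Y b - X b) \<bullet> \<phi> b = (Y a - X a) \<bullet> \<phi> a +
    integral\<^sup>L (lebesgue_on {a<..<b}) (\<lambda>x. (D *v Y x + R x) \<bullet> ((A ^^ r) \<psi>) * poly (legendre a b r) x)"
proof -
  let ?M = "lebesgue_on {a<..<b}" and ?L = "legendre a b r"
  define \<Phi> where "\<Phi> = legendre_vec a b r A \<psi>"
  define p where "p = legendre_low_vec a b r A \<psi>"
  define \<phi>' p1 where "\<phi>' = (\<lambda>x. \<chi> i. poly (pderiv (\<Phi> i)) x)" and "p1 = (\<lambda>x. \<chi> i. poly (p i) x)"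
  define F G where "F = (\<lambda>x. D *v Y x + R x)" and "G = (\<lambda>x. D *v PY x + PR x)"
  define w where "w = (A ^^ r) \<psi>"
  have \<phi>'_eq: "\<phi>' x = A (p1 x)" for x
    by (simp add: vec_eq_iff \<phi>'_def p1_def \<Phi>_def p_def A_def pderiv_legendre_vec)
  have \<phi>_eq: "\<phi> x = p1 x + poly ?L x *\<^sub>R w" for x
    by (simp add: vec_eq_iff \<phi>_def p1_def p_def w_def dual_vec_nth legendre_vec_split mult.commute)
  have adj: "y \<bullet> \<phi>' x + (D *v y) \<bullet> p1 x = 0" for x y
    unfolding \<phi>'_eq A_def inner_minus_transpose by simp
  have poly_p1: "vec_poly_on (r - 1) {a<..<b} p1"
    unfolding vec_poly_on_def
  proof (intro exI[of _ p] allI conjI ballI)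
    show "degree (p i) \<le> r - 1" for i
      using degree_legendre_low[of r a b "\<lambda>k. (A ^^ k) \<psi> $ i"] r
      unfolding p_def legendre_low_vec_def by linarith
  qed (simp add: p1_def)
  have poly_\<phi>': "vec_poly_on (r - 1) {a<..<b} \<phi>'"
    unfolding vec_poly_on_def
  proof (intro exI[of _ "\<lambda>i. pderiv (\<Phi> i)"] allI conjI ballI)
    show "degree (pderiv (\<Phi> i)) \<le> r - 1" for i
      unfolding degree_pderiv \<Phi>_def legendre_vec_def by (intro diff_le_mono degree_legendre_sum)
  qed (simp add: \<phi>'_def)
  have poly_\<phi>: "vec_poly_on r {a<..<b} \<phi>"
    unfolding vec_poly_on_def \<phi>_def dual_vec_nth \<Phi>_def[symmetric]
  proof (intro exI[of _ \<Phi>] allI conjI ballI refl)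
    show "degree (\<Phi> i) \<le> r" for i
      unfolding \<Phi>_def legendre_vec_def by (rule degree_legendre_sum)
  qed
  have cY: "continuous_on {a..b} (\<lambda>x. Y x $ i)" for i
  proof -
    have "continuous_on {a..b} Y"
      by (rule continuous_on_subset[of "{0..T}"]) (use Y ab in \<open>simp_all add: solves_ode_def\<close>)
    then show ?thesis
      by (intro continuous_intros)
  qed
  have cX: "continuous_on {a..b} (\<lambda>x. X x $ i)" for i
    by (intro continuous_intros X)
  have R_int: "integrable ?M (\<lambda>x. R x $ i)" for i
  proof -
    have "(\<lambda>x. R x $ i) \<in> L2_space 0 T"
      using R by (simp add: L2_vec_def)
    then show ?thesis
      by (rule integrable_open_subinterval[OF L2_space_integrable ab(1,3)])
  qed
  have Y_int: "integrable ?M (\<lambda>x. Y x $ i)" and X_int: "integrable ?M (\<lambda>x. X x $ i)" for i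
    by (intro continuous_integrable_open_interval cY cX)+
  have poly_int: "integrable ?M (\<lambda>x. q x $ i)" if q: "vec_poly_on m {a<..<b} q" for q :: "real \<Rightarrow> real^'m" and m i
  proof -
    obtain u where "\<And>i x. x \<in> {a<..<b} \<Longrightarrow> q x $ i = poly (u i) x"
      using q unfolding vec_poly_on_def by blast
    then show ?thesis
      by (intro Bochner_Integration.integrable_cong[THEN iffD1, OF refl _ integrable_poly[of a b "u i"]]) simp
  qed
  have DM_int: "integrable ?M (\<lambda>x. (D *v f x) $ i)" if "\<And>j. integrable ?M (\<lambda>x. f x $ j)" for f i
    unfolding matrix_vector_mult_def using that by simp
  have F_int: "integrable ?M (\<lambda>x. F x $ i)" and G_int: "integrable ?M (\<lambda>x. G x $ i)" for i
    unfolding F_def G_def vector_add_component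
    by (intro Bochner_Integration.integrable_add DM_int Y_int R_int poly_int[OF PY(1)] poly_int[OF PR(1)])+
  note inner_int = integrable_inner_poly[OF _ poly_p1] integrable_inner_poly[OF _ poly_\<phi>'] integrable_inner_poly[OF _ poly_\<phi>]
  have L_int: "integrable ?M (\<lambda>x. f x \<bullet> w * poly ?L x)" if "\<And>i. integrable ?M (\<lambda>x. f x $ i)" for f
  proof -
    have "integrable ?M (\<lambda>x. f x \<bullet> w)"
      unfolding inner_vec_def using that by simp
    then show ?thesis
      by (intro integrable_mult_continuous continuous_intros)
  qed
  \<comment> \<open>Used twice, with (\<open>Y\<close>, \<open>R\<close>) and with the discrete
    counterparts (\<open>PY\<close>, \<open>PR\<close>): by \<open>adj\<close> the operator drops
    out of the low-degree part.\<close>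
  have split: "y \<bullet> \<phi>' x + (D *v y + z) \<bullet> \<phi> x = z \<bullet> p1 x + (D *v y + z) \<bullet> w * poly ?L x" for x y z
    using adj[of y x] by (simp add: \<phi>_eq inner_add_left inner_add_right algebra_simps)

  have "Y b \<bullet> \<phi> b - Y a \<bullet> \<phi> a = (\<Sum>i\<in>UNIV. Y b $ i * poly (\<Phi> i) b - Y a $ i * poly (\<Phi> i) a)"
    by (simp add: inner_vec_def \<phi>_def \<Phi>_def dual_vec_nth sum_subtractf)
  also have "\<dots> = (\<Sum>i\<in>UNIV. integral\<^sup>L ?M (\<lambda>x. Y x $ i * poly (pderiv (\<Phi> i)) x + F x $ i * poly (\<Phi> i) x))"
  proof (intro sum.cong refl weak_by_parts_continuous[symmetric, OF _ ab(1,3,2) cY F_int])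
    show "has_weak_derivative 0 T (\<lambda>x. Y x $ i) (\<lambda>x. F x $ i)" for i
      using Y by (simp add: solves_ode_def F_def)
  qed (auto intro!: poly_DERIV continuous_intros)
  also have "\<dots> = integral\<^sup>L ?M (\<lambda>x. Y x \<bullet> \<phi>' x + F x \<bullet> \<phi> x)"
    by (subst Bochner_Integration.integral_sum[symmetric])
       (auto simp: inner_vec_def \<phi>'_def \<phi>_def \<Phi>_def dual_vec_nth sum.distrib
         intro!: Bochner_Integration.integrable_add integrable_mult_continuous Y_int F_int continuous_intros)
  also have "\<dots> = integral\<^sup>L ?M (\<lambda>x. R x \<bullet> p1 x + F x \<bullet> w * poly ?L x)"
    by (simp only: F_def split)
  also have "\<dots> = integral\<^sup>L ?M (\<lambda>x. R x \<bullet> p1 x) + integral\<^sup>L ?M (\<lambda>x. F x \<bullet> w * poly ?L x)"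
    by (intro Bochner_Integration.integral_add inner_int L_int R_int F_int)
  finally have eq_Y: "Y b \<bullet> \<phi> b - Y a \<bullet> \<phi> a =
      integral\<^sup>L ?M (\<lambda>x. R x \<bullet> p1 x) + integral\<^sup>L ?M (\<lambda>x. F x \<bullet> w * poly ?L x)" .

  \<comment> \<open>The discrete right-hand side has degree at most r - 1 and is therefore
    orthogonal to L; the exact one is not.\<close>
  have G_orth: "integral\<^sup>L ?M (\<lambda>x. G x \<bullet> w * poly ?L x) = 0"
  proof -
    obtain u v where u: "\<And>i. degree (u i) \<le> r - 1" "\<And>i x. x \<in> {a<..<b} \<Longrightarrow> PY x $ i = poly (u i) x"
      and v: "\<And>i. degree (v i) \<le> r - 1" "\<And>i x. x \<in> {a<..<b} \<Longrightarrow> PR x $ i = poly (v i) x"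
      using PY(1) PR(1) unfolding vec_poly_on_def by metis
    define g where "g = (\<Sum>i\<in>UNIV. smult (w $ i) ((\<Sum>j\<in>UNIV. smult (D $ i $ j) (u j)) + v i))"
    have "degree g \<le> r - 1"
      unfolding g_def using u(1) v(1)
      by (intro degree_sum_le order_trans[OF degree_smult_le] degree_add_le) auto
    then have "pint a b (?L * g) = 0"
      using r ab by (intro rodrigues_orthogonal) auto
    moreover have "integral\<^sup>L ?M (\<lambda>x. G x \<bullet> w * poly ?L x) = pint a b (?L * g)"
      unfolding pint_def
      by (intro Bochner_Integration.integral_cong)
         (auto simp: G_def g_def inner_vec_def matrix_vector_mult_def poly_sum u v mult_ac)
    ultimately show ?thesis
      by simp
  qed
  \<comment> \<open>\<open>X\<close> is known to be differentiable only inside the subinterval and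
    continuous up to its ends, hence the interior form of the fundamental theorem.\<close>
  have "X b \<bullet> \<phi> b - X a \<bullet> \<phi> a = integral {a..b} (\<lambda>x. X x \<bullet> \<phi>' x + G x \<bullet> \<phi> x)"
  proof (rule integral_unique[symmetric], rule fundamental_theorem_of_calculus_interior)
    have "continuous_on {a..b} \<phi>"
      unfolding continuous_on_vec_lambda dual_vec_nth \<phi>_def dual_vec_def by (intro continuous_intros)
    then show "continuous_on {a..b} (\<lambda>x. X x \<bullet> \<phi> x)"
      by (intro continuous_intros X)
    fix x
    assume "x \<in> {a<..<b}"
    have "((\<lambda>x. X x $ i * poly (\<Phi> i) x) has_real_derivative X x $ i * poly (pderiv (\<Phi> i)) x + G x $ i * poly (\<Phi> i) x) (at x)" for i
    proof -
      have "((\<lambda>x. X x $ i) has_real_derivative G x $ i) (at x)"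
        using bounded_linear.has_vector_derivative[OF bounded_linear_vec_nth der[OF \<open>x \<in> {a<..<b}\<close>], of i]
        by (simp add: has_real_derivative_iff_has_vector_derivative G_def)
      from DERIV_mult[OF this poly_DERIV[of "\<Phi> i"]] show ?thesis
        by (simp add: algebra_simps)
    qed
    then have "((\<lambda>x. \<Sum>i\<in>UNIV. X x $ i * poly (\<Phi> i) x) has_real_derivative
        (\<Sum>i\<in>UNIV. X x $ i * poly (pderiv (\<Phi> i)) x + G x $ i * poly (\<Phi> i) x)) (at x)"
      by (intro DERIV_sum)
    then show "((\<lambda>x. X x \<bullet> \<phi> x) has_vector_derivative (X x \<bullet> \<phi>' x + G x \<bullet> \<phi> x)) (at x)"
      by (simp add: inner_vec_def \<phi>_def \<phi>'_def \<Phi>_def dual_vec_nth sum.distrib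
          has_real_derivative_iff_has_vector_derivative)
  qed (use ab in auto)
  also have "\<dots> = integral\<^sup>L ?M (\<lambda>x. X x \<bullet> \<phi>' x + G x \<bullet> \<phi> x)"
    by (subst lebesgue_integral_eq_integral)
       (auto simp: integral_open_interval_real intro!: Bochner_Integration.integrable_add inner_int X_int G_int)
  also have "\<dots> = integral\<^sup>L ?M (\<lambda>x. X x \<bullet> \<phi>' x) + integral\<^sup>L ?M (\<lambda>x. G x \<bullet> \<phi> x)"
    by (intro Bochner_Integration.integral_add inner_int X_int G_int)
  \<comment> \<open>\<phi>' has degree at most r - 1, so \<open>X\<close> may be replaced by its
    projection, which is what the discrete equation involves.\<close>
  also have "\<dots> = integral\<^sup>L ?M (\<lambda>x. PY x \<bullet> \<phi>' x) + integral\<^sup>L ?M (\<lambda>x. G x \<bullet> \<phi> x)"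
    by (simp only: PY(2)[OF poly_\<phi>'])
  also have "\<dots> = integral\<^sup>L ?M (\<lambda>x. PY x \<bullet> \<phi>' x + G x \<bullet> \<phi> x)"
    by (intro Bochner_Integration.integral_add[symmetric] inner_int poly_int[OF PY(1)] G_int)
  also have "\<dots> = integral\<^sup>L ?M (\<lambda>x. PR x \<bullet> p1 x + G x \<bullet> w * poly ?L x)"
    by (simp only: G_def split)
  also have "\<dots> = integral\<^sup>L ?M (\<lambda>x. PR x \<bullet> p1 x) + integral\<^sup>L ?M (\<lambda>x. G x \<bullet> w * poly ?L x)"
    by (intro Bochner_Integration.integral_add inner_int L_int poly_int[OF PR(1)] G_int)
  also have "\<dots> = integral\<^sup>L ?M (\<lambda>x. R x \<bullet> p1 x)"
    by (simp add: G_orth PR(2)[OF poly_p1])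
  finally have eq_X: "X b \<bullet> \<phi> b - X a \<bullet> \<phi> a = integral\<^sup>L ?M (\<lambda>x. R x \<bullet> p1 x)" .
  show ?thesis
    using eq_X eq_Y by (simp add: inner_diff_left F_def w_def)
qed

section \<open>Transfer of the operator powers to the exact solution\<close>

lemma inner_funpow_minus_transpose:
  fixes D :: "real^'m^'m"
  shows "y \<bullet> (((*v) (- transpose D)) ^^ k) \<psi> = (-1) ^ k * ((((*v) D) ^^ k) y \<bullet> \<psi>)"
proof (induction k arbitrary: y)
  case (Suc k)
  have "y \<bullet> (((*v) (- transpose D)) ^^ Suc k) \<psi> = - ((D *v y) \<bullet> (((*v) (- transpose D)) ^^ k) \<psi>)"
    by (simp add: inner_minus_transpose)
  then show ?case
    unfolding Suc.IH by (simp add: funpow_swap1)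
qed simp

text \<open>\<open>weak_deriv\<close> of a component of D^r Y is a chosen function with no pointwise
  relation to \<open>D *v Y x + R x\<close>. Both moments are therefore integrated by parts onto
  \<open>p\<close>; what remains involves values of \<open>Y\<close> only, where the powers of
  \<open>D\<close> cross the inner product pointwise.\<close>

lemma dual_moment:
  fixes D :: "real^'m^'m" and \<psi> :: "real^'m"
  assumes ab: "0 \<le> a" "a < b" "b \<le> T" and s: "s \<ge> 1"
    and R: "R \<in> L2_vec 0 T" and Y: "solves_ode T D R Y0 Y"
    and Z: "(\<lambda>x. (((*v) D) ^^ r) (Y x)) \<in> sobolev_vec 0 T s"
  shows "integral\<^sup>L (lebesgue_on {a<..<b}) (\<lambda>x. (D *v Y x + R x) \<bullet> (((*v) (- transpose D)) ^^ r) \<psi> * poly p x) =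
    (-1) ^ r * (\<psi> \<bullet> (\<chi> i. integral\<^sup>L (lebesgue_on {a<..<b})
      (\<lambda>x. weak_deriv 0 T (\<lambda>x. (((*v) D) ^^ r) (Y x) $ i) x * poly p x)))"
proof -
  let ?M = "lebesgue_on {a<..<b}"
  define w where "w = (((*v) (- transpose D)) ^^ r) \<psi>"
  define z where "z i x = (((*v) D) ^^ r) (Y x) $ i" for i x
  define F where "F x = D *v Y x + R x" for x
  have parts: "integral\<^sup>L ?M (\<lambda>x. v x * poly p x) =
      u b * poly p b - u a * poly p a - integral\<^sup>L ?M (\<lambda>x. u x * poly (pderiv p) x)"
    if weak: "has_weak_derivative 0 T u v" and u: "continuous_on {a..b} u" and v: "integrable ?M v" for u v
  proof -
    have "integral\<^sup>L ?M (\<lambda>x. u x * poly (pderiv p) x + v x * poly p x) = u b * poly p b - u a * poly p a"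
      by (rule weak_by_parts_continuous[OF weak ab(1,3,2) u v]) (auto intro!: poly_DERIV continuous_intros)
    moreover have "integrable ?M (\<lambda>x. u x * poly (pderiv p) x)" "integrable ?M (\<lambda>x. v x * poly p x)"
      by (intro continuous_integrable_open_interval integrable_mult_continuous u v continuous_intros)+
    ultimately show ?thesis
      by simp
  qed
  have cY: "continuous_on {a..b} Y"
    by (rule continuous_on_subset[of "{0..T}"]) (use Y ab in \<open>simp_all add: solves_ode_def\<close>)
  have cY': "continuous_on {a..b} (\<lambda>x. Y x $ i)" for i
    by (intro continuous_intros cY)
  have "linear (((*v) D) ^^ k)" for k
  proof (induction k)
    case (Suc k)
    then show ?case
      unfolding funpow.simps by (intro linear_compose matrix_vector_mul_linear)
  qed (simp add: linear_iff)
  then have "continuous_on {a..b} (\<lambda>x. (((*v) D) ^^ r) (Y x))"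
    by (rule linear_continuous_on_compose[OF cY])
  then have cz: "continuous_on {a..b} (z i)" for i
    unfolding z_def by (intro continuous_intros)
  have F_int: "integrable ?M (\<lambda>x. F x $ i)" for i
  proof -
    have "(\<lambda>x. R x $ i) \<in> L2_space 0 T"
      using R by (simp add: L2_vec_def)
    then have "integrable ?M (\<lambda>x. R x $ i)"
      by (rule integrable_open_subinterval[OF L2_space_integrable ab(1,3)])
    moreover have "continuous_on {a..b} (\<lambda>x. (D *v Y x) $ i)"
      unfolding matrix_vector_mult_def vec_lambda_beta by (intro continuous_intros cY)
    ultimately show ?thesis
      unfolding F_def vector_add_component
      by (intro Bochner_Integration.integrable_add) (auto intro: continuous_integrable_open_interval)
  qed
  have z_sob: "z i \<in> sobolev_int 0 T (nat \<lfloor>s\<rfloor>)" for i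
    using Z by (simp add: sobolev_vec_def sobolev_space_def z_def[abs_def])
  have "1 \<le> nat \<lfloor>s\<rfloor>"
    using s by (simp add: le_nat_iff)
  then have weak_z: "has_weak_derivative 0 T (z i) (weak_deriv 0 T (z i))"
    and "weak_deriv 0 T (z i) \<in> L2_space 0 T" for i
    using weak_deriv_funpow_Suc[OF z_sob, of 0] weak_deriv_funpow_L2[OF z_sob, of 1] s by simp_all
  then have z'_int: "integrable ?M (weak_deriv 0 T (z i))" for i
    by (intro integrable_open_subinterval[OF L2_space_integrable ab(1,3)])
  have dual: "(\<Sum>i\<in>UNIV. w $ i * (Y x $ i)) = (-1) ^ r * (\<Sum>i\<in>UNIV. \<psi> $ i * z i x)" for x
    using inner_funpow_minus_transpose[where y = "Y x" and D = D and k = r and \<psi> = \<psi>]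
    by (simp add: w_def z_def inner_vec_def mult.commute)
  have comb: "(\<Sum>i\<in>UNIV. c $ i * (u i b * poly p b - u i a * poly p a - integral\<^sup>L ?M (\<lambda>x. u i x * poly (pderiv p) x))) =
      (\<Sum>i\<in>UNIV. c $ i * u i b) * poly p b - (\<Sum>i\<in>UNIV. c $ i * u i a) * poly p a -
      integral\<^sup>L ?M (\<lambda>x. (\<Sum>i\<in>UNIV. c $ i * u i x) * poly (pderiv p) x)"
    if u: "\<And>i. continuous_on {a..b} (u i)" for u and c :: "real^'m"
  proof -
    have "integrable ?M (\<lambda>x. c $ i * (u i x * poly (pderiv p) x))" for i
      by (intro continuous_integrable_open_interval continuous_intros u)
    then have "integral\<^sup>L ?M (\<lambda>x. (\<Sum>i\<in>UNIV. c $ i * u i x) * poly (pderiv p) x) =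
        (\<Sum>i\<in>UNIV. c $ i * integral\<^sup>L ?M (\<lambda>x. u i x * poly (pderiv p) x))"
      unfolding sum_distrib_right mult.assoc by (subst Bochner_Integration.integral_sum) auto
    then show ?thesis
      by (simp add: right_diff_distrib sum_subtractf sum_distrib_right mult.assoc)
  qed
  have "integral\<^sup>L ?M (\<lambda>x. F x \<bullet> w * poly p x) = (\<Sum>i\<in>UNIV. w $ i * integral\<^sup>L ?M (\<lambda>x. F x $ i * poly p x))"
  proof -
    have "integrable ?M (\<lambda>x. w $ i * (F x $ i * poly p x))" for i
      by (intro integrable_mult_right integrable_mult_continuous F_int continuous_intros)
    moreover have "F x \<bullet> w * poly p x = (\<Sum>i\<in>UNIV. w $ i * (F x $ i * poly p x))" for x
      by (simp add: inner_vec_def sum_distrib_left mult_ac)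
    ultimately show ?thesis
      by (simp add: Bochner_Integration.integral_sum)
  qed
  also have "\<dots> = (\<Sum>i\<in>UNIV. w $ i * (Y b $ i * poly p b - Y a $ i * poly p a -
      integral\<^sup>L ?M (\<lambda>x. Y x $ i * poly (pderiv p) x)))"
    using Y by (intro sum.cong refl arg_cong2[of _ _ _ _ "(*)"] parts cY' F_int) (simp add: solves_ode_def F_def)
  also have "\<dots> = (-1) ^ r * (\<Sum>i\<in>UNIV. \<psi> $ i * (z i b * poly p b - z i a * poly p a -
      integral\<^sup>L ?M (\<lambda>x. z i x * poly (pderiv p) x)))"
    unfolding comb[OF cY'] comb[OF cz] dual by (simp add: right_diff_distrib mult.assoc)
  also have "\<dots> = (-1) ^ r * (\<Sum>i\<in>UNIV. \<psi> $ i * integral\<^sup>L ?M (\<lambda>x. weak_deriv 0 T (z i) x * poly p x))"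
    by (simp only: parts[OF weak_z cz z'_int])
  finally show ?thesis
    by (simp add: F_def w_def z_def[abs_def] inner_vec_def)
qed

text \<open>For the dual solution with the error as terminal value, the left-hand side is |e|^2 and
  each term on the right is bounded by a multiple of |e|; dividing gives a one-step bound with
  factor 1.\<close>

lemma norm_step_from_duality:
  fixes e :: "'v :: real_inner" and m :: "'w :: real_inner"
  assumes "e \<bullet> e = d \<bullet> \<phi> + c * (\<psi> \<bullet> m)" "\<bar>c\<bar> = 1" "K \<ge> 0"
    and "norm \<phi> \<le> norm e" "norm \<psi> \<le> K * norm e"
  shows "norm e \<le> norm d + K * norm m"
proof (cases "e = 0")
  case False
  have "norm e * norm e = e \<bullet> e"
    by (simp add: dot_square_norm power2_eq_square)
  also have "\<dots> \<le> norm d * norm \<phi> + \<bar>c * (\<psi> \<bullet> m)\<bar>"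
    unfolding assms(1) by (intro add_mono norm_cauchy_schwarz abs_ge_self)
  also have "\<bar>c * (\<psi> \<bullet> m)\<bar> \<le> norm \<psi> * norm m"
    using assms(2) Cauchy_Schwarz_ineq2[of \<psi> m] by (simp add: abs_mult)
  also have "norm d * norm \<phi> + norm \<psi> * norm m \<le> norm d * norm e + (K * norm e) * norm m"
    using assms by (intro add_mono mult_left_mono mult_right_mono) auto
  finally have "norm e * norm e \<le> norm e * (norm d + K * norm m)"
    by (simp add: algebra_simps)
  then show ?thesis
    using False by simp
qed (use assms in simp)

lemma half_power_le_powr:
  assumes "s > 0"
  obtains C where "C > 0" "\<And>r. r \<ge> 1 \<Longrightarrow> (1 / 2) ^ r \<le> C / real r powr s"
proof
  \<comment> \<open>The maximum of x^s 2^(-x), attained at x = s/ln 2; the bound is ln y <= y - 1 at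
    y = r ln 2/s.\<close>
  let ?C = "exp (- s - s * ln (ln 2 / s))"
  show "?C > 0"
    by simp
  fix r :: nat
  assume r: "r \<ge> 1"
  have "ln (real r * (ln 2 / s)) \<le> real r * (ln 2 / s) - 1"
    using r assms by (intro ln_le_minus_one) auto
  then have "ln (real r) \<le> real r * (ln 2 / s) - 1 - ln (ln 2 / s)"
  proof -
    have "ln (real r * (ln 2 / s)) = ln (real r) + ln (ln 2 / s)"
      by (rule ln_mult_pos) (use r assms in auto)
    then show ?thesis
      using \<open>ln (real r * (ln 2 / s)) \<le> real r * (ln 2 / s) - 1\<close> by linarith
  qed
  then have "s * ln (real r) \<le> s * (real r * (ln 2 / s) - 1 - ln (ln 2 / s))"
    using assms by (intro mult_left_mono) auto
  also have "\<dots> = real r * ln 2 + (- s - s * ln (ln 2 / s))"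
    using assms by (simp add: algebra_simps)
  finally have "real r powr s \<le> exp (real r * ln 2) * ?C"
    using r by (simp add: powr_def flip: exp_add)
  also have "exp (real r * ln 2) = 2 ^ r"
    by (simp add: exp_of_nat_mult)
  finally show "(1 / 2) ^ r \<le> ?C / real r powr s"
    using r by (simp add: field_simps power_one_over)
qed

lemma mesh_size_ge: "n < N \<Longrightarrow> t (Suc n) - t n \<le> mesh_size N t"
  unfolding mesh_size_def by (intro Max_ge) auto

theorem theorem2p2:
  fixes s :: real
  assumes "s \<ge> 1"
  shows "\<exists>C>0. \<forall>(T::real) (D::real^'m^'m) (R::real \<Rightarrow> real^'m) (Y0::real^'m) (Y::real \<Rightarrow> real^'m)
           (r::nat) (N::nat) (t::nat \<Rightarrow> real) (Yr::real \<Rightarrow> real^'m).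
         T > 0 \<longrightarrow>
         neg_semidef (D + transpose D) \<longrightarrow>
         R \<in> L2_vec 0 T \<longrightarrow>
         solves_ode T D R Y0 Y \<longrightarrow>
         r \<ge> 1 \<longrightarrow>
         (\<lambda>x. (((*v) D) ^^ r) (Y x)) \<in> sobolev_vec 0 T s \<longrightarrow>
         is_partition T N t \<longrightarrow>
         galerkin_solution T D R Y0 N t r Yr \<longrightarrow>
         Max ((\<lambda>n. norm (Y (t n) - Yr (t n))) ` {1..N})
           \<le> C * T powr (1/2)
               * (mesh_size N t powr min (2 * real r) (s + real r - 1) / real r powr s)
               * sobolev_vec_norm 0 T s (\<lambda>x. (((*v) D) ^^ r) (Y x))"
proof -
  obtain C where C: "C > 0" "\<And>r. r \<ge> 1 \<Longrightarrow> (1 / 2) ^ r \<le> C / real r powr s"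
    using half_power_le_powr[of s] assms by auto
  show ?thesis
  proof (intro exI[of _ C] conjI allI impI C(1))
    fix T :: real and D :: "real^'m^'m" and R :: "real \<Rightarrow> real^'m" and Y0 :: "real^'m"
      and Y :: "real \<Rightarrow> real^'m" and r N :: nat and t :: "nat \<Rightarrow> real" and Yr :: "real \<Rightarrow> real^'m"
    assume "T > 0" and D: "neg_semidef (D + transpose D)" and R: "R \<in> L2_vec 0 T"
      and Y: "solves_ode T D R Y0 Y" and r: "r \<ge> 1"
      and Z: "(\<lambda>x. (((*v) D) ^^ r) (Y x)) \<in> sobolev_vec 0 T s"
      and part: "is_partition T N t" and Yr: "galerkin_solution T D R Y0 N t r Yr"
    define B where "B = - transpose D"
    define z where "z i x = (((*v) D) ^^ r) (Y x) $ i" for i x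
    \<comment> \<open>The order in the step size splits: \<open>\<mu>\<close> comes from the moment
      of D^r Y, and r from the size of \<psi>.\<close>
    define \<mu> where "\<mu> = min (real r) (s - 1)"
    define \<rho> where "\<rho> = min (2 * real r) (s + real r - 1)"
    define \<tau> where "\<tau> = mesh_size N t"
    have \<rho>: "\<rho> = real r + \<mu>" "\<rho> \<ge> 0"
      using r assms by (auto simp: \<rho>_def \<mu>_def min_def)
    have accretive: "x \<bullet> (B *v x) \<ge> 0" for x
    proof -
      have "x \<bullet> (D *v x) + x \<bullet> (transpose D *v x) \<le> 0"
        using D by (simp add: neg_semidef_def matrix_vector_mult_add_rdistrib inner_add_right)
      moreover have "x \<bullet> (transpose D *v x) = x \<bullet> (D *v x)"
        by (metis dot_lmul_matrix inner_commute transpose_matrix_vector)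
      ultimately show ?thesis
        unfolding B_def inner_minus_transpose by (simp add: inner_commute)
    qed
    obtain PY PR where PY: "is_local_proj N t (r - 1) Yr PY" and PR: "is_local_proj N t (r - 1) R PR"
      and der: "\<And>n x. n < N \<Longrightarrow> x \<in> subint t n \<Longrightarrow> (Yr has_vector_derivative (D *v PY x + PR x)) (at x)"
      using Yr unfolding galerkin_solution_def by blast
    have cont: "continuous_on {0..T} Yr" and init: "Y 0 = Yr 0"
      using Yr Y by (auto simp: galerkin_solution_def V_space_def solves_ode_def)
    define Q where "Q i e \<longleftrightarrow> (\<forall>a b. e a b \<ge> 0) \<and>
        (\<forall>a b. 0 \<le> a \<longrightarrow> a < b \<longrightarrow> b \<le> T \<longrightarrow>
          (integral\<^sup>L (lebesgue_on {a<..<b}) (\<lambda>x. weak_deriv 0 T (z i) x * poly (legendre a b r) x))\<^sup>2 \<le>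
          (b - a) powr (2 * \<mu>) * pint a b (legendre a b r * legendre a b r) * e a b) \<and>
        (\<Sum>n<N. e (t n) (t (Suc n))) \<le> (sobolev_norm 0 T s (z i))\<^sup>2" for i and e :: "real \<Rightarrow> real \<Rightarrow> real"
    have "\<exists>e. Q i e" for i
    proof -
      have "z i \<in> sobolev_space 0 T s"
        using Z by (simp add: sobolev_vec_def z_def[abs_def])
      then obtain e where e: "\<And>a b. e a b \<ge> 0"
        "\<And>a b. 0 \<le> a \<Longrightarrow> a < b \<Longrightarrow> b \<le> T \<Longrightarrow>
          (integral\<^sup>L (lebesgue_on {a<..<b}) (\<lambda>x. weak_deriv 0 T (z i) x * poly (legendre a b r) x))\<^sup>2 \<le>
          (b - a) powr (2 * min (real r) (s - 1)) * pint a b (legendre a b r * legendre a b r) * e a b"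
        "\<And>N t. is_partition T N t \<Longrightarrow> (\<Sum>n<N. e (t n) (t (Suc n))) \<le> (sobolev_norm 0 T s (z i))\<^sup>2"
        using sobolev_moment_bound[OF assms r] by blast
      have "Q i e"
        unfolding Q_def \<mu>_def by (intro conjI allI impI e part)
      then show ?thesis
        by blast
    qed
    then obtain e where "\<And>i. Q i (e i)"
      using choice[of Q] by blast
    then have e_nonneg: "\<And>i a b. e i a b \<ge> 0"
      and e_moment: "\<And>i a b. 0 \<le> a \<Longrightarrow> a < b \<Longrightarrow> b \<le> T \<Longrightarrow>
        (integral\<^sup>L (lebesgue_on {a<..<b}) (\<lambda>x. weak_deriv 0 T (z i) x * poly (legendre a b r) x))\<^sup>2 \<le>
        (b - a) powr (2 * \<mu>) * pint a b (legendre a b r * legendre a b r) * e i a b"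
      and e_sum: "\<And>i. (\<Sum>n<N. e i (t n) (t (Suc n))) \<le> (sobolev_norm 0 T s (z i))\<^sup>2"
      unfolding Q_def by blast+
    define h where "h n = t (Suc n) - t n" for n
    define \<epsilon> where "\<epsilon> n = (\<Sum>i\<in>UNIV. e i (t n) (t (Suc n)))" for n
    have \<epsilon>: "\<epsilon> n \<ge> 0" for n
      by (simp add: \<epsilon>_def sum_nonneg e_nonneg)
    have step: "norm (Y (t (Suc n)) - Yr (t (Suc n))) \<le> norm (Y (t n) - Yr (t n)) +
        (1 / 2) ^ r * \<tau> powr \<rho> * (sqrt (h n) * sqrt (\<epsilon> n))" if n: "n < N" for n
    proof -
      define a b where "a = t n" and "b = t (Suc n)"
      have ab: "0 \<le> a" "a < b" "b \<le> T"
        using partition_bounds[OF part n] by (auto simp: a_def b_def)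
      have sub: "subint t n = {a<..<b}"
        by (simp add: subint_def a_def b_def)
      have r0: "r > 0"
        using r by simp
      let ?L = "legendre a b r"
      define l where "l = \<bar>poly ?L b\<bar>"
      define H where "H = b - a"
      have H: "H > 0" "H = h n" "H \<le> \<tau>"
        using ab mesh_size_ge[OF n, of t] by (auto simp: H_def h_def a_def b_def \<tau>_def)
      have LL: "H * l\<^sup>2 = (2 * real r + 1) * pint a b (?L * ?L)"
        using legendre_end_point[OF ab(2) r0] by (simp add: l_def H_def)
      have LL0: "pint a b (?L * ?L) > 0"
        by (rule pint_square_pos[OF ab(2) legendre_nonzero])
      then have "H * l\<^sup>2 > 0"
        unfolding LL by (intro mult_pos_pos) auto
      then have l: "l > 0"
        using H by (auto simp: l_def zero_less_mult_iff)
      \<comment> \<open>The reciprocal of the factor \<open>l * (2 / H) ^ r\<close> in the lower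
        bound for the terminal value.\<close>
      define K where "K = (H / 2) ^ r / l"
      have K: "K \<ge> 0"
        using H l by (simp add: K_def)
      define m where "m = (\<chi> i. integral\<^sup>L (lebesgue_on {a<..<b}) (\<lambda>x. weak_deriv 0 T (z i) x * poly ?L x))"
      obtain \<psi> where \<psi>: "dual_vec a b r ((*v) B) \<psi> b = Y b - Yr b"
        using dual_vec_surj[OF ab(2) r0 accretive] by blast
      have "l * (2 / H) ^ r * norm \<psi> \<le> norm (Y b - Yr b)"
        using norm_dual_vec_ge[OF ab(2) r0 matrix_vector_mul_linear accretive, of \<psi>]
        unfolding \<psi> l_def H_def .
      then have norm_\<psi>: "norm \<psi> \<le> K * norm (Y b - Yr b)"
        using l H by (simp add: K_def field_simps power_divide)
      have "(Y b - Yr b) \<bullet> (Y b - Yr b) =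
          (Y a - Yr a) \<bullet> dual_vec a b r ((*v) B) \<psi> a + (-1) ^ r * (\<psi> \<bullet> m)"
      proof -
        have cont': "continuous_on {a..b} Yr"
          by (rule continuous_on_subset[OF cont]) (use ab in auto)
        have proj:
          "vec_poly_on (r - 1) {a<..<b} PY" "vec_poly_on (r - 1) {a<..<b} PR"
          "\<And>q. vec_poly_on (r - 1) {a<..<b} q \<Longrightarrow>
            integral\<^sup>L (lebesgue_on {a<..<b}) (\<lambda>x. PY x \<bullet> q x) = integral\<^sup>L (lebesgue_on {a<..<b}) (\<lambda>x. Yr x \<bullet> q x)"
          "\<And>q. vec_poly_on (r - 1) {a<..<b} q \<Longrightarrow>
            integral\<^sup>L (lebesgue_on {a<..<b}) (\<lambda>x. PR x \<bullet> q x) = integral\<^sup>L (lebesgue_on {a<..<b}) (\<lambda>x. R x \<bullet> q x)"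
          using PY PR n unfolding is_local_proj_def sub[symmetric] by blast+
        have "(Y b - Yr b) \<bullet> dual_vec a b r ((*v) B) \<psi> b =
            (Y a - Yr a) \<bullet> dual_vec a b r ((*v) B) \<psi> a +
            integral\<^sup>L (lebesgue_on {a<..<b}) (\<lambda>x. (D *v Y x + R x) \<bullet> (((*v) B) ^^ r) \<psi> * poly ?L x)"
          unfolding B_def
          by (rule galerkin_dual_identity[OF ab r R Y cont' der[OF n, unfolded sub] proj(1,3,2,4)])
        then show ?thesis
          unfolding \<psi> unfolding m_def z_def[abs_def] B_def dual_moment[OF ab assms R Y Z] .
      qed
      then have "norm (Y b - Yr b) \<le> norm (Y a - Yr a) + K * norm m"
        by (rule norm_step_from_duality[OF _ _ K])
           (use norm_dual_vec_le[OF ab(2) r0 accretive, of \<psi>] norm_\<psi> in \<open>simp_all add: \<psi> power_abs\<close>)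
      also have "norm m \<le> H powr \<mu> * (sqrt H * l) * sqrt (\<epsilon> n)"
      proof (rule power2_le_imp_le)
        have "(norm m)\<^sup>2 = (\<Sum>i\<in>UNIV. (m $ i)\<^sup>2)"
          unfolding power2_norm_eq_inner inner_vec_def by (simp add: power2_eq_square)
        also have "\<dots> \<le> (\<Sum>i\<in>UNIV. H powr (2 * \<mu>) * pint a b (?L * ?L) * e i a b)"
          unfolding m_def vec_lambda_beta H_def by (intro sum_mono e_moment ab)
        also have "\<dots> = H powr (2 * \<mu>) * pint a b (?L * ?L) * \<epsilon> n"
          by (simp add: \<epsilon>_def a_def b_def sum_distrib_left)
        \<comment> \<open>By \<open>LL\<close> the squared norm of L is at most H l^2; the factor 2
          r + 1 is given away.\<close>
        also have "\<dots> \<le> H powr (2 * \<mu>) * (H * l\<^sup>2) * \<epsilon> n"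
          unfolding LL using LL0 \<epsilon> by (intro mult_right_mono mult_left_mono) auto
        also have "H powr (2 * \<mu>) = (H powr \<mu>)\<^sup>2"
          by (simp add: power2_eq_square flip: powr_add)
        finally show "(norm m)\<^sup>2 \<le> (H powr \<mu> * (sqrt H * l) * sqrt (\<epsilon> n))\<^sup>2"
          using H \<epsilon> by (simp add: power_mult_distrib)
        show "0 \<le> H powr \<mu> * (sqrt H * l) * sqrt (\<epsilon> n)"
          using H l \<epsilon> by simp
      qed
      then have "K * norm m \<le> K * (H powr \<mu> * (sqrt H * l) * sqrt (\<epsilon> n))"
        using K by (rule mult_left_mono)
      \<comment> \<open>\<open>l\<close> cancels and \<open>H^r\<close> joins
        \<open>H^\<mu>\<close>, leaving \<open>2^(-r)\<close> as a surplus.\<close>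
      also have "\<dots> = (1 / 2) ^ r * H powr \<rho> * (sqrt H * sqrt (\<epsilon> n))"
        using H l by (simp add: K_def \<rho>(1) powr_add powr_realpow power_divide)
      also have "\<dots> \<le> (1 / 2) ^ r * \<tau> powr \<rho> * (sqrt H * sqrt (\<epsilon> n))"
        using H \<rho>(2) \<epsilon> by (intro mult_right_mono mult_left_mono powr_mono2) auto
      finally show ?thesis
        by (simp add: a_def b_def H(2))
    qed
    \<comment> \<open>The initial error is zero, and each step adds to the error without amplifying
      it.\<close>
    have bound: "norm (Y (t n) - Yr (t n)) \<le>
        (\<Sum>j<n. (1 / 2) ^ r * \<tau> powr \<rho> * (sqrt (h j) * sqrt (\<epsilon> j)))" if "n \<le> N" for n
      using that
    proof (induction n)
      case 0
      then show ?case
        using part init by (simp add: is_partition_def)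
    next
      case (Suc n)
      then show ?case
        using step[of n] by simp
    qed
    have h: "h n \<ge> 0" if "n < N" for n
      using partition_bounds[OF part that] by (simp add: h_def)
    \<comment> \<open>Cauchy-Schwarz over the subintervals; the lengths add up to T, and the
      energies, after exchanging the sums, to at most the squared Sobolev norm.\<close>
    have "(\<Sum>j<N. sqrt (h j) * sqrt (\<epsilon> j)) \<le> sqrt T * sobolev_vec_norm 0 T s (\<lambda>x. (((*v) D) ^^ r) (Y x))"
    proof -
      have "(\<Sum>j<N. sqrt (h j) * sqrt (\<epsilon> j)) = (\<Sum>j<N. \<bar>sqrt (h j)\<bar> * \<bar>sqrt (\<epsilon> j)\<bar>)"
        using h \<epsilon> by (intro sum.cong) auto
      also have "\<dots> \<le> L2_set (\<lambda>j. sqrt (h j)) {..<N} * L2_set (\<lambda>j. sqrt (\<epsilon> j)) {..<N}"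
        by (rule L2_set_mult_ineq)
      also have "\<dots> = sqrt (\<Sum>j<N. h j) * sqrt (\<Sum>j<N. \<epsilon> j)"
        using h \<epsilon> by (simp add: L2_set_def)
      also have "(\<Sum>j<N. h j) = T"
        using part by (simp add: h_def sum_lessThan_telescope is_partition_def)
      also have "(\<Sum>j<N. \<epsilon> j) \<le> (\<Sum>i\<in>UNIV. (sobolev_norm 0 T s (z i))\<^sup>2)"
        unfolding \<epsilon>_def by (subst sum.swap) (intro sum_mono e_sum)
      finally show ?thesis
        using \<open>T > 0\<close> by (simp add: sobolev_vec_norm_def z_def[abs_def] mult_left_mono)
    qed
    note sum_bound = this
    show "Max ((\<lambda>n. norm (Y (t n) - Yr (t n))) ` {1..N})
           \<le> C * T powr (1/2)
               * (mesh_size N t powr min (2 * real r) (s + real r - 1) / real r powr s)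
               * sobolev_vec_norm 0 T s (\<lambda>x. (((*v) D) ^^ r) (Y x))" (is "_ \<le> ?rhs")
    proof (rule Max.boundedI)
      show "(\<lambda>n. norm (Y (t n) - Yr (t n))) ` {1..N} \<noteq> {}"
        using part by (simp add: is_partition_def)
      fix y
      assume "y \<in> (\<lambda>n. norm (Y (t n) - Yr (t n))) ` {1..N}"
      then obtain n where n: "n \<le> N" "y = norm (Y (t n) - Yr (t n))"
        by auto
      have "y \<le> (\<Sum>j<n. (1 / 2) ^ r * \<tau> powr \<rho> * (sqrt (h j) * sqrt (\<epsilon> j)))"
        using bound n by simp
      also have "\<dots> \<le> (\<Sum>j<N. (1 / 2) ^ r * \<tau> powr \<rho> * (sqrt (h j) * sqrt (\<epsilon> j)))"
        using n(1) h \<epsilon> by (intro sum_mono2) auto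
      also have "\<dots> = (1 / 2) ^ r * \<tau> powr \<rho> * (\<Sum>j<N. sqrt (h j) * sqrt (\<epsilon> j))"
        by (simp add: sum_distrib_left)
      also have "\<dots> \<le> C / real r powr s * \<tau> powr \<rho> *
          (sqrt T * sobolev_vec_norm 0 T s (\<lambda>x. (((*v) D) ^^ r) (Y x)))"
        using C r sum_bound h \<epsilon> by (intro mult_mono mult_right_mono) (auto intro!: sum_nonneg)
      also have "\<dots> = ?rhs"
        using \<open>T > 0\<close> by (simp add: \<tau>_def \<rho>_def powr_half_sqrt)
      finally show "y \<le> ?rhs" .
    qed simp
  qed
qed

end
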